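(* In the setting described in the context, let $\{(\bm{u}_h^n,\xi_h^n,p_h^n)\}_{n=2}^N$ be the solution of the monolithic BDF-2 scheme and, for $i\ge 1$, let $\{(\bm{u}_{h,f}^{n,i},\xi_{h,f}^{n,i},p_{h,f}^{n,i})\}_{n=2}^N$ be the $i$-th iterate of the global-in-time iterative decoupled BDF-2 algorithm, with the same data at the time levels $n=0,1$ and arbitrary initial guesses $\{\xi_{h,f}^{n,0}\}_{n=2}^N\subset W_h$. Define $e_{\bm{u},f}^{n,i}:=\bm{u}_{h,f}^{n,i}-\bm{u}_h^n$, $e_{\xi,f}^{n,i}:=\xi_{h,f}^{n,i}-\xi_h^n$, $e_{p,f}^{n,i}:=p_{h,f}^{n,i}-p_h^n$ (all taken to be zero for $n=0,1$). Then there is a constant $C(\tilde\beta,\mu)>0$, depending only on $\tilde\beta$ and $\mu$, such that with $$K=\frac{1}{\left(\frac{c_0\lambda}{\alpha^2}+1\right)\left(C(\tilde\beta,\mu)\lambda+1\right)}$$ one has $K<1$ and, for all $i\ge1$, $$\sum_{n=2}^N\|\mathbb{D}_t^2 e_{\xi,f}^{n,i}\|_{L^2}^2\le K^2\sum_{n=2}^N\|\mathbb{D}_t^2 e_{\xi,f}^{n,i-1}\|_{L^2}^2 ,$$ so that the iteration is contractive. Moreover the algorithm is globally convergent: for any initial guesses, $e_{\bm{u},f}^{n,i}$, $e_{\xi,f}^{n,i}$ and $e_{p,f}^{n,i}$ converge to zero as $i\to\infty$ for each $n=2,\dots,N$.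
   Context: **Domain and parameters.** $\Omega\subset\mathbb{R}^d$ ($d=2$ or $3$) is a bounded polygonal (polyhedral) domain, with $\partial\Omega=\Gamma_u\cup\Gamma_\sigma=\Gamma_p\cup\Gamma_q$, $\Gamma_u\cap\Gamma_\sigma=\emptyset$, $\Gamma_p\cap\Gamma_q=\emptyset$, all four parts having positive measure. Parameters: $\lambda,\mu,\alpha,k_p>0$ and $c_0\ge0$. $T<\infty$ is the final time; $\bm{f}$ and $g$ are given, sufficiently regular functions on $\Omega\times[0,T]$. $(\cdot,\cdot)$ is the $L^2(\Omega)$ inner product and $\varepsilon(\bm{u})=\frac12[\nabla\bm{u}+(\nabla\bm{u})^T]$. **Bilinear forms.** $a_1(\bm{u},\bm{v})=2\mu\int_\Omega\varepsilon(\bm{u}):\varepsilon(\bm{v})$, $b(\bm{v},w)=\int_\Omega w\,\nabla\cdot\bm{v}$, $a_2(\xi,w)=\frac1\lambda\int_\Omega\xi w$, $c(p,w)=\frac\alpha\lambda\int_\Omega pw$, $a_3(p,q)=\left(c_0+\frac{\alpha^2}{\lambda}\right)\int_\Omega pq$, $d(p,q)=k_p\int_\Omega\nabla p\cdot\nabla q$. **Discrete spaces.** $\mathcal{T}_h$ is a mesh of $\Omega$ by triangles/tetrahedra with maximum element diameter $h$; $k\ge2$ and $l\ge1$ are integers. $\bm{V}_h=\{\bm{v}_h\in [H^1(\Omega)]^d\cap [C^0(\bar\Omega)]^d:\bm{v}_h|_{\Gamma_u}=\bm{0},\ \bm{v}_h|_E\in[P_k(E)]^d\ \forall E\in\mathcal{T}_h\}$,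 $W_h=\{w_h\in L^2(\Omega)\cap C^0(\bar\Omega):w_h|_E\in P_{k-1}(E)\ \forall E\in\mathcal{T}_h\}$, $M_h=\{q_h\in H^1(\Omega)\cap C^0(\bar\Omega):q_h|_{\Gamma_p}=0,\ q_h|_E\in P_l(E)\ \forall E\in\mathcal{T}_h\}$. The discrete inf-sup condition holds: there is $\tilde\beta>0$ independent of $h$ with $\sup_{\bm{0}\ne\bm{v}_h\in\bm{V}_h} b(\bm{v}_h,w_h)/\|\bm{v}_h\|_{H^1}\ge\tilde\beta\|w_h\|_{L^2}$ for all $w_h\in W_h$. **Time discretization.** $\Delta t=T/N$, $t^n=n\Delta t$, $\bm{f}^n=\bm{f}(t^n)$, $g^n=g(t^n)$, and $\mathbb{D}_t^2y^n=\frac1{\Delta t}\left(\frac32y^n-2y^{n-1}+\frac12y^{n-2}\right)$. For doubly indexed sequences $y^{n,i}$, $\mathbb{D}_t^2$ acts on the time index $n$ with $i$ fixed. **Monolithic BDF-2 scheme.** Given $\xi_h^0,\xi_h^1\in W_h$ and $p_h^0,p_h^1\in M_h$, for $n=2,\dots,N$ find $(\bm{u}_h^n,\xi_h^n,p_h^n)\in\bm{V}_h\times W_h\times M_h$ such that for all $(\bm{v}_h,w_h,q_h)\in\bm{V}_h\times W_h\times M_h$: $a_1(\bm{u}_h^n,\bm{v}_h)-b(\bm{v}_h,\xi_h^n)=(\bm{f}^n,\bm{v}_h)$, $b(\bm{u}_h^n,w_h)+a_2(\xi_h^n,w_h)-c(p_h^n,w_h)=0$, $a_3(\mathbb{D}_t^2p_h^n,q_h)-c(q_h,\mathbb{D}_t^2\xi_h^n)+d(p_h^n,q_h)=(g^n,q_h)$.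 **Global-in-time iterative decoupled BDF-2 algorithm.** Given initial guesses $\{\xi_{h,f}^{n,0}\}_{n=2}^N\subset W_h$, for $i=1,2,\dots$ set $p_{h,f}^{n,i}=p_h^n$ and $\xi_{h,f}^{n,i-1}=\xi_h^n$ for $n=0,1$, and perform: Step a: find $\{p_{h,f}^{n,i}\}_{n=2}^N\subset M_h$ with $a_3(\mathbb{D}_t^2p_{h,f}^{n,i},q_h)+d(p_{h,f}^{n,i},q_h)=(g^n,q_h)+c(q_h,\mathbb{D}_t^2\xi_{h,f}^{n,i-1})$ for all $q_h\in M_h$. Step b: find $\{(\bm{u}_{h,f}^{n,i},\xi_{h,f}^{n,i})\}_{n=2}^N\subset\bm{V}_h\times W_h$ with $a_1(\bm{u}_{h,f}^{n,i},\bm{v}_h)-b(\bm{v}_h,\xi_{h,f}^{n,i})=(\bm{f}^n,\bm{v}_h)$ for all $\bm{v}_h\in\bm{V}_h$ and $b(\bm{u}_{h,f}^{n,i},w_h)+a_2(\xi_{h,f}^{n,i},w_h)=c(p_{h,f}^{n,i},w_h)$ for all $w_h\in W_h$. *)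

theory Defs
  imports "HOL-Analysis.Analysis"
begin

section \<open>Lebesgue and Sobolev spaces on an open set\<close>

definition in_L2 :: "(real^'n) set \<Rightarrow> (real^'n \<Rightarrow> 'b::euclidean_space) \<Rightarrow> bool" where
  "in_L2 \<Omega> f \<longleftrightarrow> f \<in> borel_measurable (lebesgue_on \<Omega>) \<and>
     integrable (lebesgue_on \<Omega>) (\<lambda>x. (norm (f x))\<^sup>2)"

text \<open>For matrix-valued functions, the inner product of the type \<open>real^'n^'n\<close> is the
  Frobenius product \<open>A : B\<close>.\<close>

definition L2_inner ::
    "(real^'n) set \<Rightarrow> (real^'n \<Rightarrow> 'b::euclidean_space) \<Rightarrow> (real^'n \<Rightarrow> 'b) \<Rightarrow> real" where
  "L2_inner \<Omega> f g = (\<integral>x. f x \<bullet> g x \<partial>lebesgue_on \<Omega>)"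

definition L2_norm :: "(real^'n) set \<Rightarrow> (real^'n \<Rightarrow> 'b::euclidean_space) \<Rightarrow> real" where
  "L2_norm \<Omega> f = sqrt (L2_inner \<Omega> f f)"

definition classical_grad :: "(real^'n \<Rightarrow> real) \<Rightarrow> real^'n \<Rightarrow> real^'n" where
  "classical_grad \<phi> x = (\<chi> i. frechet_derivative \<phi> (at x) (axis i 1))"

text \<open>Test functions are \<open>C\<^sup>1\<close> with compact support in \<open>\<Omega>\<close>; for first-order derivatives of
  locally integrable functions this gives the same weak derivatives as smooth test functions.\<close>

definition test_function :: "(real^'n) set \<Rightarrow> (real^'n \<Rightarrow> real) \<Rightarrow> bool" where
  "test_function \<Omega> \<phi> \<longleftrightarrow> (\<forall>x. \<phi> differentiable (at x)) \<and>
     continuous_on UNIV (classical_grad \<phi>) \<and>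
     (\<exists>K. compact K \<and> K \<subseteq> \<Omega> \<and> (\<forall>x. x \<notin> K \<longrightarrow> \<phi> x = 0))"

definition has_weak_grad ::
    "(real^'n) set \<Rightarrow> (real^'n \<Rightarrow> real) \<Rightarrow> (real^'n \<Rightarrow> real^'n) \<Rightarrow> bool" where
  "has_weak_grad \<Omega> f G \<longleftrightarrow> (\<forall>\<phi>. test_function \<Omega> \<phi> \<longrightarrow>
     (\<integral>x. f x *\<^sub>R classical_grad \<phi> x \<partial>lebesgue_on \<Omega>) = - (\<integral>x. \<phi> x *\<^sub>R G x \<partial>lebesgue_on \<Omega>))"

definition in_H1 :: "(real^'n) set \<Rightarrow> (real^'n \<Rightarrow> real) \<Rightarrow> bool" where
  "in_H1 \<Omega> f \<longleftrightarrow> in_L2 \<Omega> f \<and> (\<exists>G. in_L2 \<Omega> G \<and> has_weak_grad \<Omega> f G)"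

text \<open>The weak gradient is unique only up to null sets; \<open>weak_grad\<close> selects a representative.\<close>

definition weak_grad :: "(real^'n) set \<Rightarrow> (real^'n \<Rightarrow> real) \<Rightarrow> real^'n \<Rightarrow> real^'n" where
  "weak_grad \<Omega> f = (SOME G. in_L2 \<Omega> G \<and> has_weak_grad \<Omega> f G)"

definition in_H1_vec :: "(real^'n) set \<Rightarrow> (real^'n \<Rightarrow> real^'n) \<Rightarrow> bool" where
  "in_H1_vec \<Omega> u \<longleftrightarrow> (\<forall>i. in_H1 \<Omega> (\<lambda>x. u x $ i))"

definition weak_jacobian ::
    "(real^'n) set \<Rightarrow> (real^'n \<Rightarrow> real^'n) \<Rightarrow> real^'n \<Rightarrow> real^'n^'n" where
  "weak_jacobian \<Omega> u x = (\<chi> i. weak_grad \<Omega> (\<lambda>y. u y $ i) x)"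

definition divergence :: "(real^'n) set \<Rightarrow> (real^'n \<Rightarrow> real^'n) \<Rightarrow> real^'n \<Rightarrow> real" where
  "divergence \<Omega> u x = trace (weak_jacobian \<Omega> u x)"

definition strain :: "(real^'n) set \<Rightarrow> (real^'n \<Rightarrow> real^'n) \<Rightarrow> real^'n \<Rightarrow> real^'n^'n" where
  "strain \<Omega> u x = (1/2) *\<^sub>R (weak_jacobian \<Omega> u x + transpose (weak_jacobian \<Omega> u x))"

definition H1_norm :: "(real^'n) set \<Rightarrow> (real^'n \<Rightarrow> real) \<Rightarrow> real" where
  "H1_norm \<Omega> f = sqrt ((L2_norm \<Omega> f)\<^sup>2 + (L2_norm \<Omega> (weak_grad \<Omega> f))\<^sup>2)"

definition H1_norm_vec :: "(real^'n) set \<Rightarrow> (real^'n \<Rightarrow> real^'n) \<Rightarrow> real" where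
  "H1_norm_vec \<Omega> u = sqrt ((L2_norm \<Omega> u)\<^sup>2 + (L2_norm \<Omega> (weak_jacobian \<Omega> u))\<^sup>2)"

section \<open>Geometry\<close>

text \<open>Taking the interior of a finite union of polytopes excludes slits: \<open>\<Omega>\<close> lies on one side
  of its boundary in the sense that \<open>\<Omega> = interior (closure \<Omega>)\<close>.\<close>

definition polyhedral_domain :: "(real^'n) set \<Rightarrow> bool" where
  "polyhedral_domain \<Omega> \<longleftrightarrow> open \<Omega> \<and> connected \<Omega> \<and> bounded \<Omega> \<and> \<Omega> \<noteq> {} \<and>
     (\<exists>\<P>. finite \<P> \<and> (\<forall>P\<in>\<P>. polytope P) \<and> \<Omega> = interior (\<Union>\<P>))"

text \<open>The \<open>s\<close>-dimensional Hausdorff outer measure up to normalization. It is only used to say that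
  a part of the boundary has positive surface measure.\<close>

definition hausdorff_measure :: "nat \<Rightarrow> 'a::metric_space set \<Rightarrow> ennreal" where
  "hausdorff_measure s A = (SUP \<delta>\<in>{0<..}.
     INF U\<in>{U :: nat \<Rightarrow> 'a set. A \<subseteq> (\<Union>j. U j) \<and> (\<forall>j. bounded (U j) \<and> diameter (U j) \<le> \<delta>)}.
       \<Sum>j. ennreal (diameter (U j) ^ s))"

definition boundary_split :: "(real^'n) set \<Rightarrow> (real^'n) set \<Rightarrow> (real^'n) set \<Rightarrow> bool" where
  "boundary_split \<Omega> \<Gamma>\<^sub>1 \<Gamma>\<^sub>2 \<longleftrightarrow> frontier \<Omega> = \<Gamma>\<^sub>1 \<union> \<Gamma>\<^sub>2 \<and> \<Gamma>\<^sub>1 \<inter> \<Gamma>\<^sub>2 = {} \<and>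
     0 < hausdorff_measure (CARD('n) - 1) \<Gamma>\<^sub>1 \<and> 0 < hausdorff_measure (CARD('n) - 1) \<Gamma>\<^sub>2"

text \<open>Conforming simplicial mesh: \<open>triangulation\<close> includes finiteness and that two elements meet in
  a common (possibly empty) face.\<close>

definition simplicial_mesh :: "(real^'n) set \<Rightarrow> (real^'n) set set \<Rightarrow> bool" where
  "simplicial_mesh \<Omega> \<T> \<longleftrightarrow> triangulation \<T> \<and> (\<forall>E\<in>\<T>. int CARD('n) simplex E) \<and>
     \<Union>\<T> = closure \<Omega>"

section \<open>The problem data and the discrete spaces\<close>

record ('n::finite) biot_problem =
  Omega :: "(real^'n) set"
  Gamma_u :: "(real^'n) set"
  Gamma_sigma :: "(real^'n) set"
  Gamma_p :: "(real^'n) set"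
  Gamma_q :: "(real^'n) set"
  lam :: real
  mu :: real
  alpha :: real
  k_p :: real
  c_0 :: real
  final_time :: real
  force :: "real \<Rightarrow> real^'n \<Rightarrow> real^'n"
  source :: "real \<Rightarrow> real^'n \<Rightarrow> real"
  mesh :: "(real^'n) set set"
  deg_k :: nat
  deg_l :: nat
  steps :: nat

definition biot_setting :: "('n::finite) biot_problem \<Rightarrow> bool" where
  "biot_setting D \<longleftrightarrow>
     polyhedral_domain (Omega D) \<and>
     boundary_split (Omega D) (Gamma_u D) (Gamma_sigma D) \<and>
     boundary_split (Omega D) (Gamma_p D) (Gamma_q D) \<and>
     0 < lam D \<and> 0 < mu D \<and> 0 < alpha D \<and> 0 < k_p D \<and> 0 \<le> c_0 D \<and>
     0 < final_time D \<and>
     (\<forall>t\<in>{0..final_time D}. in_L2 (Omega D) (force D t) \<and> in_L2 (Omega D) (source D t)) \<and>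
     simplicial_mesh (Omega D) (mesh D) \<and>
     2 \<le> deg_k D \<and> 1 \<le> deg_l D \<and> 2 \<le> steps D"

text \<open>Restrictions to \<open>E\<close> of polynomials of total degree at most \<open>k\<close>; \<open>m\<close> ranges over
  multi-indices.\<close>

definition poly_on :: "nat \<Rightarrow> (real^'n) set \<Rightarrow> (real^'n \<Rightarrow> real) \<Rightarrow> bool" where
  "poly_on k E f \<longleftrightarrow> (\<exists>c :: ('n \<Rightarrow> nat) \<Rightarrow> real. \<forall>x\<in>E.
     f x = (\<Sum>m | (\<Sum>i\<in>UNIV. m i) \<le> k. c m * (\<Prod>i\<in>UNIV. (x $ i) ^ m i)))"

text \<open>Members of the discrete spaces are functions on the whole space whose values outside
  \<open>closure \<Omega>\<close> are irrelevant.\<close>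

definition V_h :: "('n::finite) biot_problem \<Rightarrow> (real^'n \<Rightarrow> real^'n) set" where
  "V_h D = {v. in_H1_vec (Omega D) v \<and> continuous_on (closure (Omega D)) v \<and>
     (\<forall>x\<in>Gamma_u D. v x = 0) \<and>
     (\<forall>E\<in>mesh D. \<forall>i. poly_on (deg_k D) E (\<lambda>x. v x $ i))}"

definition W_h :: "('n::finite) biot_problem \<Rightarrow> (real^'n \<Rightarrow> real) set" where
  "W_h D = {w. in_L2 (Omega D) w \<and> continuous_on (closure (Omega D)) w \<and>
     (\<forall>E\<in>mesh D. poly_on (deg_k D - 1) E w)}"

definition M_h :: "('n::finite) biot_problem \<Rightarrow> (real^'n \<Rightarrow> real) set" where
  "M_h D = {q. in_H1 (Omega D) q \<and> continuous_on (closure (Omega D)) q \<and>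
     (\<forall>x\<in>Gamma_p D. q x = 0) \<and>
     (\<forall>E\<in>mesh D. poly_on (deg_l D) E q)}"

section \<open>Bilinear forms and the inf-sup condition\<close>

definition form_a1 ::
    "('n::finite) biot_problem \<Rightarrow> (real^'n \<Rightarrow> real^'n) \<Rightarrow> (real^'n \<Rightarrow> real^'n) \<Rightarrow> real" where
  "form_a1 D u v = 2 * mu D * L2_inner (Omega D) (strain (Omega D) u) (strain (Omega D) v)"

definition form_b ::
    "('n::finite) biot_problem \<Rightarrow> (real^'n \<Rightarrow> real^'n) \<Rightarrow> (real^'n \<Rightarrow> real) \<Rightarrow> real" where
  "form_b D v w = L2_inner (Omega D) w (divergence (Omega D) v)"

definition form_a2 ::
    "('n::finite) biot_problem \<Rightarrow> (real^'n \<Rightarrow> real) \<Rightarrow> (real^'n \<Rightarrow> real) \<Rightarrow> real" where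
  "form_a2 D \<xi> w = 1 / lam D * L2_inner (Omega D) \<xi> w"

definition form_c ::
    "('n::finite) biot_problem \<Rightarrow> (real^'n \<Rightarrow> real) \<Rightarrow> (real^'n \<Rightarrow> real) \<Rightarrow> real" where
  "form_c D p w = alpha D / lam D * L2_inner (Omega D) p w"

definition form_a3 ::
    "('n::finite) biot_problem \<Rightarrow> (real^'n \<Rightarrow> real) \<Rightarrow> (real^'n \<Rightarrow> real) \<Rightarrow> real" where
  "form_a3 D p q = (c_0 D + (alpha D)\<^sup>2 / lam D) * L2_inner (Omega D) p q"

definition form_d ::
    "('n::finite) biot_problem \<Rightarrow> (real^'n \<Rightarrow> real) \<Rightarrow> (real^'n \<Rightarrow> real) \<Rightarrow> real" where
  "form_d D p q = k_p D * L2_inner (Omega D) (weak_grad (Omega D) p) (weak_grad (Omega D) q)"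

text \<open>The supremum is taken in the extended reals, so that no boundedness or nonemptiness
  proviso is needed.\<close>

definition inf_sup :: "('n::finite) biot_problem \<Rightarrow> real \<Rightarrow> bool" where
  "inf_sup D \<beta> \<longleftrightarrow> (\<forall>w\<in>W_h D.
     ereal (\<beta> * L2_norm (Omega D) w) \<le>
       (SUP v\<in>{v\<in>V_h D. \<exists>x\<in>closure (Omega D). v x \<noteq> 0}.
          ereal (form_b D v w / H1_norm_vec (Omega D) v)))"

section \<open>Time discretization and the two schemes\<close>

definition dt :: "('n::finite) biot_problem \<Rightarrow> real" where
  "dt D = final_time D / real (steps D)"

text \<open>Only used for \<open>n \<ge> 2\<close>.\<close>

definition BDF2 ::
    "('n::finite) biot_problem \<Rightarrow> (nat \<Rightarrow> real^'n \<Rightarrow> real) \<Rightarrow> nat \<Rightarrow> real^'n \<Rightarrow> real" where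
  "BDF2 D y n = (\<lambda>x. 1 / dt D * (3/2 * y n x - 2 * y (n - 1) x + 1/2 * y (n - 2) x))"

definition monolithic_solution ::
    "('n::finite) biot_problem \<Rightarrow> (nat \<Rightarrow> real^'n \<Rightarrow> real^'n) \<Rightarrow>
      (nat \<Rightarrow> real^'n \<Rightarrow> real) \<Rightarrow> (nat \<Rightarrow> real^'n \<Rightarrow> real) \<Rightarrow> bool" where
  "monolithic_solution D u \<xi> p \<longleftrightarrow>
     (\<forall>n<2. \<xi> n \<in> W_h D \<and> p n \<in> M_h D) \<and>
     (\<forall>n\<in>{2..steps D}. u n \<in> V_h D \<and> \<xi> n \<in> W_h D \<and> p n \<in> M_h D \<and>
        (\<forall>v\<in>V_h D. form_a1 D (u n) v - form_b D v (\<xi> n) =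
           L2_inner (Omega D) (force D (real n * dt D)) v) \<and>
        (\<forall>w\<in>W_h D. form_b D (u n) w + form_a2 D (\<xi> n) w - form_c D (p n) w = 0) \<and>
        (\<forall>q\<in>M_h D. form_a3 D (BDF2 D p n) q - form_c D q (BDF2 D \<xi> n) + form_d D (p n) q =
           L2_inner (Omega D) (source D (real n * dt D)) q))"

text \<open>The iterates carry the time index \<open>n\<close> first and the iteration index \<open>i\<close> second; \<open>\<xi>f n 0\<close> is
  the initial guess, whereas \<open>uf n 0\<close> and \<open>pf n 0\<close> play no role.\<close>

definition decoupled_iterates ::
    "('n::finite) biot_problem \<Rightarrow> (nat \<Rightarrow> real^'n \<Rightarrow> real) \<Rightarrow> (nat \<Rightarrow> real^'n \<Rightarrow> real) \<Rightarrow>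
      (nat \<Rightarrow> nat \<Rightarrow> real^'n \<Rightarrow> real^'n) \<Rightarrow> (nat \<Rightarrow> nat \<Rightarrow> real^'n \<Rightarrow> real) \<Rightarrow>
      (nat \<Rightarrow> nat \<Rightarrow> real^'n \<Rightarrow> real) \<Rightarrow> bool" where
  "decoupled_iterates D \<xi> p uf \<xi>f pf \<longleftrightarrow>
     (\<forall>n\<in>{2..steps D}. \<xi>f n 0 \<in> W_h D) \<and>
     (\<forall>i\<ge>1.
        (\<forall>n<2. pf n i = p n \<and> \<xi>f n (i - 1) = \<xi> n) \<and>
        (\<forall>n\<in>{2..steps D}. pf n i \<in> M_h D \<and>
           (\<forall>q\<in>M_h D. form_a3 D (BDF2 D (\<lambda>m. pf m i) n) q + form_d D (pf n i) q =
              L2_inner (Omega D) (source D (real n * dt D)) q +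
              form_c D q (BDF2 D (\<lambda>m. \<xi>f m (i - 1)) n))) \<and>
        (\<forall>n\<in>{2..steps D}. uf n i \<in> V_h D \<and> \<xi>f n i \<in> W_h D \<and>
           (\<forall>v\<in>V_h D. form_a1 D (uf n i) v - form_b D v (\<xi>f n i) =
              L2_inner (Omega D) (force D (real n * dt D)) v) \<and>
           (\<forall>w\<in>W_h D. form_b D (uf n i) w + form_a2 D (\<xi>f n i) w = form_c D (pf n i) w)))"

definition iter_error ::
    "(nat \<Rightarrow> nat \<Rightarrow> 'a \<Rightarrow> 'b::ab_group_add) \<Rightarrow> (nat \<Rightarrow> 'a \<Rightarrow> 'b) \<Rightarrow> nat \<Rightarrow> nat \<Rightarrow> 'a \<Rightarrow> 'b" where
  "iter_error yf y i n = (\<lambda>x. if n < 2 then 0 else yf n i x - y n x)"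

definition contraction_factor :: "('n::finite) biot_problem \<Rightarrow> real \<Rightarrow> real" where
  "contraction_factor D C = 1 / ((c_0 D * lam D / (alpha D)\<^sup>2 + 1) * (C * lam D + 1))"

end

theory Submission
  imports Defs
begin

text \<open>
  \<^bold>\<open>Contraction.\<close> The errors of the iteration solve homogeneous versions of the two subproblems. The flow
  subproblem is linear and acts at a single time level, so the BDF-2 differences of the errors solve it
  as well. Testing it with the error itself gives
  \<open>a\<^sub>1 e\<^sub>u e\<^sub>u + 1/\<lambda> \<parallel>e\<^sub>\<xi>\<parallel>\<^sup>2 = \<alpha>/\<lambda> (e\<^sub>p, e\<^sub>\<xi>)\<close>, and the inf-sup condition bounds the elastic energy from below by
  \<open>C \<parallel>e\<^sub>\<xi>\<parallel>\<^sup>2\<close> with \<open>C = \<beta>\<^sup>2 / (2 \<mu>)\<close>; this yields \<open>(C \<lambda> + 1) \<parallel>e\<^sub>\<xi>\<parallel> \<le> \<alpha> \<parallel>e\<^sub>p\<parallel>\<close>, which is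
  \<open>homogeneous_stokes_estimate\<close>. In the diffusion subproblem one tests with the BDF-2 difference of \<open>e\<^sub>p\<close>.
  The BDF-2 method is G-stable, and the errors vanish at the initial levels, so the diffusion terms add up
  to a nonnegative number (\<open>sum_bdf_nonneg\<close>) and the rest bounds \<open>\<alpha>\<close> times the pressure differences by
  \<open>1 / (c\<^sub>0 \<lambda> / \<alpha>\<^sup>2 + 1)\<close> times the previous differences of \<open>e\<^sub>\<xi>\<close> (\<open>diffusion_step\<close>). The product of the two factors
  is \<open>K\<close>.

  \<^bold>\<open>Convergence.\<close> The contraction drives the BDF-2 differences to zero, and the errors themselves are
  recovered from their differences level by level. The gradient of \<open>e\<^sub>p\<close> is controlled by testing the
  diffusion equation with \<open>e\<^sub>p\<close>, and the strain of \<open>e\<^sub>u\<close> by the energy identity. To pass from the strain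
  to the full norm of \<open>e\<^sub>u\<close> a Korn inequality is needed. The mesh is fixed, so its constant may
  depend on the mesh, and it suffices by finite dimension (\<open>semi_inner_dominated\<close>) that a discrete
  field with vanishing strain vanishes (\<open>strain_zero_imp_zero\<close>).

  \<^bold>\<open>Rigidity.\<close> Such a field \<open>v\<close> satisfies \<open>(v y - v x) \<bullet> (y - x) = 0\<close> within each cell. Along a segment in the
  domain the component of \<open>v\<close> in the direction of the segment is continuous and takes finitely many values,
  so the orthogonality holds across cells. This makes \<open>v\<close> an infinitesimal rigid motion near every point,
  hence on the whole connected domain. The zero set of a nontrivial rigid motion is contained in a graph
  over all but two coordinates and has no surface measure, whereas \<open>v\<close> vanishes on \<open>Gamma_u\<close>.

  \<^bold>\<open>Weak gradients.\<close> The forms are built from representatives of weak gradients. The fundamental lemma of the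
  calculus of variations (\<open>AE_zero_if_orthogonal_to_test_functions\<close>) makes these unique, and hence linear,
  up to null sets, which is all that the integrals see.
\<close>

section \<open>Semi-inner products on spaces of functions\<close>

text \<open>Linearity is used in the single form \<open>u + c v\<close>, which covers sums, differences and multiples and so
  serves alike for spaces, forms and operators.\<close>

definition axpy :: "('a \<Rightarrow> 'b::real_vector) \<Rightarrow> real \<Rightarrow> ('a \<Rightarrow> 'b) \<Rightarrow> 'a \<Rightarrow> 'b" where
  "axpy u c v = (\<lambda>x. u x + c *\<^sub>R v x)"

definition lin_space :: "('a \<Rightarrow> 'b::real_vector) set \<Rightarrow> bool" where
  "lin_space V \<longleftrightarrow> (\<lambda>_. 0) \<in> V \<and> (\<forall>u\<in>V. \<forall>v\<in>V. \<forall>c. axpy u c v \<in> V)"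

definition lin_form :: "('a \<Rightarrow> 'b::real_vector) set \<Rightarrow> (('a \<Rightarrow> 'b) \<Rightarrow> real) \<Rightarrow> bool" where
  "lin_form V L \<longleftrightarrow> (\<forall>u\<in>V. \<forall>v\<in>V. \<forall>c. L (axpy u c v) = L u + c * L v)"

text \<open>Functions that agree almost everywhere are distinct elements of the spaces below, so even the
  \<open>L\<^sup>2\<close> product is only positive semidefinite.\<close>

definition semi_inner ::
    "('a \<Rightarrow> 'b::real_vector) set \<Rightarrow> (('a \<Rightarrow> 'b) \<Rightarrow> ('a \<Rightarrow> 'b) \<Rightarrow> real) \<Rightarrow> bool" where
  "semi_inner V A \<longleftrightarrow> (\<forall>w\<in>V. lin_form V (\<lambda>u. A u w)) \<and>
     (\<forall>u\<in>V. \<forall>v\<in>V. A u v = A v u) \<and> (\<forall>u\<in>V. 0 \<le> A u u)"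

lemma lin_spaceD:
  assumes "lin_space V"
  shows "(\<lambda>_. 0) \<in> V" "\<And>u v c. u \<in> V \<Longrightarrow> v \<in> V \<Longrightarrow> axpy u c v \<in> V"
  using assms by (auto simp: lin_space_def)

lemma lin_formD: "lin_form V L \<Longrightarrow> u \<in> V \<Longrightarrow> v \<in> V \<Longrightarrow> L (axpy u c v) = L u + c * L v"
  by (auto simp: lin_form_def)

lemma lin_form_zero:
  fixes V :: "('a \<Rightarrow> 'b::real_vector) set"
  assumes "lin_space V" "lin_form V L"
  shows "L (\<lambda>_. 0) = 0"
proof -
  have "axpy (\<lambda>_. 0) (-1) (\<lambda>_. 0) = ((\<lambda>_. 0) :: 'a \<Rightarrow> 'b)" by (simp add: axpy_def)
  then have "L (\<lambda>_. 0) = L (\<lambda>_. 0) + (-1) * L (\<lambda>_. 0)"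
    using lin_formD[OF assms(2), of "\<lambda>_. 0" "\<lambda>_. 0" "-1"] lin_spaceD(1)[OF assms(1)] by simp
  then show ?thesis by simp
qed

lemma semi_innerD:
  assumes "semi_inner V A"
  shows semi_inner_left: "\<And>u v w c. \<lbrakk>u \<in> V; v \<in> V; w \<in> V\<rbrakk> \<Longrightarrow> A (axpy u c v) w = A u w + c * A v w"
    and semi_inner_sym: "\<And>u v. \<lbrakk>u \<in> V; v \<in> V\<rbrakk> \<Longrightarrow> A u v = A v u"
    and semi_inner_nonneg: "\<And>u. u \<in> V \<Longrightarrow> 0 \<le> A u u"
  using assms by (auto simp: semi_inner_def lin_form_def)

lemma semi_inner_right:
  assumes "lin_space V" "semi_inner V A" "u \<in> V" "v \<in> V" "w \<in> V"
  shows "A w (axpy u c v) = A w u + c * A w v"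
  using semi_inner_left[OF assms(2-5)] semi_inner_sym[OF assms(2)] assms(3-5)
    lin_spaceD(2)[OF assms(1,3,4)] by metis

lemma semi_inner_axpy:
  assumes "lin_space V" "semi_inner V A" "u \<in> V" "v \<in> V"
  shows "A (axpy u c v) (axpy u c v) = A u u + 2 * c * A u v + c\<^sup>2 * A v v"
proof -
  have "A (axpy u c v) (axpy u c v) = A (axpy u c v) u + c * A (axpy u c v) v"
    using semi_inner_right[OF assms(1,2,3,4)] lin_spaceD(2)[OF assms(1,3,4)] by blast
  then show ?thesis
    using assms(3,4) semi_inner_left[OF assms(2)] semi_inner_sym[OF assms(2) assms(3,4)]
    by (simp add: algebra_simps power2_eq_square)
qed

text \<open>The quadratic \<open>c \<mapsto> A (u + c v) (u + c v)\<close> is nonnegative; when \<open>A v v = 0\<close> it is affine in \<open>c\<close>, which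
  forces its slope to vanish.\<close>

lemma semi_inner_Cauchy_Schwarz:
  assumes V: "lin_space V" and A: "semi_inner V A" and u: "u \<in> V" and v: "v \<in> V"
  shows "(A u v)\<^sup>2 \<le> A u u * A v v"
proof -
  have q: "0 \<le> A u u + 2 * c * A u v + c\<^sup>2 * A v v" for c
    using semi_inner_nonneg[OF A lin_spaceD(2)[OF V u v]] semi_inner_axpy[OF V A u v] by simp
  show ?thesis
  proof (cases "A v v = 0")
    case True
    have "A u v = 0"
    proof (rule ccontr)
      assume "A u v \<noteq> 0"
      then show False
        using q[of "- (A u u + 1) / (2 * A u v)"] True by (simp add: field_simps)
    qed
    then show ?thesis by (simp add: True)
  next
    case False
    then have pos: "A v v > 0" using semi_inner_nonneg[OF A v] by simp
    have "0 \<le> A u u - (A u v)\<^sup>2 / A v v"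
      using q[of "- A u v / A v v"] pos by (simp add: field_simps power2_eq_square)
    then show ?thesis using pos by (simp add: field_simps)
  qed
qed

lemma semi_inner_null:
  assumes "lin_space V" "semi_inner V A" "u \<in> V" "v \<in> V" "A v v = 0"
  shows "A u v = 0"
  using semi_inner_Cauchy_Schwarz[OF assms(1-4)] assms(5) by simp

lemma semi_inner_le_sqrt:
  assumes "lin_space V" "semi_inner V A" "u \<in> V" "v \<in> V"
  shows "A u v \<le> sqrt (A u u) * sqrt (A v v)"
proof -
  have "\<bar>A u v\<bar> \<le> sqrt (A u u * A v v)"
    using semi_inner_Cauchy_Schwarz[OF assms] by (simp add: real_le_rsqrt)
  then show ?thesis by (simp add: real_sqrt_mult)
qed

lemma lin_space_kernel:
  assumes V: "lin_space V" and l: "lin_form V l"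
  shows "lin_space {v\<in>V. l v = 0}"
  using lin_spaceD[OF V] lin_form_zero[OF V l] lin_formD[OF l] by (auto simp: lin_space_def)

lemma axpy_split: "v = axpy (axpy v (- s) w) s w"
  by (simp add: axpy_def)

text \<open>A semi-inner product admits orthogonal projections onto a subspace \<open>V\<close> as soon as finitely many
  linear functionals separate \<open>V\<close> up to \<open>A\<close>-null elements. This replaces a basis: adding a functional
  \<open>l\<close> extends its kernel by at most one direction \<open>w\<close>, which can be taken orthogonal to the kernel, and
  the projection onto the kernel is corrected by a multiple of \<open>w\<close>.\<close>

lemma ex_orthogonal_projection:
  assumes "finite F" and V0: "lin_space V0" and A: "semi_inner V0 A"
    and "lin_space V" "V \<subseteq> V0" "\<And>l. l \<in> F \<Longrightarrow> lin_form V l"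
    and "\<And>v. v \<in> V \<Longrightarrow> (\<forall>l\<in>F. l v = 0) \<Longrightarrow> A v v = 0" and "u \<in> V0"
  shows "\<exists>\<pi>\<in>V. \<forall>v\<in>V. A (axpy u (-1) \<pi>) v = 0"
  using assms(1,4-)
proof (induction F arbitrary: V u rule: finite_induct)
  case empty
  have "A (axpy u (-1) (\<lambda>_. 0)) v = 0" if "v \<in> V" for v
    using semi_inner_null[OF V0 A, of "axpy u (-1) (\<lambda>_. 0)" v] that empty
      lin_spaceD[OF V0] by auto
  then show ?case using lin_spaceD(1)[OF empty(1)] by blast
next
  case (insert l F)
  note V = insert.prems(1) and sub = insert.prems(2) and u = insert.prems(5)
  let ?K = "{v\<in>V. l v = 0}"
  have l: "lin_form V l" using insert.prems by blast
  have proj: "\<exists>\<pi>\<in>?K. \<forall>v\<in>?K. A (axpy w (-1) \<pi>) v = 0" if "w \<in> V0" for w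
  proof (rule insert.IH)
    show "lin_space ?K" by (rule lin_space_kernel[OF V l])
    show "?K \<subseteq> V0" using sub by blast
    show "lin_form ?K m" if "m \<in> F" for m
      using insert.prems(3)[of m] that by (auto simp: lin_form_def)
    show "A v v = 0" if "v \<in> ?K" "\<forall>l\<in>F. l v = 0" for v
      using insert.prems(4)[of v] that by blast
  qed (use that in auto)
  show ?case
  proof (cases "\<forall>v\<in>V. l v = 0")
    case True
    then have "?K = V" by blast
    then show ?thesis using proj[OF u] by simp
  next
    case False
    then obtain w0 where w0: "w0 \<in> V" "l w0 \<noteq> 0" by blast
    obtain \<pi>0 where \<pi>0: "\<pi>0 \<in> ?K" "\<forall>v\<in>?K. A (axpy w0 (-1) \<pi>0) v = 0"
      using proj[of w0] w0 sub by blast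
    define w where "w = axpy w0 (-1) \<pi>0"
    have w: "w \<in> V" "l w \<noteq> 0" and wK: "\<And>v. v \<in> ?K \<Longrightarrow> A w v = 0"
      using w0 \<pi>0 lin_spaceD(2)[OF V] lin_formD[OF l] by (auto simp: w_def)
    obtain \<pi>1 where \<pi>1: "\<pi>1 \<in> ?K" "\<forall>v\<in>?K. A (axpy u (-1) \<pi>1) v = 0"
      using proj[OF u] by blast
    \<comment> \<open>If \<open>A w w = 0\<close> then \<open>A u w = 0\<close> too, and the value \<open>t = 0\<close> of the quotient is the right one.\<close>
    define t where "t = A u w / A w w"
    have t: "A u w = t * A w w"
      using semi_inner_null[OF V0 A u, of w] w sub by (auto simp: t_def)
    have inV0: "w \<in> V0" "\<pi>1 \<in> V0" "axpy \<pi>1 t w \<in> V0"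
      using w \<pi>1 sub by (auto intro!: lin_spaceD(2)[OF V0])
    have "A (axpy u (-1) (axpy \<pi>1 t w)) v = 0" if v: "v \<in> V" for v
    proof -
      define s where "s = l v / l w"
      define v' where "v' = axpy v (- s) w"
      have v': "v' \<in> ?K"
        using v w lin_spaceD(2)[OF V] lin_formD[OF l] by (auto simp: v'_def s_def)
      have dec: "v = axpy v' s w" unfolding v'_def by (rule axpy_split)
      have v'0: "v' \<in> V0" using v' sub by blast
      have e1: "A (axpy u (-1) (axpy \<pi>1 t w)) x = A u x - A \<pi>1 x - t * A w x" if "x \<in> V0" for x
        using inV0 u that semi_inner_left[OF A] by simp
      have e2: "A u v' - A \<pi>1 v' = 0"
        using \<pi>1 v' semi_inner_left[OF A u inV0(2) v'0, of "-1"] by auto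
      have e3: "A \<pi>1 w = 0" using wK[OF \<pi>1(1)] semi_inner_sym[OF A inV0(2,1)] by simp
      have e4: "axpy u (-1) (axpy \<pi>1 t w) \<in> V0" using u inV0 lin_spaceD(2)[OF V0] by blast
      show ?thesis
        unfolding dec using semi_inner_right[OF V0 A v'0 inV0(1) e4] e1[OF v'0] e1[OF inV0(1)]
          e2 e3 t wK[OF v'] by simp
    qed
    moreover have "axpy \<pi>1 t w \<in> V" using \<pi>1 w lin_spaceD(2)[OF V] by auto
    ultimately show ?thesis by blast
  qed
qed

text \<open>Equivalence of norms on a finite-dimensional space, for seminorms: if finitely many functionals
  separate \<open>V\<close> up to \<open>A\<close>-null elements and \<open>B\<close> vanishes wherever \<open>A\<close> does, then \<open>B\<close> is bounded by a multiple of \<open>A\<close>. The induction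
  splits off one \<open>A\<close>-orthogonal direction \<open>w\<close> at a time, so that \<open>A\<close> is additive along the splitting while
  \<open>B\<close> is at most doubled.\<close>

lemma semi_inner_dominated:
  assumes "finite F" and "lin_space V" "semi_inner V A" "semi_inner V B"
    and "\<And>l. l \<in> F \<Longrightarrow> lin_form V l"
    and "\<And>v. v \<in> V \<Longrightarrow> (\<forall>l\<in>F. l v = 0) \<Longrightarrow> A v v = 0"
    and "\<And>v. v \<in> V \<Longrightarrow> A v v = 0 \<Longrightarrow> B v v = 0"
  shows "\<exists>C\<ge>0. \<forall>v\<in>V. B v v \<le> C * A v v"
  using assms
proof (induction F arbitrary: V rule: finite_induct)
  case empty
  then show ?case by (intro exI[of _ 0]) auto
next
  case (insert l F)
  note V = insert.prems(1) and A = insert.prems(2) and B = insert.prems(3)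
  let ?K = "{v\<in>V. l v = 0}"
  have l: "lin_form V l" using insert.prems by blast
  have K: "lin_space ?K" by (rule lin_space_kernel[OF V l])
  have lK: "lin_form ?K m" if "m \<in> F" for m
    using insert.prems(4)[of m] that by (auto simp: lin_form_def)
  have nK: "A v v = 0" if "v \<in> ?K" "\<forall>l\<in>F. l v = 0" for v
    using insert.prems(5)[of v] that by blast
  have "\<exists>C\<ge>0. \<forall>v\<in>?K. B v v \<le> C * A v v"
  proof (rule insert.IH[OF K _ _ lK nK])
    show "semi_inner ?K A" "semi_inner ?K B"
      using A B by (auto simp: semi_inner_def lin_form_def)
  qed (use insert.prems(6) in auto)
  then obtain C where C: "C \<ge> 0" "\<And>v. v \<in> ?K \<Longrightarrow> B v v \<le> C * A v v" by blast
  show ?case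
  proof (cases "\<forall>v\<in>V. l v = 0")
    case True
    then show ?thesis using C by blast
  next
    case False
    then obtain w0 where w0: "w0 \<in> V" "l w0 \<noteq> 0" by blast
    obtain \<pi>0 where \<pi>0: "\<pi>0 \<in> ?K" "\<forall>v\<in>?K. A (axpy w0 (-1) \<pi>0) v = 0"
      using ex_orthogonal_projection[OF insert.hyps(1) V A K _ lK nK w0(1)] by blast
    define w where "w = axpy w0 (-1) \<pi>0"
    have w: "w \<in> V" "l w \<noteq> 0" and wK: "\<And>v. v \<in> ?K \<Longrightarrow> A w v = 0"
      using w0 \<pi>0 lin_spaceD(2)[OF V] lin_formD[OF l] by (auto simp: w_def)
    define D where "D = B w w / A w w"
    have D: "B w w = D * A w w" using insert.prems(6)[OF w(1)] by (auto simp: D_def)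
    have D0: "D \<ge> 0" using semi_inner_nonneg[OF A w(1)] semi_inner_nonneg[OF B w(1)] by (simp add: D_def)
    have "B v v \<le> (2 * C + 2 * D) * A v v" if v: "v \<in> V" for v
    proof -
      define s where "s = l v / l w"
      define v' where "v' = axpy v (- s) w"
      have v': "v' \<in> ?K"
        using v w lin_spaceD(2)[OF V] lin_formD[OF l] by (auto simp: v'_def s_def)
      then have v'V: "v' \<in> V" by blast
      have dec: "v = axpy v' s w" unfolding v'_def by (rule axpy_split)
      have Av: "A v v = A v' v' + s\<^sup>2 * A w w"
        unfolding dec using semi_inner_axpy[OF V A v'V w(1)] wK[OF v'] semi_inner_sym[OF A v'V w(1)] by simp
      have "0 \<le> B (axpy v' (- s) w) (axpy v' (- s) w)"
        using semi_inner_nonneg[OF B] lin_spaceD(2)[OF V v'V w(1)] by blast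
      then have "B v v \<le> 2 * B v' v' + 2 * (s\<^sup>2 * B w w)"
        unfolding dec using semi_inner_axpy[OF V B v'V w(1), of s]
          semi_inner_axpy[OF V B v'V w(1), of "- s"] by (simp add: algebra_simps)
      also have "\<dots> \<le> 2 * (C * A v' v') + 2 * (s\<^sup>2 * (D * A w w))"
        using C(2)[OF v'] D by simp
      also have "\<dots> \<le> (2 * C + 2 * D) * A v v"
        unfolding Av using C(1) D0 semi_inner_nonneg[OF A v'V] semi_inner_nonneg[OF A w(1)]
        by (simp add: algebra_simps)
      finally show ?thesis .
    qed
    then show ?thesis using C(1) D0 by (intro exI[of _ "2 * C + 2 * D"]) auto
  qed
qed

section \<open>The space \<open>L\<^sup>2\<close>\<close>

lemma in_L2_axpy:
  assumes "in_L2 \<Omega> f" "in_L2 \<Omega> g"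
  shows "in_L2 \<Omega> (axpy f c g)"
proof -
  have m: "f \<in> borel_measurable (lebesgue_on \<Omega>)" "g \<in> borel_measurable (lebesgue_on \<Omega>)"
    using assms by (auto simp: in_L2_def)
  have "integrable (lebesgue_on \<Omega>) (\<lambda>x. (norm (f x + c *\<^sub>R g x))\<^sup>2)"
  proof (rule Bochner_Integration.integrable_bound)
    show "integrable (lebesgue_on \<Omega>) (\<lambda>x. 2 * (norm (f x))\<^sup>2 + 2 * c\<^sup>2 * (norm (g x))\<^sup>2)"
      using assms by (auto simp: in_L2_def)
    show "(\<lambda>x. (norm (f x + c *\<^sub>R g x))\<^sup>2) \<in> borel_measurable (lebesgue_on \<Omega>)"
      using m by measurable
    have "(norm (f x + c *\<^sub>R g x))\<^sup>2 \<le> 2 * (norm (f x))\<^sup>2 + 2 * c\<^sup>2 * (norm (g x))\<^sup>2" for x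
    proof -
      have "(norm (f x + c *\<^sub>R g x))\<^sup>2 \<le> (norm (f x) + \<bar>c\<bar> * norm (g x))\<^sup>2"
        by (metis norm_ge_zero norm_scaleR norm_triangle_ineq power_mono)
      also have "\<dots> \<le> 2 * (norm (f x))\<^sup>2 + 2 * (\<bar>c\<bar> * norm (g x))\<^sup>2"
        using sum_squares_bound[of "norm (f x)" "\<bar>c\<bar> * norm (g x)"] by (simp add: power2_sum)
      finally show ?thesis by (simp add: power_mult_distrib)
    qed
    then show "AE x in lebesgue_on \<Omega>. norm ((norm (f x + c *\<^sub>R g x))\<^sup>2)
        \<le> norm (2 * (norm (f x))\<^sup>2 + 2 * c\<^sup>2 * (norm (g x))\<^sup>2)" by auto
  qed
  then show ?thesis using m by (auto simp: in_L2_def axpy_def)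
qed

lemma in_L2_zero: "in_L2 \<Omega> (\<lambda>_. 0)"
  by (simp add: in_L2_def)

lemma lin_space_L2: "lin_space {f. in_L2 \<Omega> f}"
  by (auto simp: lin_space_def in_L2_zero intro: in_L2_axpy)

lemma integrable_L2_inner:
  assumes "in_L2 \<Omega> f" "in_L2 \<Omega> g"
  shows "integrable (lebesgue_on \<Omega>) (\<lambda>x. f x \<bullet> g x)"
proof (rule Bochner_Integration.integrable_bound)
  show "integrable (lebesgue_on \<Omega>) (\<lambda>x. (norm (f x))\<^sup>2 + (norm (g x))\<^sup>2)"
    using assms by (auto simp: in_L2_def)
  show "(\<lambda>x. f x \<bullet> g x) \<in> borel_measurable (lebesgue_on \<Omega>)"
    using assms unfolding in_L2_def by (intro borel_measurable_inner) auto
  have "\<bar>f x \<bullet> g x\<bar> \<le> (norm (f x))\<^sup>2 + (norm (g x))\<^sup>2" for x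
    using Cauchy_Schwarz_ineq2[of "f x" "g x"] sum_squares_bound[of "norm (f x)" "norm (g x)"]
      zero_le_power2[of "norm (f x)"] zero_le_power2[of "norm (g x)"]
      mult_nonneg_nonneg[OF norm_ge_zero[of "f x"] norm_ge_zero[of "g x"]] by linarith
  then show "AE x in lebesgue_on \<Omega>. norm (f x \<bullet> g x) \<le> norm ((norm (f x))\<^sup>2 + (norm (g x))\<^sup>2)"
    by auto
qed

lemma L2_inner_commute: "L2_inner \<Omega> f g = L2_inner \<Omega> g f"
  by (simp add: L2_inner_def inner_commute)

lemma L2_inner_self_nonneg: "0 \<le> L2_inner \<Omega> f f"
  by (simp add: L2_inner_def)

lemma L2_norm_nonneg: "0 \<le> L2_norm \<Omega> f"
  by (simp add: L2_norm_def L2_inner_self_nonneg)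

lemma L2_norm_sq: "(L2_norm \<Omega> f)\<^sup>2 = L2_inner \<Omega> f f"
  by (simp add: L2_norm_def L2_inner_self_nonneg)

lemma L2_inner_axpy_left:
  assumes "in_L2 \<Omega> f" "in_L2 \<Omega> g" "in_L2 \<Omega> h"
  shows "L2_inner \<Omega> (axpy f c g) h = L2_inner \<Omega> f h + c * L2_inner \<Omega> g h"
  using integrable_L2_inner[OF assms(1,3)] integrable_L2_inner[OF assms(2,3)]
  by (simp add: L2_inner_def axpy_def inner_add_left)

lemma semi_inner_L2: "semi_inner {f. in_L2 \<Omega> f} (L2_inner \<Omega>)"
  by (auto simp: semi_inner_def lin_form_def L2_inner_axpy_left L2_inner_self_nonneg
      intro: L2_inner_commute)

lemma L2_inner_le:
  assumes "in_L2 \<Omega> f" "in_L2 \<Omega> g"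
  shows "L2_inner \<Omega> f g \<le> L2_norm \<Omega> f * L2_norm \<Omega> g"
  using semi_inner_le_sqrt[OF lin_space_L2 semi_inner_L2] assms by (auto simp: L2_norm_def)

lemma L2_norm_axpy_le:
  assumes "in_L2 \<Omega> f" "in_L2 \<Omega> g"
  shows "L2_norm \<Omega> (axpy f c g) \<le> L2_norm \<Omega> f + \<bar>c\<bar> * L2_norm \<Omega> g"
proof (rule power2_le_imp_le)
  have "c * L2_inner \<Omega> f g \<le> \<bar>c\<bar> * (L2_norm \<Omega> f * L2_norm \<Omega> g)"
  proof (cases "c \<ge> 0")
    case True
    then show ?thesis using L2_inner_le[OF assms] by (simp add: mult_left_mono)
  next
    case False
    have "- L2_inner \<Omega> f g \<le> L2_norm \<Omega> f * L2_norm \<Omega> g"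
      using semi_inner_Cauchy_Schwarz[OF lin_space_L2 semi_inner_L2, of f \<Omega> g] assms
      by (simp add: L2_norm_def real_sqrt_mult[symmetric] real_le_rsqrt)
    then have "(-c) * (- L2_inner \<Omega> f g) \<le> (-c) * (L2_norm \<Omega> f * L2_norm \<Omega> g)"
      using False by (intro mult_left_mono) auto
    then show ?thesis using False by simp
  qed
  then show "(L2_norm \<Omega> (axpy f c g))\<^sup>2 \<le> (L2_norm \<Omega> f + \<bar>c\<bar> * L2_norm \<Omega> g)\<^sup>2"
    using semi_inner_axpy[OF lin_space_L2 semi_inner_L2, of f \<Omega> g c] assms
    by (simp add: power2_sum power_mult_distrib L2_norm_sq algebra_simps)
qed (simp add: L2_norm_nonneg)

lemma L2_inner_cong_AE:
  assumes "in_L2 \<Omega> f" "in_L2 \<Omega> f'" "in_L2 \<Omega> g" "in_L2 \<Omega> g'"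
    and "AE x in lebesgue_on \<Omega>. f x = f' x" "AE x in lebesgue_on \<Omega>. g x = g' x"
  shows "L2_inner \<Omega> f g = L2_inner \<Omega> f' g'"
  unfolding L2_inner_def
proof (rule integral_cong_AE)
  show "AE x in lebesgue_on \<Omega>. f x \<bullet> g x = f' x \<bullet> g' x" using assms(5,6) by eventually_elim simp
qed (use assms integrable_L2_inner in blast)+

lemma L2_inner_self_zero_iff:
  assumes "in_L2 \<Omega> f"
  shows "L2_inner \<Omega> f f = 0 \<longleftrightarrow> (AE x in lebesgue_on \<Omega>. f x = 0)"
  using integral_nonneg_eq_0_iff_AE[OF integrable_L2_inner[OF assms assms]]
  by (simp add: L2_inner_def)

text \<open>Operators that are defined through an arbitrary representative, such as the weak gradient, are
  linear only up to null sets.\<close>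

definition L2_linear ::
    "(real^'n) set \<Rightarrow> ('a \<Rightarrow> 'c::real_vector) set \<Rightarrow> (('a \<Rightarrow> 'c) \<Rightarrow> real^'n \<Rightarrow> 'b::euclidean_space) \<Rightarrow> bool" where
  "L2_linear \<Omega> V T \<longleftrightarrow> (\<forall>u\<in>V. in_L2 \<Omega> (T u)) \<and>
     (\<forall>u\<in>V. \<forall>v\<in>V. \<forall>c. AE x in lebesgue_on \<Omega>. T (axpy u c v) x = axpy (T u) c (T v) x)"

lemma L2_linear_inner_left:
  assumes T: "L2_linear \<Omega> V T" and V: "lin_space V" and g: "in_L2 \<Omega> g"
  shows "lin_form V (\<lambda>u. L2_inner \<Omega> (T u) g)"
  unfolding lin_form_def
proof (intro ballI allI)
  fix u v c assume uv: "u \<in> V" "v \<in> V"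
  have Tuv: "in_L2 \<Omega> (T u)" "in_L2 \<Omega> (T v)" "in_L2 \<Omega> (T (axpy u c v))"
    using T lin_spaceD(2)[OF V uv] uv by (auto simp: L2_linear_def)
  have "L2_inner \<Omega> (T (axpy u c v)) g = L2_inner \<Omega> (axpy (T u) c (T v)) g"
    using T uv Tuv g by (intro L2_inner_cong_AE) (auto simp: L2_linear_def intro: in_L2_axpy)
  then show "L2_inner \<Omega> (T (axpy u c v)) g = L2_inner \<Omega> (T u) g + c * L2_inner \<Omega> (T v) g"
    using L2_inner_axpy_left[OF Tuv(1,2) g] by simp
qed

lemma L2_linear_semi_inner:
  assumes "L2_linear \<Omega> V T" "lin_space V"
  shows "semi_inner V (\<lambda>u v. L2_inner \<Omega> (T u) (T v))"
  using L2_linear_inner_left[OF assms] assms(1)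
  by (auto simp: semi_inner_def L2_linear_def L2_inner_self_nonneg intro: L2_inner_commute)

section \<open>The fundamental lemma of the calculus of variations\<close>

text \<open>The regularity of test functions, without the support condition.\<close>

definition C1 :: "(real^'n \<Rightarrow> real) \<Rightarrow> bool" where
  "C1 f \<longleftrightarrow> (\<forall>x. f differentiable (at x)) \<and> continuous_on UNIV (classical_grad f)"

lemma classical_grad_eqI:
  fixes f :: "real^'n \<Rightarrow> real"
  assumes "(f has_derivative (\<lambda>h. g \<bullet> h)) (at x)"
  shows "classical_grad f x = g"
proof -
  have "frechet_derivative f (at x) = (\<lambda>h. g \<bullet> h)"
    using frechet_derivative_at[OF assms] by simp
  then show ?thesis by (simp add: classical_grad_def vec_eq_iff inner_axis)
qed

lemma has_derivative_classical_grad: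
  fixes f :: "real^'n \<Rightarrow> real"
  assumes "f differentiable (at x)"
  shows "(f has_derivative (\<lambda>h. classical_grad f x \<bullet> h)) (at x)"
proof -
  let ?F = "frechet_derivative f (at x)"
  have F: "(f has_derivative ?F) (at x)" using assms by (simp add: frechet_derivative_works)
  have lin: "linear ?F" using F has_derivative_linear by blast
  have "?F h = classical_grad f x \<bullet> h" for h
  proof -
    have "?F h = ?F (\<Sum>i\<in>UNIV. (h $ i) *\<^sub>R axis i 1)"
      using basis_expansion[of h] by (simp add: scalar_mult_eq_scaleR)
    also have "\<dots> = (\<Sum>i\<in>UNIV. (h $ i) * ?F (axis i 1))"
      using lin by (simp add: linear_sum linear_cmul)
    finally show ?thesis by (simp add: classical_grad_def inner_vec_def mult.commute)
  qed
  then show ?thesis using F by (metis (no_types, lifting) ext)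
qed

lemma C1I:
  fixes f :: "real^'n \<Rightarrow> real"
  assumes "\<And>x. (f has_derivative (\<lambda>h. G x \<bullet> h)) (at x)" "continuous_on UNIV G"
  shows "C1 f"
proof -
  have "classical_grad f = G" using classical_grad_eqI[OF assms(1)] by blast
  then show ?thesis using assms by (auto simp: C1_def differentiable_def)
qed

lemma C1_has_derivative:
  "C1 f \<Longrightarrow> (f has_derivative (\<lambda>h. classical_grad f x \<bullet> h)) (at x)"
  by (simp add: C1_def has_derivative_classical_grad)

lemma C1_continuous_grad: "C1 f \<Longrightarrow> continuous_on S (classical_grad f)"
  using C1_def continuous_on_subset by blast

lemma C1_continuous: "C1 f \<Longrightarrow> continuous_on S f"
  by (simp add: C1_def continuous_at_imp_continuous_on differentiable_imp_continuous_within)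

lemma C1_const: "C1 (\<lambda>_. c)"
  by (rule C1I[where G="\<lambda>_. 0"]) (auto intro!: derivative_eq_intros)

lemma C1_mult:
  assumes "C1 f" "C1 g"
  shows "C1 (\<lambda>x. f x * g x)"
    and "classical_grad (\<lambda>x. f x * g x) x = f x *\<^sub>R classical_grad g x + g x *\<^sub>R classical_grad f x"
proof -
  let ?G = "\<lambda>x. f x *\<^sub>R classical_grad g x + g x *\<^sub>R classical_grad f x"
  have d: "((\<lambda>x. f x * g x) has_derivative (\<lambda>h. ?G x \<bullet> h)) (at x)" for x
    by (rule has_derivative_eq_rhs[OF has_derivative_mult[OF assms[THEN C1_has_derivative]]])
      (auto simp: inner_add_left)
  show "C1 (\<lambda>x. f x * g x)"
    by (rule C1I[OF d]) (intro continuous_intros assms C1_continuous C1_continuous_grad)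
  show "classical_grad (\<lambda>x. f x * g x) x = ?G x"
    by (rule classical_grad_eqI[OF d])
qed

lemma C1_add:
  assumes "C1 f" "C1 g"
  shows "C1 (\<lambda>x. f x + g x)"
proof (rule C1I)
  show "((\<lambda>x. f x + g x) has_derivative (\<lambda>h. (classical_grad f x + classical_grad g x) \<bullet> h)) (at x)" for x
    by (rule has_derivative_eq_rhs[OF has_derivative_add[OF assms[THEN C1_has_derivative]]])
      (auto simp: inner_add_left)
  show "continuous_on UNIV (\<lambda>x. classical_grad f x + classical_grad g x)"
    by (intro continuous_intros assms C1_continuous_grad)
qed

lemma C1_compose:
  assumes f: "C1 f" and q: "\<And>x. (q has_real_derivative q' (f x)) (at (f x))"
    and "continuous_on (range f) q'"
  shows "C1 (\<lambda>x. q (f x))"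
proof (rule C1I)
  show "((\<lambda>x. q (f x)) has_derivative (\<lambda>h. (q' (f x) *\<^sub>R classical_grad f x) \<bullet> h)) (at x)" for x
    by (rule has_derivative_eq_rhs[OF has_derivative_compose[OF C1_has_derivative[OF f]
          q[of x, unfolded has_field_derivative_def]]]) auto
  show "continuous_on UNIV (\<lambda>x. q' (f x) *\<^sub>R classical_grad f x)"
    using assms(3) by (intro continuous_intros C1_continuous_grad f
        continuous_on_compose2[OF _ C1_continuous[OF f]]) auto
qed

lemma C1_prod:
  assumes "\<And>i. i \<in> I \<Longrightarrow> C1 (f i)"
  shows "C1 (\<lambda>x. \<Prod>i\<in>I. f i x)"
  using assms by (induction I rule: infinite_finite_induct) (auto intro: C1_const C1_mult)

lemma C1_sum:
  assumes "\<And>i. i \<in> I \<Longrightarrow> C1 (f i)"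
  shows "C1 (\<lambda>x. \<Sum>i\<in>I. f i x)"
  using assms by (induction I rule: infinite_finite_induct) (auto intro: C1_const C1_add)

lemma C1_power: "C1 f \<Longrightarrow> C1 (\<lambda>x. f x ^ k)"
  by (induction k) (auto intro: C1_const C1_mult)

lemma C1_coordinate: "C1 (\<lambda>x :: real^'n. x $ i)"
proof (rule C1I[where G="\<lambda>_. axis i 1"])
  have "((\<lambda>x. axis i 1 \<bullet> x) has_derivative (\<lambda>h. axis i 1 \<bullet> h)) (at x)" for i and x :: "real^'n"
    by (rule bounded_linear_imp_has_derivative[OF bounded_linear_inner_right])
  then show "((\<lambda>x. x $ i) has_derivative (\<lambda>h. axis i 1 \<bullet> h)) (at x)" for x
    by (simp add: inner_axis')
qed auto

lemma has_real_derivative_pos_part_sq: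
  "((\<lambda>t. (max 0 t)\<^sup>2) has_real_derivative 2 * max 0 t) (at t)"
proof -
  consider "t > 0" | "t < 0" | "t = 0" by linarith
  then show ?thesis
  proof cases
    case 1
    have "((\<lambda>t::real. t\<^sup>2) has_real_derivative 2 * max 0 t) (at t)"
      using 1 by (auto intro!: derivative_eq_intros)
    then show ?thesis
      by (rule has_field_derivative_transform_within_open[where S="{0<..}"]) (use 1 in auto)
  next
    case 2
    have "((\<lambda>t::real. 0) has_real_derivative 2 * max 0 t) (at t)"
      using 2 by (auto intro!: derivative_eq_intros)
    then show ?thesis
      by (rule has_field_derivative_transform_within_open[where S="{..<0}"]) (use 2 in auto)
  next
    case 3
    have "((\<lambda>h::real. ((max 0 (0 + h))\<^sup>2 - (max 0 0)\<^sup>2) / h) \<longlongrightarrow> 0) (at 0)"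
    proof (rule Lim_null_comparison)
      show "\<forall>\<^sub>F h in at 0. norm (((max 0 (0 + h))\<^sup>2 - (max 0 0)\<^sup>2) / h) \<le> \<bar>h::real\<bar>"
        by (intro always_eventually) (auto simp: max_def power2_eq_square)
      show "((\<lambda>h::real. \<bar>h\<bar>) \<longlongrightarrow> 0) (at 0)"
        by (intro tendsto_rabs_zero tendsto_ident_at)
    qed
    then show ?thesis using 3 by (simp add: DERIV_def)
  qed
qed

text \<open>The product over all coordinates of squared positive parts of \<open>x - a\<close> and \<open>b - x\<close>. The squares make
  the truncations continuously differentiable.\<close>

lemma ex_C1_box_function:
  fixes a b :: "real^'n"
  obtains P where "C1 P" "\<And>x. x \<in> box a b \<Longrightarrow> P x > 0" "\<And>x. x \<notin> box a b \<Longrightarrow> P x = 0"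
proof
  let ?q = "\<lambda>t::real. (max 0 t)\<^sup>2"
  let ?P = "\<lambda>x::real^'n. \<Prod>i\<in>UNIV. ?q (x $ i - a $ i) * ?q (b $ i - x $ i)"
  have q: "C1 (\<lambda>x. ?q (f x))" if "C1 f" for f :: "real^'n \<Rightarrow> real"
    by (rule C1_compose[OF that, where q'="\<lambda>t. 2 * max 0 t"])
      (rule has_real_derivative_pos_part_sq, intro continuous_intros)
  have "C1 (\<lambda>x. x $ i - a $ i)" "C1 (\<lambda>x. b $ i - x $ i)" for i :: 'n
    using C1_add[OF C1_coordinate[of i] C1_const[of "- (a $ i)"]]
      C1_add[OF C1_const[of "b $ i"] C1_mult(1)[OF C1_const[of "-1"] C1_coordinate[of i]]] by auto
  then show "C1 ?P" by (intro C1_prod C1_mult q)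
  show "?P x > 0" if "x \<in> box a b" for x
    using that by (intro prod_pos mult_pos_pos zero_less_power) (auto simp: mem_box_cart)
  show "?P x = 0" if out: "x \<notin> box a b" for x
  proof -
    obtain i where "\<not> (a $ i < x $ i \<and> x $ i < b $ i)" using out by (auto simp: mem_box_cart)
    then have "?q (x $ i - a $ i) * ?q (b $ i - x $ i) = 0" by (auto simp: max_def)
    then show ?thesis by (intro prod_zero) auto
  qed
qed

text \<open>With \<open>P\<close> positive exactly on the open box, the functions \<open>k P / (1 + k P)\<close> are test functions bounded
  by one that increase to the indicator of the box; dominated convergence passes to the limit.\<close>

lemma integral_cbox_zero_if_orthogonal:
  fixes g :: "real^'n \<Rightarrow> 'b::euclidean_space"
  assumes U: "cbox a b \<subseteq> U" and g: "integrable lebesgue g"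
    and orth: "\<And>\<phi>. test_function U \<phi> \<Longrightarrow> (\<integral>x. \<phi> x *\<^sub>R g x \<partial>lebesgue) = 0"
  shows "integral (cbox a b) g = 0"
proof -
  obtain P where P: "C1 P" "\<And>x. x \<in> box a b \<Longrightarrow> P x > 0" "\<And>x. x \<notin> box a b \<Longrightarrow> P x = 0"
    using ex_C1_box_function by blast
  have P0: "P x \<ge> 0" for x using P(2)[of x] P(3)[of x] by (cases "x \<in> box a b") auto
  define \<phi> where "\<phi> k x = 1 - inverse (1 + real k * P x)" for k x
  have pos: "1 + real k * P x > 0" for k x using P0[of x] by (simp add: add_pos_nonneg)
  have C1\<phi>: "C1 (\<phi> k)" for k
  proof -
    have 1: "C1 (\<lambda>x. 1 + real k * P x)" by (intro C1_add C1_const C1_mult P)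
    have nz: "1 + real k * P x \<noteq> 0" for x using pos[of k x] by linarith
    have "C1 (\<lambda>x. inverse (1 + real k * P x))"
      by (rule C1_compose[OF 1, where q'="\<lambda>t. - inverse (t ^ 2)"])
        (use nz in \<open>auto intro!: derivative_eq_intros continuous_intros simp: power2_eq_square\<close>)
    from C1_add[OF C1_const[of 1] C1_mult(1)[OF C1_const[of "-1"] this]]
    show ?thesis by (simp add: \<phi>_def[abs_def])
  qed
  have test: "test_function U (\<phi> k)" for k
    unfolding test_function_def
  proof (intro conjI exI[of _ "cbox a b"] allI impI)
    show "\<phi> k x = 0" if "x \<notin> cbox a b" for x
      using P(3)[of x] that box_subset_cbox by (auto simp: \<phi>_def)
  qed (use C1\<phi> U in \<open>auto simp: C1_def\<close>)
  have bound: "norm (\<phi> k x) \<le> 1" for k x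
  proof -
    have "inverse (1 + real k * P x) \<le> 1" using P0[of x] by (simp add: inverse_le_1_iff)
    moreover have "inverse (1 + real k * P x) > 0" using pos by simp
    ultimately show ?thesis by (simp add: \<phi>_def)
  qed
  have lim: "(\<lambda>k. \<phi> k x) \<longlonglongrightarrow> indicator (box a b) x" for x
  proof (cases "x \<in> box a b")
    case True
    have "filterlim (\<lambda>k. 1 + real k * P x) at_top sequentially"
      by (intro filterlim_tendsto_add_at_top[OF tendsto_const]
          filterlim_at_top_mult_tendsto_pos[OF tendsto_const P(2)[OF True] filterlim_real_sequentially])
    then have "(\<lambda>k. inverse (1 + real k * P x)) \<longlonglongrightarrow> 0"
      using tendsto_inverse_0_at_top by blast
    then have "(\<lambda>k. \<phi> k x) \<longlonglongrightarrow> 1 - 0" unfolding \<phi>_def by (intro tendsto_intros)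
    then show ?thesis using True by simp
  next
    case False
    then show ?thesis using P(3)[OF False] by (simp add: \<phi>_def)
  qed
  have gm: "g \<in> borel_measurable lebesgue" using g by auto
  have "(\<lambda>k. \<integral>x. \<phi> k x *\<^sub>R g x \<partial>lebesgue) \<longlonglongrightarrow> (\<integral>x. indicator (box a b) x *\<^sub>R g x \<partial>lebesgue)"
  proof (rule integral_dominated_convergence[where w="\<lambda>x. norm (g x)"])
    show "(\<lambda>x. indicator (box a b) x *\<^sub>R g x) \<in> borel_measurable lebesgue"
      by (rule borel_measurable_scaleR[OF borel_measurable_indicator gm]) simp
    have \<phi>m: "\<phi> k \<in> borel_measurable lebesgue" for k
      using continuous_imp_measurable_on_sets_lebesgue[OF C1_continuous[OF C1\<phi>], of UNIV k]
      by (simp add: lebesgue_on_UNIV_eq)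
    show "(\<lambda>x. \<phi> k x *\<^sub>R g x) \<in> borel_measurable lebesgue" for k
      by (rule borel_measurable_scaleR[OF \<phi>m gm])
    show "AE x in lebesgue. (\<lambda>k. \<phi> k x *\<^sub>R g x) \<longlonglongrightarrow> indicator (box a b) x *\<^sub>R g x"
      by (intro always_eventually allI tendsto_intros lim)
    show "AE x in lebesgue. norm (\<phi> k x *\<^sub>R g x) \<le> norm (g x)" for k
      using bound by (intro always_eventually allI) (auto simp: mult_left_le_one_le)
  qed (use g in auto)
  then have "(\<integral>x. indicator (box a b) x *\<^sub>R g x \<partial>lebesgue) = 0"
    using orth[OF test] LIMSEQ_unique by (simp add: LIMSEQ_const_iff)
  moreover have "set_integrable lebesgue (box a b) g"
    using g unfolding set_integrable_def by (intro integrable_mult_indicator) auto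
  ultimately have "integral (box a b) g = 0"
    using set_lebesgue_integral_eq_integral(2) by (fastforce simp: set_lebesgue_integral_def)
  then show ?thesis by (simp add: integral_open_interval)
qed

text \<open>All integrals over small boxes inside \<open>U\<close> vanish, and almost every point is a limit of box averages
  (Lebesgue differentiation).\<close>

lemma AE_zero_if_orthogonal_to_test_functions:
  fixes g :: "real^'n \<Rightarrow> 'b::euclidean_space"
  assumes U: "open U" and g: "integrable (lebesgue_on U) g"
    and orth: "\<And>\<phi>. test_function U \<phi> \<Longrightarrow> (\<integral>x. \<phi> x *\<^sub>R g x \<partial>lebesgue_on U) = 0"
  shows "AE x in lebesgue_on U. g x = 0"
proof -
  define f where "f x = indicator U x *\<^sub>R g x" for x
  have Um: "U \<inter> space lebesgue \<in> sets lebesgue" using U by auto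
  have f: "integrable lebesgue f"
    using g integrable_restrict_space[OF Um, of g] by (simp add: f_def[abs_def])
  have "integral (cbox a b) f = 0" if "cbox a b \<subseteq> U" for a b
  proof (rule integral_cbox_zero_if_orthogonal[OF that f])
    fix \<phi> :: "real^'n \<Rightarrow> real" assume "test_function U \<phi>"
    from orth[OF this] show "(\<integral>x. \<phi> x *\<^sub>R f x \<partial>lebesgue) = 0"
      using integral_restrict_space[OF Um, of "\<lambda>x. \<phi> x *\<^sub>R g x"]
      by (simp add: f_def mult.commute)
  qed
  note zero = this
  have "f integrable_on cbox a b" for a b
    using integrable_on_lebesgue[OF f] integrable_on_subcbox by blast
  then obtain N where N: "negligible N" and
    diff: "\<And>x e. \<lbrakk>x \<notin> N; 0 < e\<rbrakk> \<Longrightarrow> \<exists>d>0. \<forall>h. 0 < h \<and> h < d \<longrightarrow>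
       norm (integral (cbox x (x + h *\<^sub>R One)) f /\<^sub>R h ^ DIM(real^'n) - f x) < e"
    using integrable_ccontinuous_explicit by blast
  have "g x = 0" if x: "x \<in> U" "x \<notin> N" for x
  proof -
    obtain r where r: "r > 0" "ball x r \<subseteq> U" using U x(1) openE by blast
    have "norm (f x) < e" if e: "e > 0" for e
    proof -
      obtain d where d: "d > 0" "\<And>h. 0 < h \<and> h < d \<Longrightarrow>
          norm (integral (cbox x (x + h *\<^sub>R One)) f /\<^sub>R h ^ DIM(real^'n) - f x) < e"
        using diff[OF x(2) e] by blast
      \<comment> \<open>The side length \<open>h\<close> keeps the box based at \<open>x\<close> inside the ball of radius \<open>r\<close>.\<close>
      define M where "M = norm (One :: real^'n) + 1"
      have M: "M > 0" by (simp add: M_def add_nonneg_pos)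
      define h where "h = min (d / 2) (r / (2 * M))"
      have h: "0 < h" "h < d" using d r M by (auto simp: h_def)
      have hM: "h * norm (One :: real^'n) < r"
      proof -
        have "h * norm (One :: real^'n) \<le> r / (2 * M) * M"
          using M h r by (intro mult_mono) (auto simp: h_def M_def)
        also have "\<dots> < r" using M r by simp
        finally show ?thesis .
      qed
      have "cbox x (x + h *\<^sub>R One) \<subseteq> U"
      proof
        fix y assume y: "y \<in> cbox x (x + h *\<^sub>R One)"
        have "norm (y - x) \<le> norm (h *\<^sub>R (One :: real^'n))"
        proof (rule norm_le_componentwise)
          fix i :: "real^'n" assume i: "i \<in> Basis"
          have "0 \<le> (y - x) \<bullet> i" "(y - x) \<bullet> i \<le> h *\<^sub>R One \<bullet> i"
            using y i by (auto simp: mem_box inner_diff_left inner_add_left)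
          then show "\<bar>(y - x) \<bullet> i\<bar> \<le> \<bar>h *\<^sub>R One \<bullet> i\<bar>" by linarith
        qed
        then have "dist x y < r" using hM h by (simp add: dist_norm norm_minus_commute)
        then show "y \<in> U" using r by auto
      qed
      then show ?thesis using d(2)[of h] h zero by simp
    qed
    then have "f x = 0" by (metis less_irrefl zero_less_norm_iff)
    then show ?thesis using x by (simp add: f_def)
  qed
  moreover have "N \<in> null_sets lebesgue" using N by (simp add: negligible_iff_null_sets)
  ultimately have "AE x in lebesgue. x \<in> U \<longrightarrow> g x = 0"
    by (intro AE_I'[of N]) auto
  then show ?thesis using U by (subst AE_restrict_space_iff) auto
qed

section \<open>Weak gradients\<close>

lemma lmeasurable_bounded_open: "open \<Omega> \<Longrightarrow> bounded \<Omega> \<Longrightarrow> \<Omega> \<in> lmeasurable"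
  using lmeasurable_open by blast

lemma in_L2_continuous:
  fixes h :: "real^'n \<Rightarrow> 'b::euclidean_space"
  assumes \<Omega>: "open \<Omega>" "bounded \<Omega>" and h: "continuous_on (closure \<Omega>) h"
  shows "in_L2 \<Omega> h"
proof -
  have m: "h \<in> borel_measurable (lebesgue_on \<Omega>)"
    by (rule continuous_imp_measurable_on_sets_lebesgue[OF continuous_on_subset[OF h closure_subset]])
      (use \<Omega> in simp)
  have "bounded (h ` closure \<Omega>)"
    using \<Omega> h by (intro compact_imp_bounded compact_continuous_image) (auto simp: compact_closure)
  then obtain B where B: "\<And>x. x \<in> closure \<Omega> \<Longrightarrow> norm (h x) \<le> B"
    by (auto simp: bounded_iff)
  have "integrable (lebesgue_on \<Omega>) (\<lambda>x. (norm (h x))\<^sup>2)"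
  proof (rule Bochner_Integration.integrable_bound)
    show "integrable (lebesgue_on \<Omega>) (\<lambda>x. B\<^sup>2)"
      using lmeasurable_bounded_open[OF \<Omega>] by (intro finite_measure.integrable_const)
        (auto simp: finite_measure_lebesgue_on)
    show "AE x in lebesgue_on \<Omega>. norm ((norm (h x))\<^sup>2) \<le> norm (B\<^sup>2)"
      using B closure_subset by (intro AE_I2) (auto intro!: power_mono)
  qed (use m in measurable)
  then show ?thesis using m by (simp add: in_L2_def)
qed

lemma integrable_L2_scaleR:
  fixes f :: "real^'n \<Rightarrow> real" and g :: "real^'n \<Rightarrow> 'b::euclidean_space"
  assumes "in_L2 \<Omega> f" "in_L2 \<Omega> g"
  shows "integrable (lebesgue_on \<Omega>) (\<lambda>x. f x *\<^sub>R g x)"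
proof (rule Bochner_Integration.integrable_bound)
  show "integrable (lebesgue_on \<Omega>) (\<lambda>x. (norm (f x))\<^sup>2 + (norm (g x))\<^sup>2)"
    using assms by (auto simp: in_L2_def)
  show "(\<lambda>x. f x *\<^sub>R g x) \<in> borel_measurable (lebesgue_on \<Omega>)"
    using assms unfolding in_L2_def by (intro borel_measurable_scaleR) auto
  have "norm (f x *\<^sub>R g x) \<le> (norm (f x))\<^sup>2 + (norm (g x))\<^sup>2" for x
    using sum_squares_bound[of "norm (f x)" "norm (g x)"]
      mult_nonneg_nonneg[OF norm_ge_zero[of "f x"] norm_ge_zero[of "g x"]]
    unfolding norm_scaleR real_norm_def by linarith
  then show "AE x in lebesgue_on \<Omega>. norm (f x *\<^sub>R g x) \<le> norm ((norm (f x))\<^sup>2 + (norm (g x))\<^sup>2)"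
    by auto
qed

lemma test_functionD:
  assumes "test_function U \<phi>"
  shows test_function_C1: "C1 \<phi>"
    and test_function_mono: "U \<subseteq> \<Omega> \<Longrightarrow> test_function \<Omega> \<phi>"
    and test_function_zero: "x \<notin> U \<Longrightarrow> \<phi> x = 0"
  using assms by (auto simp: test_function_def C1_def)

lemma test_function_grad_zero:
  assumes "test_function U \<phi>" "x \<notin> U"
  shows "classical_grad \<phi> x = 0"
proof (rule classical_grad_eqI)
  obtain K where K: "compact K" "K \<subseteq> U" "\<And>x. x \<notin> K \<Longrightarrow> \<phi> x = 0"
    using assms(1) by (auto simp: test_function_def)
  have "((\<lambda>_. 0) has_derivative (\<lambda>h. 0 \<bullet> h)) (at x)"
    by (auto intro!: derivative_eq_intros)
  then show "(\<phi> has_derivative (\<lambda>h. 0 \<bullet> h)) (at x)"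
    by (rule has_derivative_transform_within_open[where s="- K"])
      (use K assms(2) in \<open>auto simp: open_Compl compact_imp_closed\<close>)
qed

lemma in_L2_test_function:
  assumes "test_function U \<phi>" "open \<Omega>" "bounded \<Omega>"
  shows "in_L2 \<Omega> \<phi>" "in_L2 \<Omega> (classical_grad \<phi>)"
  using test_function_C1[OF assms(1)] assms(2,3)
  by (auto intro: in_L2_continuous C1_continuous C1_continuous_grad)

lemma in_L2_subset:
  assumes "in_L2 \<Omega> f" "U \<subseteq> \<Omega>" "open U" "open \<Omega>"
  shows "in_L2 U f"
proof -
  have m: "U \<inter> space lebesgue \<in> sets lebesgue" "\<Omega> \<inter> space lebesgue \<in> sets lebesgue"
    using assms(3,4) by auto
  have f: "f \<in> borel_measurable (lebesgue_on U)"
    using assms(1) unfolding in_L2_def by (intro measurable_restrict_mono[OF _ assms(2)]) simp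
  have "integrable lebesgue (\<lambda>x. indicator \<Omega> x *\<^sub>R (norm (f x))\<^sup>2)"
    using assms(1) integrable_restrict_space[OF m(2), of "\<lambda>x. (norm (f x))\<^sup>2"] by (simp add: in_L2_def)
  then have "integrable lebesgue (\<lambda>x. indicator U x *\<^sub>R (indicator \<Omega> x *\<^sub>R (norm (f x))\<^sup>2))"
    by (rule integrable_mult_indicator[rotated]) (use m in simp)
  moreover have "indicator U x *\<^sub>R (indicator \<Omega> x *\<^sub>R (norm (f x))\<^sup>2) = indicator U x *\<^sub>R (norm (f x))\<^sup>2" for x
    using assms(2) by (auto simp: indicator_def)
  ultimately have "integrable lebesgue (\<lambda>x. indicator U x *\<^sub>R (norm (f x))\<^sup>2)" by (simp only:)
  then have "integrable (lebesgue_on U) (\<lambda>x. (norm (f x))\<^sup>2)"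
    using integrable_restrict_space[OF m(1), of "\<lambda>x. (norm (f x))\<^sup>2"] by simp
  then show ?thesis using f by (simp add: in_L2_def)
qed

lemma integral_test_function_subset:
  fixes g :: "real^'n \<Rightarrow> 'b::euclidean_space"
  assumes "U \<subseteq> \<Omega>" "open U" "open \<Omega>" and "\<And>x. x \<notin> U \<Longrightarrow> g x = 0"
  shows "(\<integral>x. g x \<partial>lebesgue_on \<Omega>) = (\<integral>x. g x \<partial>lebesgue_on U)"
proof -
  have m: "U \<inter> space lebesgue \<in> sets lebesgue" "\<Omega> \<inter> space lebesgue \<in> sets lebesgue"
    using assms(2,3) by auto
  have "indicator \<Omega> x *\<^sub>R g x = indicator U x *\<^sub>R g x" for x
    using assms(1,4) by (cases "x \<in> U") auto
  then show ?thesis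
    unfolding integral_restrict_space[OF m(1)] integral_restrict_space[OF m(2)] by (simp only:)
qed

lemma integrable_in_L2:
  assumes "open \<Omega>" "bounded \<Omega>" "in_L2 \<Omega> f"
  shows "integrable (lebesgue_on \<Omega>) f"
  using integrable_L2_scaleR[OF in_L2_continuous[OF assms(1,2) continuous_on_const[of _ 1]] assms(3)]
  by simp

text \<open>Localized to an open subset \<open>U\<close>, so that it can also identify a weak gradient on a single mesh cell.\<close>

lemma weak_grad_unique_on:
  fixes F G :: "real^'n \<Rightarrow> 'b::euclidean_space"
  assumes \<Omega>: "open \<Omega>" "bounded \<Omega>" and U: "open U" "U \<subseteq> \<Omega>" and F: "in_L2 \<Omega> F" and G: "in_L2 U G"
    and eq: "\<And>\<phi>. test_function U \<phi> \<Longrightarrow>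
      (\<integral>x. \<phi> x *\<^sub>R F x \<partial>lebesgue_on \<Omega>) = (\<integral>x. \<phi> x *\<^sub>R G x \<partial>lebesgue_on U)"
  shows "AE x in lebesgue_on U. F x = G x"
proof -
  have Ub: "bounded U" using \<Omega> U bounded_subset by blast
  have FU: "in_L2 U F" by (rule in_L2_subset[OF F U(2,1) \<Omega>(1)])
  have "AE x in lebesgue_on U. axpy F (-1) G x = 0"
  proof (rule AE_zero_if_orthogonal_to_test_functions[OF U(1)])
    show "integrable (lebesgue_on U) (axpy F (-1) G)"
      by (rule integrable_in_L2[OF U(1) Ub in_L2_axpy[OF FU G]])
    fix \<phi> :: "real^'n \<Rightarrow> real" assume \<phi>: "test_function U \<phi>"
    have "in_L2 U \<phi>" by (rule in_L2_test_function(1)[OF \<phi> U(1) Ub])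
    note int = integrable_L2_scaleR[OF this FU] integrable_L2_scaleR[OF this G]
    have "(\<integral>x. \<phi> x *\<^sub>R F x \<partial>lebesgue_on \<Omega>) = (\<integral>x. \<phi> x *\<^sub>R F x \<partial>lebesgue_on U)"
      by (rule integral_test_function_subset[OF U(2,1) \<Omega>(1)]) (simp add: test_function_zero[OF \<phi>])
    then show "(\<integral>x. \<phi> x *\<^sub>R axpy F (-1) G x \<partial>lebesgue_on U) = 0"
      using eq[OF \<phi>] int by (simp add: axpy_def scaleR_diff_right)
  qed
  then show ?thesis by (simp add: axpy_def)
qed

lemma has_weak_grad_unique:
  assumes "open \<Omega>" "bounded \<Omega>" "in_L2 \<Omega> F" "in_L2 \<Omega> G" "has_weak_grad \<Omega> f F" "has_weak_grad \<Omega> f G"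
  shows "AE x in lebesgue_on \<Omega>. F x = G x"
  using assms(5,6)
  by (intro weak_grad_unique_on[OF assms(1,2,1) _ assms(3,4)]) (auto simp: has_weak_grad_def)

lemma has_weak_grad_axpy:
  assumes \<Omega>: "open \<Omega>" "bounded \<Omega>" and L2: "in_L2 \<Omega> f" "in_L2 \<Omega> g" "in_L2 \<Omega> F" "in_L2 \<Omega> G"
    and f: "has_weak_grad \<Omega> f F" and g: "has_weak_grad \<Omega> g G"
  shows "has_weak_grad \<Omega> (axpy f c g) (axpy F c G)"
  unfolding has_weak_grad_def
proof (intro allI impI)
  fix \<phi> :: "real^'a \<Rightarrow> real" assume \<phi>: "test_function \<Omega> \<phi>"
  note t = in_L2_test_function[OF \<phi> \<Omega>]
  have "(\<integral>x. axpy f c g x *\<^sub>R classical_grad \<phi> x \<partial>lebesgue_on \<Omega>) =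
      (\<integral>x. f x *\<^sub>R classical_grad \<phi> x + c *\<^sub>R (g x *\<^sub>R classical_grad \<phi> x) \<partial>lebesgue_on \<Omega>)"
    by (simp add: axpy_def scaleR_add_left)
  also have "\<dots> = (\<integral>x. f x *\<^sub>R classical_grad \<phi> x \<partial>lebesgue_on \<Omega>) +
      c *\<^sub>R (\<integral>x. g x *\<^sub>R classical_grad \<phi> x \<partial>lebesgue_on \<Omega>)"
    using integrable_L2_scaleR[OF L2(1) t(2)] integrable_L2_scaleR[OF L2(2) t(2)]
    by (subst Bochner_Integration.integral_add) (auto simp del: scaleR_scaleR)
  also have "\<dots> = - ((\<integral>x. \<phi> x *\<^sub>R F x \<partial>lebesgue_on \<Omega>) + c *\<^sub>R (\<integral>x. \<phi> x *\<^sub>R G x \<partial>lebesgue_on \<Omega>))"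
    using f g \<phi> by (simp add: has_weak_grad_def)
  also have "(\<integral>x. \<phi> x *\<^sub>R F x \<partial>lebesgue_on \<Omega>) + c *\<^sub>R (\<integral>x. \<phi> x *\<^sub>R G x \<partial>lebesgue_on \<Omega>) =
      (\<integral>x. \<phi> x *\<^sub>R F x + c *\<^sub>R (\<phi> x *\<^sub>R G x) \<partial>lebesgue_on \<Omega>)"
    using integrable_L2_scaleR[OF t(1) L2(3)] integrable_L2_scaleR[OF t(1) L2(4)]
    by (subst Bochner_Integration.integral_add) (auto simp del: scaleR_scaleR)
  also have "\<dots> = (\<integral>x. \<phi> x *\<^sub>R axpy F c G x \<partial>lebesgue_on \<Omega>)"
    by (simp add: axpy_def scaleR_add_right mult.commute)
  finally show "(\<integral>x. axpy f c g x *\<^sub>R classical_grad \<phi> x \<partial>lebesgue_on \<Omega>) =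
      - (\<integral>x. \<phi> x *\<^sub>R axpy F c G x \<partial>lebesgue_on \<Omega>)" .
qed

lemma has_weak_grad_zero:
  assumes "open \<Omega>" "\<And>x. x \<in> \<Omega> \<Longrightarrow> f x = 0"
  shows "has_weak_grad \<Omega> f (\<lambda>_. 0)"
proof -
  have "(\<integral>x. f x *\<^sub>R classical_grad \<phi> x \<partial>lebesgue_on \<Omega>) = (\<integral>x. 0 \<partial>lebesgue_on \<Omega>)" for \<phi>
    by (rule Bochner_Integration.integral_cong) (use assms in auto)
  then show ?thesis by (simp add: has_weak_grad_def)
qed

lemma weak_grad_H1:
  assumes "in_H1 \<Omega> f"
  shows "in_L2 \<Omega> (weak_grad \<Omega> f)" "has_weak_grad \<Omega> f (weak_grad \<Omega> f)"
proof -
  obtain G where "in_L2 \<Omega> G \<and> has_weak_grad \<Omega> f G" using assms by (auto simp: in_H1_def)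
  then have "in_L2 \<Omega> (weak_grad \<Omega> f) \<and> has_weak_grad \<Omega> f (weak_grad \<Omega> f)"
    unfolding weak_grad_def by (rule someI[of "\<lambda>G. in_L2 \<Omega> G \<and> has_weak_grad \<Omega> f G"])
  then show "in_L2 \<Omega> (weak_grad \<Omega> f)" "has_weak_grad \<Omega> f (weak_grad \<Omega> f)" by auto
qed

lemma in_H1_in_L2: "in_H1 \<Omega> f \<Longrightarrow> in_L2 \<Omega> f"
  by (simp add: in_H1_def)

lemma lin_space_H1:
  assumes "open \<Omega>" "bounded \<Omega>"
  shows "lin_space {f. in_H1 \<Omega> f}"
proof -
  have "in_H1 \<Omega> (\<lambda>_. 0)"
    unfolding in_H1_def by (intro conjI exI[of _ "\<lambda>_. 0"] in_L2_zero has_weak_grad_zero[OF assms(1)]) simp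
  moreover have "in_H1 \<Omega> (axpy f c g)" if "in_H1 \<Omega> f" "in_H1 \<Omega> g" for f g c
    using that in_L2_axpy[of \<Omega> f g c] has_weak_grad_axpy[OF assms, of f g _ _ c]
      in_L2_axpy[of \<Omega> _ _ c] unfolding in_H1_def by metis
  ultimately show ?thesis by (auto simp: lin_space_def)
qed

text \<open>Any linear combination of weak gradients is a weak gradient of the combination, so by uniqueness it
  agrees almost everywhere with the selected representative.\<close>

lemma weak_grad_linear:
  assumes \<Omega>: "open \<Omega>" "bounded \<Omega>"
  shows "L2_linear \<Omega> {f. in_H1 \<Omega> f} (weak_grad \<Omega>)"
proof -
  have "AE x in lebesgue_on \<Omega>. weak_grad \<Omega> (axpy f c g) x = axpy (weak_grad \<Omega> f) c (weak_grad \<Omega> g) x"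
    if fg: "in_H1 \<Omega> f" "in_H1 \<Omega> g" for f g c
  proof (rule has_weak_grad_unique[OF \<Omega>])
    have "in_H1 \<Omega> (axpy f c g)" using lin_spaceD(2)[OF lin_space_H1[OF \<Omega>]] fg by blast
    then show "in_L2 \<Omega> (weak_grad \<Omega> (axpy f c g))"
        "has_weak_grad \<Omega> (axpy f c g) (weak_grad \<Omega> (axpy f c g))"
      by (fact weak_grad_H1)+
    show "in_L2 \<Omega> (axpy (weak_grad \<Omega> f) c (weak_grad \<Omega> g))"
      by (intro in_L2_axpy weak_grad_H1 fg)
    show "has_weak_grad \<Omega> (axpy f c g) (axpy (weak_grad \<Omega> f) c (weak_grad \<Omega> g))"
      by (intro has_weak_grad_axpy \<Omega> weak_grad_H1 fg in_H1_in_L2)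
  qed
  then show ?thesis by (auto simp: L2_linear_def weak_grad_H1)
qed

lemma weak_grad_zero:
  assumes "open \<Omega>" "bounded \<Omega>" "in_H1 \<Omega> f" "\<And>x. x \<in> \<Omega> \<Longrightarrow> f x = 0"
  shows "AE x in lebesgue_on \<Omega>. weak_grad \<Omega> f x = 0"
  by (rule has_weak_grad_unique[OF assms(1,2) weak_grad_H1(1)[OF assms(3)] in_L2_zero
        weak_grad_H1(2)[OF assms(3)] has_weak_grad_zero[OF assms(1,4)]])

section \<open>Jacobian, strain and divergence\<close>

lemma in_L2_linear_image:
  fixes f :: "real^'n \<Rightarrow> 'b::euclidean_space" and L :: "'b \<Rightarrow> 'c::euclidean_space"
  assumes L: "linear L" and f: "in_L2 \<Omega> f"
  shows "in_L2 \<Omega> (\<lambda>x. L (f x))"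
proof -
  have bl: "bounded_linear L" using L by (simp add: linear_conv_bounded_linear)
  then obtain B where B: "\<And>y. norm (L y) \<le> B * norm y"
    using linear_bounded[OF L] by blast
  have fm: "f \<in> borel_measurable (lebesgue_on \<Omega>)" using f by (simp add: in_L2_def)
  have m: "(\<lambda>x. L (f x)) \<in> borel_measurable (lebesgue_on \<Omega>)"
    by (rule measurable_compose[OF fm]) (simp add: borel_measurable_continuous_onI linear_continuous_on bl)
  have "integrable (lebesgue_on \<Omega>) (\<lambda>x. (norm (L (f x)))\<^sup>2)"
  proof (rule Bochner_Integration.integrable_bound)
    show "integrable (lebesgue_on \<Omega>) (\<lambda>x. B\<^sup>2 * (norm (f x))\<^sup>2)"
      using f by (simp add: in_L2_def)
    show "AE x in lebesgue_on \<Omega>. norm ((norm (L (f x)))\<^sup>2) \<le> norm (B\<^sup>2 * (norm (f x))\<^sup>2)"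
      using power_mono[OF B norm_ge_zero, of _ 2] by (simp add: power_mult_distrib)
  qed (rule borel_measurable_power[OF measurable_compose[OF m borel_measurable_norm]])
  then show ?thesis using m by (simp add: in_L2_def)
qed

lemma in_L2_sum:
  assumes "\<And>i. i \<in> I \<Longrightarrow> in_L2 \<Omega> (f i)"
  shows "in_L2 \<Omega> (\<lambda>x. \<Sum>i\<in>I. f i x)"
  using assms
proof (induction I rule: infinite_finite_induct)
  case (insert i I)
  then have "in_L2 \<Omega> (axpy (f i) 1 (\<lambda>x. \<Sum>i\<in>I. f i x))" by (intro in_L2_axpy) auto
  then show ?case using insert by (simp add: axpy_def)
qed (simp_all add: in_L2_zero)

lemma in_L2_vec:
  fixes f :: "real^'n \<Rightarrow> ('b::euclidean_space)^'m"
  assumes "\<And>i. in_L2 \<Omega> (\<lambda>x. f x $ i)"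
  shows "in_L2 \<Omega> f"
proof -
  have lin: "linear (axis i :: 'b \<Rightarrow> 'b^'m)" for i
    by (rule linearI) (auto simp: axis_def vec_eq_iff)
  have "f x = (\<Sum>i\<in>UNIV. axis i (f x $ i))" for x
    by (simp add: vec_eq_iff axis_def if_distrib sum.delta cong: if_cong)
  moreover have "in_L2 \<Omega> (\<lambda>x. \<Sum>i\<in>UNIV. axis i (f x $ i))"
    by (intro in_L2_sum in_L2_linear_image[OF lin] assms)
  ultimately show ?thesis by (metis (no_types, lifting) ext)
qed

lemma L2_linear_subset:
  assumes "L2_linear \<Omega> V T" "V' \<subseteq> V"
  shows "L2_linear \<Omega> V' T"
  using assms unfolding L2_linear_def by blast

lemma in_H1_vec_component: "in_H1_vec \<Omega> u \<Longrightarrow> in_H1 \<Omega> (\<lambda>x. u x $ i)"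
  by (simp add: in_H1_vec_def)

lemma axpy_component: "(\<lambda>x. axpy u c v x $ i) = axpy (\<lambda>x. u x $ i) c (\<lambda>x. v x $ i)"
  by (simp add: axpy_def)

lemma lin_space_H1_vec:
  assumes "open \<Omega>" "bounded \<Omega>"
  shows "lin_space {u. in_H1_vec \<Omega> u}"
  using lin_spaceD[OF lin_space_H1[OF assms]] by (auto simp: lin_space_def in_H1_vec_def axpy_component)

lemma in_H1_vec_in_L2: "in_H1_vec \<Omega> u \<Longrightarrow> in_L2 \<Omega> u"
  by (auto intro!: in_L2_vec in_H1_in_L2 simp: in_H1_vec_def)

lemma L2_linear_id: "(\<And>u. u \<in> V \<Longrightarrow> in_L2 \<Omega> u) \<Longrightarrow> L2_linear \<Omega> V (\<lambda>u. u)"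
  by (simp add: L2_linear_def)

lemma weak_jacobian_linear:
  assumes "open \<Omega>" "bounded \<Omega>"
  shows "L2_linear \<Omega> {u. in_H1_vec \<Omega> u} (weak_jacobian \<Omega>)"
proof -
  note lin = weak_grad_linear[OF assms, unfolded L2_linear_def]
  have "in_L2 \<Omega> (weak_jacobian \<Omega> u)" if "in_H1_vec \<Omega> u" for u
    by (rule in_L2_vec) (simp add: weak_jacobian_def weak_grad_H1(1)[OF in_H1_vec_component[OF that]])
  moreover have "AE x in lebesgue_on \<Omega>.
      weak_jacobian \<Omega> (axpy u c v) x = axpy (weak_jacobian \<Omega> u) c (weak_jacobian \<Omega> v) x"
    if uv: "in_H1_vec \<Omega> u" "in_H1_vec \<Omega> v" for u v c
  proof -
    have "AE x in lebesgue_on \<Omega>. \<forall>i\<in>UNIV. weak_grad \<Omega> (axpy (\<lambda>x. u x $ i) c (\<lambda>x. v x $ i)) x =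
        axpy (weak_grad \<Omega> (\<lambda>x. u x $ i)) c (weak_grad \<Omega> (\<lambda>x. v x $ i)) x"
      using lin uv by (intro AE_finite_allI) (auto simp: in_H1_vec_def)
    then show ?thesis
      by eventually_elim (simp add: weak_jacobian_def vec_eq_iff axpy_def)
  qed
  ultimately show ?thesis by (auto simp: L2_linear_def)
qed

lemma L2_linear_image:
  assumes T: "L2_linear \<Omega> V T" and L: "linear L"
  shows "L2_linear \<Omega> V (\<lambda>u x. L (T u x))"
proof -
  have "AE x in lebesgue_on \<Omega>. L (T (axpy u c v) x) = axpy (\<lambda>x. L (T u x)) c (\<lambda>x. L (T v x)) x"
    if "u \<in> V" "v \<in> V" for u v c
  proof -
    have "AE x in lebesgue_on \<Omega>. T (axpy u c v) x = axpy (T u) c (T v) x"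
      using T that by (auto simp: L2_linear_def)
    then show ?thesis
      by eventually_elim (use L in \<open>simp add: axpy_def linear_add linear_cmul\<close>)
  qed
  then show ?thesis using T by (auto simp: L2_linear_def intro: in_L2_linear_image[OF L])
qed

definition sym_part :: "real^'n^'n \<Rightarrow> real^'n^'n" where
  "sym_part A = (1/2) *\<^sub>R (A + transpose A)"

lemma linear_sym_part: "linear sym_part"
  by (rule linearI) (auto simp: sym_part_def transpose_def vec_eq_iff algebra_simps)

lemma norm_transpose: "norm (transpose A) = norm (A :: real^'n^'n)"
proof -
  have "transpose A \<bullet> transpose A = A \<bullet> A"
    unfolding inner_vec_def transpose_def by (simp add: sum.swap[of "\<lambda>i j. A $ j $ i * A $ j $ i"])
  then show ?thesis by (simp add: norm_eq_sqrt_inner)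
qed

lemma norm_sym_part_le: "norm (sym_part A) \<le> norm A"
  using norm_triangle_ineq[of A "transpose A"] by (simp add: sym_part_def norm_transpose)

lemma strain_eq_sym_part: "strain \<Omega> u = (\<lambda>x. sym_part (weak_jacobian \<Omega> u x))"
  by (simp add: strain_def sym_part_def fun_eq_iff)

lemma strain_linear:
  assumes "open \<Omega>" "bounded \<Omega>"
  shows "L2_linear \<Omega> {u. in_H1_vec \<Omega> u} (strain \<Omega>)"
  unfolding strain_eq_sym_part[abs_def]
  by (rule L2_linear_image[OF weak_jacobian_linear[OF assms] linear_sym_part])

lemma divergence_linear:
  assumes "open \<Omega>" "bounded \<Omega>"
  shows "L2_linear \<Omega> {u. in_H1_vec \<Omega> u} (divergence \<Omega>)"
proof -
  have "linear (trace :: real^'n^'n \<Rightarrow> real)"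
    by (rule linearI) (auto simp: trace_def sum.distrib sum_distrib_left)
  moreover have "divergence \<Omega> = (\<lambda>u x. trace (weak_jacobian \<Omega> u x))"
    by (simp add: divergence_def fun_eq_iff)
  ultimately show ?thesis
    using L2_linear_image[OF weak_jacobian_linear[OF assms]] by simp
qed

text \<open>Symmetrization does not increase the Frobenius norm.\<close>

lemma L2_norm_strain_le:
  assumes "open \<Omega>" "bounded \<Omega>" "in_H1_vec \<Omega> u"
  shows "L2_norm \<Omega> (strain \<Omega> u) \<le> H1_norm_vec \<Omega> u"
proof -
  have J: "in_L2 \<Omega> (weak_jacobian \<Omega> u)" and S: "in_L2 \<Omega> (strain \<Omega> u)"
    using weak_jacobian_linear[OF assms(1,2)] strain_linear[OF assms(1,2)] assms(3)
    by (auto simp: L2_linear_def)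
  have "L2_inner \<Omega> (strain \<Omega> u) (strain \<Omega> u) \<le> L2_inner \<Omega> (weak_jacobian \<Omega> u) (weak_jacobian \<Omega> u)"
    unfolding L2_inner_def
  proof (rule integral_mono[OF integrable_L2_inner[OF S S] integrable_L2_inner[OF J J]])
    show "strain \<Omega> u x \<bullet> strain \<Omega> u x \<le> weak_jacobian \<Omega> u x \<bullet> weak_jacobian \<Omega> u x" for x
      using norm_sym_part_le[of "weak_jacobian \<Omega> u x"]
      by (simp add: strain_eq_sym_part norm_le)
  qed
  also have "\<dots> \<le> (L2_norm \<Omega> u)\<^sup>2 + (L2_norm \<Omega> (weak_jacobian \<Omega> u))\<^sup>2"
    by (simp add: L2_norm_sq L2_inner_self_nonneg)
  finally show ?thesis unfolding H1_norm_vec_def L2_norm_def[of _ "strain \<Omega> u"] by simp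
qed

section \<open>The discrete spaces\<close>

lemma poly_on_axpy:
  assumes "poly_on k E f" "poly_on k E g"
  shows "poly_on k E (axpy f c g)"
proof -
  obtain a b where "\<forall>x\<in>E. f x = (\<Sum>m | (\<Sum>i\<in>UNIV. m i) \<le> k. a m * (\<Prod>i\<in>UNIV. (x $ i) ^ m i))"
    "\<forall>x\<in>E. g x = (\<Sum>m | (\<Sum>i\<in>UNIV. m i) \<le> k. b m * (\<Prod>i\<in>UNIV. (x $ i) ^ m i))"
    using assms unfolding poly_on_def by blast
  then show ?thesis unfolding poly_on_def axpy_def
    by (intro exI[of _ "\<lambda>m. a m + c * b m"])
      (simp add: algebra_simps sum.distrib sum_distrib_left)
qed

lemma poly_on_zero: "poly_on k E (\<lambda>_. 0)"
  unfolding poly_on_def by (intro exI[of _ "\<lambda>_. 0"]) simp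

lemma biot_Omega:
  assumes "biot_setting D"
  shows "open (Omega D)" "bounded (Omega D)" "connected (Omega D)" "Omega D \<noteq> {}"
  using assms by (auto simp: biot_setting_def polyhedral_domain_def)

lemma lin_space_discrete:
  assumes "biot_setting D"
  shows "lin_space (V_h D)" "lin_space (W_h D)" "lin_space (M_h D)"
proof -
  note \<Omega> = biot_Omega(1,2)[OF assms]
  show "lin_space (V_h D)"
    using lin_spaceD[OF lin_space_H1_vec[OF \<Omega>]]
    by (auto simp: lin_space_def V_h_def axpy_component poly_on_zero poly_on_axpy)
      (auto simp: axpy_def intro!: continuous_intros)
  show "lin_space (W_h D)"
    using lin_spaceD[OF lin_space_L2[where \<Omega>="Omega D"]]
    by (auto simp: lin_space_def W_h_def poly_on_zero poly_on_axpy)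
      (auto simp: axpy_def intro!: continuous_intros)
  show "lin_space (M_h D)"
    using lin_spaceD[OF lin_space_H1[OF \<Omega>]]
    by (auto simp: lin_space_def M_h_def poly_on_zero poly_on_axpy)
      (auto simp: axpy_def intro!: continuous_intros)
qed

lemma discrete_subset:
  "V_h D \<subseteq> {u. in_H1_vec (Omega D) u}" "W_h D \<subseteq> {w. in_L2 (Omega D) w}"
  "M_h D \<subseteq> {q. in_H1 (Omega D) q}"
  by (auto simp: V_h_def W_h_def M_h_def)

section \<open>Weak and classical gradients\<close>

lemma integral_lborel_translate:
  fixes f :: "real^'n \<Rightarrow> real"
  assumes "f \<in> borel_measurable borel"
  shows "(\<integral>x. f (x + c) \<partial>lborel) = (\<integral>x. f x \<partial>lborel)"
proof -
  have "(\<integral>x. f x \<partial>lborel) = (\<integral>x. f x \<partial>distr lborel borel ((+) c))"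
    by (simp add: lborel_distr_plus)
  also have "\<dots> = (\<integral>x. f (c + x) \<partial>lborel)"
    using assms by (intro integral_distr) auto
  finally show ?thesis by (simp add: add.commute)
qed

lemma directional_has_derivative:
  assumes "C1 \<psi>"
  shows "((\<lambda>t. \<psi> (x + t *\<^sub>R e)) has_real_derivative (classical_grad \<psi> (x + t *\<^sub>R e) \<bullet> e)) (at t)"
proof -
  have "((\<lambda>t. x + t *\<^sub>R e) has_derivative (\<lambda>s. s *\<^sub>R e)) (at t)"
    by (auto intro!: derivative_eq_intros)
  from has_derivative_compose[OF this C1_has_derivative[OF assms]]
  show ?thesis by (simp add: has_field_derivative_def mult.commute[of _ "_ \<bullet> _"])
qed

text \<open>Difference quotients of a compactly supported function integrate to zero by translation invariance;
  they converge boundedly, with uniformly bounded support, to the derivative.\<close>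

lemma integral_partial_derivative_zero:
  fixes \<psi> :: "real^'n \<Rightarrow> real"
  assumes \<psi>: "C1 \<psi>" and K: "compact K" and out: "\<And>x. x \<notin> K \<Longrightarrow> \<psi> x = 0" and e: "norm e = 1"
  shows "(\<integral>x. classical_grad \<psi> x \<bullet> e \<partial>lborel) = 0"
proof -
  have test: "test_function K \<psi>"
    unfolding test_function_def using \<psi> K out by (auto simp: C1_def)
  have G0: "classical_grad \<psi> x = 0" if "x \<notin> K" for x
    by (rule test_function_grad_zero[OF test that])
  have "bounded (classical_grad \<psi> ` K)"
    by (intro compact_imp_bounded compact_continuous_image C1_continuous_grad \<psi> K)
  then obtain B0 where B0: "\<And>x. x \<in> K \<Longrightarrow> norm (classical_grad \<psi> x) \<le> B0"
    by (auto simp: bounded_iff)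
  define B where "B = max B0 0"
  have B: "norm (classical_grad \<psi> x) \<le> B" for x
    using B0[of x] G0[of x] by (cases "x \<in> K") (auto simp: B_def)
  obtain R where R: "\<And>x. x \<in> K \<Longrightarrow> norm x \<le> R"
    using compact_imp_bounded[OF K] by (auto simp: bounded_iff)
  define h where "h k = inverse (real (Suc k))" for k
  have h: "0 < h k" "h k \<le> 1" for k by (auto simp: h_def inverse_le_1_iff)
  define q where "q k x = (\<psi> (x + h k *\<^sub>R e) - \<psi> x) / h k" for k x
  have \<psi>m: "\<psi> \<in> borel_measurable borel"
    by (rule borel_measurable_continuous_onI[OF C1_continuous[OF \<psi>]])
  have int\<psi>: "integrable lborel \<psi>"
  proof -
    have "integrable lborel (\<lambda>x. indicator K x *\<^sub>R \<psi> x)"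
      by (rule borel_integrable_compact[OF K C1_continuous[OF \<psi>]])
    also have "(\<lambda>x. indicator K x *\<^sub>R \<psi> x) = \<psi>"
      using out by (auto simp: indicator_def fun_eq_iff)
    finally show ?thesis .
  qed
  have shift_m: "(\<lambda>x. \<psi> (x + c)) \<in> borel_measurable borel" for c
    by (intro borel_measurable_continuous_onI continuous_on_compose2[OF C1_continuous[OF \<psi>, of UNIV]]
        continuous_intros) auto
  have int_shift: "integrable lborel (\<lambda>x. \<psi> (x + c))" for c
  proof -
    have "integrable (distr lborel borel ((+) c)) \<psi>" using int\<psi> by (simp add: lborel_distr_plus)
    then show ?thesis
      by (subst (asm) integrable_distr_eq) (auto simp: add.commute \<psi>m)
  qed
  have q0: "(\<integral>x. q k x \<partial>lborel) = 0" for k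
    unfolding q_def using int_shift int\<psi> integral_lborel_translate[OF \<psi>m] by simp
  have lim: "(\<lambda>k. q k x) \<longlonglongrightarrow> classical_grad \<psi> x \<bullet> e" for x
  proof -
    have "((\<lambda>t. \<psi> (x + t *\<^sub>R e)) has_real_derivative (classical_grad \<psi> x \<bullet> e)) (at 0)"
      using directional_has_derivative[OF \<psi>, of x e 0] by simp
    then have "((\<lambda>t. (\<psi> (x + t *\<^sub>R e) - \<psi> x) / t) \<longlongrightarrow> classical_grad \<psi> x \<bullet> e) (at 0)"
      by (simp add: DERIV_def)
    moreover have "filterlim h (at 0) sequentially"
    proof -
      have "h \<longlonglongrightarrow> 0" using LIMSEQ_inverse_real_of_nat unfolding h_def[abs_def] .
      moreover have "h k \<noteq> 0" for k using h(1)[of k] by simp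
      ultimately show ?thesis by (simp add: filterlim_at)
    qed
    ultimately show ?thesis unfolding q_def by (rule filterlim_compose)
  qed
  have bound: "norm (q k x) \<le> B * indicator (cball 0 (R + 1)) x" for k x
  proof (cases "x \<in> cball 0 (R + 1)")
    case True
    obtain z where z: "0 < z" "z < h k"
      "\<psi> (x + h k *\<^sub>R e) - \<psi> (x + 0 *\<^sub>R e) = (h k - 0) * (classical_grad \<psi> (x + z *\<^sub>R e) \<bullet> e)"
      using MVT2[OF h(1)[of k], of "\<lambda>t. \<psi> (x + t *\<^sub>R e)" "\<lambda>t. classical_grad \<psi> (x + t *\<^sub>R e) \<bullet> e"]
        directional_has_derivative[OF \<psi>] by blast
    then have "q k x = classical_grad \<psi> (x + z *\<^sub>R e) \<bullet> e" using h(1)[of k] by (simp add: q_def)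
    then have "\<bar>q k x\<bar> \<le> norm (classical_grad \<psi> (x + z *\<^sub>R e)) * norm e"
      by (simp only: Cauchy_Schwarz_ineq2)
    also have "\<dots> \<le> B" using B e by simp
    finally show ?thesis using True by simp
  next
    case False
    have "norm x \<le> norm (x + h k *\<^sub>R e) + norm (h k *\<^sub>R e)"
      using norm_triangle_ineq4[of "x + h k *\<^sub>R e" "h k *\<^sub>R e"] by simp
    then have "norm (x + h k *\<^sub>R e) > R" "norm x > R" using False h[of k] e by auto
    then have "x \<notin> K" "x + h k *\<^sub>R e \<notin> K" using R by force+
    then show ?thesis using out False by (simp add: q_def)
  qed
  have "(\<lambda>k. \<integral>x. q k x \<partial>lborel) \<longlonglongrightarrow> (\<integral>x. classical_grad \<psi> x \<bullet> e \<partial>lborel)"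
  proof (rule integral_dominated_convergence[where w="\<lambda>x. B * indicator (cball 0 (R + 1)) x"])
    show "(\<lambda>x. classical_grad \<psi> x \<bullet> e) \<in> borel_measurable lborel"
      using borel_measurable_continuous_onI[OF continuous_on_inner[OF C1_continuous_grad[OF \<psi>] continuous_on_const]]
      by simp
    show "q k \<in> borel_measurable lborel" for k
      unfolding q_def using shift_m \<psi>m by simp
    show "integrable lborel (\<lambda>x :: real^'n. B * indicator (cball 0 (R + 1)) x)"
      using emeasure_lborel_cball_finite[of "0 :: real^'n" "R + 1"]
      by (intro integrable_mult_right integrable_real_indicator) auto
  qed (use lim bound in auto)
  then show ?thesis using q0 by (simp add: LIMSEQ_const_iff)
qed

lemma integral_classical_grad_zero:
  fixes \<psi> :: "real^'n \<Rightarrow> real"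
  assumes U: "open U" "bounded U" and \<psi>: "test_function U \<psi>"
  shows "(\<integral>x. classical_grad \<psi> x \<partial>lebesgue_on U) = 0"
proof -
  have G: "in_L2 U (classical_grad \<psi>)" by (rule in_L2_test_function(2)[OF \<psi> U])
  have int: "integrable (lebesgue_on U) (classical_grad \<psi>)" by (rule integrable_in_L2[OF U G])
  obtain K where K: "compact K" "K \<subseteq> U" "\<And>x. x \<notin> K \<Longrightarrow> \<psi> x = 0"
    using \<psi> by (auto simp: test_function_def)
  have "(\<integral>x. classical_grad \<psi> x \<partial>lebesgue_on U) $ i = 0" for i
  proof -
    let ?g = "\<lambda>x. classical_grad \<psi> x \<bullet> axis i 1"
    have "(\<integral>x. classical_grad \<psi> x \<partial>lebesgue_on U) $ i =
        (\<integral>x. classical_grad \<psi> x \<partial>lebesgue_on U) \<bullet> axis i 1"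
      by (simp add: inner_axis)
    also have "\<dots> = (\<integral>x. ?g x \<partial>lebesgue_on U)"
      by (rule integral_inner_left[symmetric]) (rule int)
    also have "\<dots> = (\<integral>x. ?g x \<partial>lebesgue_on UNIV)"
      by (rule integral_test_function_subset[symmetric]) (use U test_function_grad_zero[OF \<psi>] in auto)
    also have "\<dots> = (\<integral>x. ?g x \<partial>lborel)"
      unfolding lebesgue_on_UNIV_eq
      using borel_measurable_continuous_onI[OF continuous_on_inner[OF
          C1_continuous_grad[OF test_function_C1[OF \<psi>]] continuous_on_const]]
      by (intro integral_completion) simp
    also have "\<dots> = 0"
      by (rule integral_partial_derivative_zero[OF test_function_C1[OF \<psi>] K(1) K(3)]) auto
    finally show ?thesis .
  qed
  then show ?thesis by (simp add: vec_eq_iff)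
qed

text \<open>Integration by parts: the gradient of \<open>p \<phi>\<close> has integral zero.\<close>

lemma has_weak_grad_classical:
  assumes U: "open U" "bounded U" and p: "C1 p"
  shows "has_weak_grad U p (classical_grad p)"
  unfolding has_weak_grad_def
proof (intro allI impI)
  fix \<phi> :: "real^'a \<Rightarrow> real" assume \<phi>: "test_function U \<phi>"
  obtain K where K: "compact K" "K \<subseteq> U" "\<And>x. x \<notin> K \<Longrightarrow> \<phi> x = 0"
    using \<phi> by (auto simp: test_function_def)
  have "test_function U (\<lambda>x. p x * \<phi> x)"
    using C1_mult(1)[OF p test_function_C1[OF \<phi>]] K
    unfolding test_function_def C1_def by (intro conjI exI[of _ K]) simp_all
  from integral_classical_grad_zero[OF U this]
  have "(\<integral>x. p x *\<^sub>R classical_grad \<phi> x + \<phi> x *\<^sub>R classical_grad p x \<partial>lebesgue_on U) = 0"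
    by (simp add: C1_mult(2)[OF p test_function_C1[OF \<phi>]])
  moreover have "in_L2 U p" "in_L2 U (classical_grad p)"
    by (intro in_L2_continuous U C1_continuous C1_continuous_grad p)+
  ultimately show "(\<integral>x. p x *\<^sub>R classical_grad \<phi> x \<partial>lebesgue_on U) =
      - (\<integral>x. \<phi> x *\<^sub>R classical_grad p x \<partial>lebesgue_on U)"
    using integrable_L2_scaleR in_L2_test_function[OF \<phi> U]
    by (subst (asm) Bochner_Integration.integral_add) (auto simp: eq_neg_iff_add_eq_0)
qed

text \<open>This makes the weak gradient of a piecewise polynomial computable inside each cell.\<close>

lemma weak_grad_eq_classical:
  assumes \<Omega>: "open \<Omega>" "bounded \<Omega>" and U: "open U" "U \<subseteq> \<Omega>" and f: "in_H1 \<Omega> f"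
    and p: "C1 p" and eq: "\<And>x. x \<in> U \<Longrightarrow> f x = p x"
  shows "AE x in lebesgue_on U. weak_grad \<Omega> f x = classical_grad p x"
proof (rule weak_grad_unique_on[OF \<Omega> U weak_grad_H1(1)[OF f]])
  have Ub: "bounded U" using \<Omega> U bounded_subset by blast
  show "in_L2 U (classical_grad p)" by (intro in_L2_continuous U Ub C1_continuous_grad p)
  fix \<phi> assume \<phi>: "test_function U \<phi>"
  have "(\<integral>x. \<phi> x *\<^sub>R weak_grad \<Omega> f x \<partial>lebesgue_on \<Omega>) = - (\<integral>x. f x *\<^sub>R classical_grad \<phi> x \<partial>lebesgue_on \<Omega>)"
    using weak_grad_H1(2)[OF f] test_function_mono[OF \<phi> U(2)] by (simp add: has_weak_grad_def)
  also have "(\<integral>x. f x *\<^sub>R classical_grad \<phi> x \<partial>lebesgue_on \<Omega>) = (\<integral>x. f x *\<^sub>R classical_grad \<phi> x \<partial>lebesgue_on U)"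
    by (rule integral_test_function_subset[OF U(2,1) \<Omega>(1)]) (simp add: test_function_grad_zero[OF \<phi>])
  also have "\<dots> = (\<integral>x. p x *\<^sub>R classical_grad \<phi> x \<partial>lebesgue_on U)"
    by (rule Bochner_Integration.integral_cong) (use eq in auto)
  also have "- \<dots> = (\<integral>x. \<phi> x *\<^sub>R classical_grad p x \<partial>lebesgue_on U)"
    using has_weak_grad_classical[OF U(1) Ub p] \<phi> by (simp add: has_weak_grad_def)
  finally show "(\<integral>x. \<phi> x *\<^sub>R weak_grad \<Omega> f x \<partial>lebesgue_on \<Omega>) = (\<integral>x. \<phi> x *\<^sub>R classical_grad p x \<partial>lebesgue_on U)" .
qed

lemma AE_zero_continuous:
  fixes g :: "real^'n \<Rightarrow> 'b::euclidean_space"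
  assumes U: "open U" and g: "continuous_on U g" and ae: "AE x in lebesgue_on U. g x = 0" and x: "x \<in> U"
  shows "g x = 0"
proof (rule ccontr)
  assume "g x \<noteq> 0"
  let ?S = "U \<inter> g -` (- {0})"
  have op: "open ?S" by (rule continuous_open_preimage[OF g U]) (simp add: open_Compl)
  have "AE x in lebesgue. x \<notin> ?S"
    using ae U by (subst (asm) AE_restrict_space_iff) auto
  then have "?S \<in> null_sets lebesgue"
    using op by (subst (asm) AE_iff_null_sets[symmetric]) auto
  then have "negligible ?S" by (simp add: negligible_iff_null_sets)
  then show False using open_not_negligible[OF op] x \<open>g x \<noteq> 0\<close> by blast
qed

section \<open>Fields with orthogonal increments\<close>

lemma sym_part_zero_orthogonal:
  fixes A :: "real^'n^'n"
  assumes "sym_part A = 0"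
  shows "d \<bullet> (A *v d) = 0"
proof -
  have "A + transpose A = 0" using assms by (simp add: sym_part_def)
  then have "d \<bullet> (A *v d) + d \<bullet> (transpose A *v d) = 0"
    by (metis inner_add_right inner_zero_right matrix_vector_mult_0 matrix_vector_mult_add_rdistrib)
  moreover have "d \<bullet> (A *v d) = d \<bullet> (transpose A *v d)"
    by (metis dot_lmul_matrix inner_commute transpose_matrix_vector)
  ultimately show ?thesis by simp
qed

text \<open>Along the segment from \<open>x\<close> to \<open>y\<close> with direction \<open>d\<close> the derivative of \<open>v \<bullet> d\<close> is \<open>d \<bullet> (\<nabla>v d)\<close>, which
  only sees the symmetric part of \<open>\<nabla>v\<close>.\<close>

lemma orthogonal_increments_if_strain_zero:
  fixes v :: "real^'n \<Rightarrow> real^'n" and p :: "'n \<Rightarrow> real^'n \<Rightarrow> real"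
  assumes U: "open U" "convex U" and p: "\<And>i. C1 (p i)" and eq: "\<And>z i. z \<in> U \<Longrightarrow> v z $ i = p i z"
    and zero: "\<And>z. z \<in> U \<Longrightarrow> sym_part (\<chi> i. classical_grad (p i) z) = 0" and xy: "x \<in> U" "y \<in> U"
  shows "(v y - v x) \<bullet> (y - x) = 0"
proof -
  define d where "d = y - x"
  let ?s = "\<lambda>t. \<Sum>i\<in>UNIV. p i (x + t *\<^sub>R d) * d $ i"
  have seg: "x + t *\<^sub>R d \<in> U" if "0 \<le> t" "t \<le> 1" for t
    using convexD_alt[OF U(2) xy, of t] that by (simp add: d_def algebra_simps)
  have "DERIV ?s t :> (\<Sum>i\<in>UNIV. (classical_grad (p i) (x + t *\<^sub>R d) \<bullet> d) * d $ i)" for t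
    by (intro DERIV_sum DERIV_cmult_right directional_has_derivative p)
  then obtain t where t: "0 < t" "t < 1" and
    s: "?s 1 - ?s 0 = (1 - 0) * (\<Sum>i\<in>UNIV. (classical_grad (p i) (x + t *\<^sub>R d) \<bullet> d) * d $ i)"
    using MVT2[of 0 1 ?s "\<lambda>t. \<Sum>i\<in>UNIV. (classical_grad (p i) (x + t *\<^sub>R d) \<bullet> d) * d $ i"] by auto
  have "(\<Sum>i\<in>UNIV. (classical_grad (p i) (x + t *\<^sub>R d) \<bullet> d) * d $ i) =
      d \<bullet> ((\<chi> i. classical_grad (p i) (x + t *\<^sub>R d)) *v d)"
    by (simp add: inner_vec_def matrix_vector_mult_def mult.commute)
  also have "\<dots> = 0" by (rule sym_part_zero_orthogonal[OF zero[OF seg]]) (use t in auto)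
  finally have "?s 1 = ?s 0" using s by simp
  moreover have "(v y - v x) \<bullet> (y - x) = ?s 1 - ?s 0"
    using eq[OF xy(1)] eq[OF xy(2)] by (simp add: inner_vec_def d_def sum_subtractf left_diff_distrib)
  ultimately show ?thesis by simp
qed

lemma orthogonal_increments_closure:
  fixes v :: "real^'n \<Rightarrow> real^'n"
  assumes v: "continuous_on (closure U) v"
    and U: "\<And>x y. x \<in> U \<Longrightarrow> y \<in> U \<Longrightarrow> (v y - v x) \<bullet> (y - x) = 0"
    and xy: "x \<in> closure U" "y \<in> closure U"
  shows "(v y - v x) \<bullet> (y - x) = 0"
proof -
  have 1: "(v y - v x) \<bullet> (y - x) = 0" if "x \<in> U" "y \<in> closure U" for x y
    by (rule continuous_constant_on_closure[where f="\<lambda>y. (v y - v x) \<bullet> (y - x)" and S=U])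
      (use that U v in \<open>auto intro!: continuous_intros\<close>)
  show ?thesis
    by (rule continuous_constant_on_closure[where f="\<lambda>x. (v y - v x) \<bullet> (y - x)" and S=U])
      (use xy 1 v in \<open>auto intro!: continuous_intros\<close>)
qed

text \<open>Along a segment \<open>x + t d\<close> the function \<open>s t = v (x + t d) \<bullet> d\<close> is continuous, and constant on the
  parameters that fall into one cell. It therefore takes finitely many values on a connected set, so
  it is constant.\<close>

lemma orthogonal_increments_across_cells:
  fixes v :: "real^'n \<Rightarrow> real^'n"
  assumes fin: "finite \<T>" and cover: "closed_segment x y \<subseteq> \<Union>\<T>" and v: "continuous_on (\<Union>\<T>) v"
    and cell: "\<And>E x y. E \<in> \<T> \<Longrightarrow> x \<in> E \<Longrightarrow> y \<in> E \<Longrightarrow> (v y - v x) \<bullet> (y - x) = 0"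
  shows "(v y - v x) \<bullet> (y - x) = 0"
proof -
  define d where "d = y - x"
  define s where "s t = v (x + t *\<^sub>R d) \<bullet> d" for t :: real
  have seg: "x + t *\<^sub>R d \<in> closed_segment x y" if "t \<in> {0..1}" for t
    using that by (auto simp: closed_segment_def d_def algebra_simps intro!: exI[of _ t])
  have cont: "continuous_on {0..1} s"
    unfolding s_def using seg cover
    by (intro continuous_intros continuous_on_compose2[OF v]) auto
  \<comment> \<open>The value of \<open>s\<close> on the cell \<open>E\<close>; arbitrary if the segment misses \<open>E\<close>.\<close>
  define c where "c E = (SOME r. r \<in> s ` {t. x + t *\<^sub>R d \<in> E})" for E
  have same: "s t = s t'" if "E \<in> \<T>" "x + t *\<^sub>R d \<in> E" "x + t' *\<^sub>R d \<in> E" for t t' E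
  proof (cases "t = t'")
    case False
    have "(v (x + t *\<^sub>R d) - v (x + t' *\<^sub>R d)) \<bullet> ((t - t') *\<^sub>R d) = 0"
      using cell[OF that(1,3,2)] by (simp add: algebra_simps)
    then show ?thesis using False by (simp add: s_def inner_diff_left)
  qed simp
  have "s ` {0..1} \<subseteq> c ` \<T>"
  proof
    fix r assume "r \<in> s ` {0..1}"
    then obtain t where t: "t \<in> {0..1}" "r = s t" by blast
    then obtain E where E: "E \<in> \<T>" "x + t *\<^sub>R d \<in> E" using seg cover by blast
    have "c E \<in> s ` {t. x + t *\<^sub>R d \<in> E}"
      unfolding c_def by (rule someI[of _ "s t"]) (use E in blast)
    then obtain t' where "c E = s t'" "x + t' *\<^sub>R d \<in> E" by blast
    then have "r = c E" using same[OF E] t by simp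
    then show "r \<in> c ` \<T>" using E by blast
  qed
  then have "finite (s ` {0..1})" using fin finite_surj by blast
  moreover have "connected (s ` {0..1})"
    by (rule connected_continuous_image[OF cont]) (simp add: convex_connected)
  ultimately obtain r where "s ` {0..1} = {r}"
    using connected_finite_iff_sing[of "s ` {0..1}"] by fastforce
  then have "s 0 = s 1" by (metis atLeastAtMost_iff image_eqI order_refl singletonD zero_le_one)
  then show ?thesis by (simp add: s_def d_def inner_diff_left)
qed

section \<open>Infinitesimal rigid motions\<close>

lemma affine_zero_on_ball:
  fixes A :: "real^'n^'n"
  assumes r: "r > 0" and zero: "\<And>y. y \<in> ball x r \<Longrightarrow> A *v y + b = 0"
  shows "A = 0" "b = 0"
proof -
  have x: "A *v x + b = 0" using zero[of x] r by simp
  have "A *v z = 0" for z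
  proof -
    define t where "t = r / (2 * (norm z + 1))"
    have nz: "norm z + 1 > 0" by (simp add: add_nonneg_pos)
    then have t: "t > 0" using r by (simp add: t_def)
    have "norm (t *\<^sub>R z) \<le> t * (norm z + 1)" using t by simp
    also have "\<dots> = r / 2" using nz unfolding t_def by (simp add: divide_simps)
    finally have "norm (t *\<^sub>R z) < r" using r by linarith
    then have "A *v (x + t *\<^sub>R z) + b = 0" by (intro zero) (simp add: dist_norm)
    moreover have "A *v (x + t *\<^sub>R z) = A *v x + t *\<^sub>R (A *v z)"
      by (simp add: matrix_vector_right_distrib matrix_vector_mult_scaleR)
    ultimately have "(A *v x + b) + t *\<^sub>R (A *v z) = 0" by (simp add: algebra_simps)
    then have "t *\<^sub>R (A *v z) = 0" using x by simp
    then show ?thesis using t by simp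
  qed
  then show "A = 0" by (metis matrix_eq matrix_vector_mult_0)
  then show "b = 0" using x by simp
qed

text \<open>Polarizing the orthogonality gives \<open>w z \<bullet> z' = - (w z' \<bullet> z)\<close> for \<open>w z = v (x0 + z) - v x0\<close>. Fixing \<open>z'\<close>
  on the coordinate axes shows that each component of \<open>w\<close> is linear.\<close>

lemma affine_if_orthogonal_increments:
  fixes v :: "real^'n \<Rightarrow> real^'n"
  assumes r: "r > 0"
    and orth: "\<And>x y. x \<in> ball x0 r \<Longrightarrow> y \<in> ball x0 r \<Longrightarrow> (v y - v x) \<bullet> (y - x) = 0"
  shows "\<exists>A b. (\<forall>z. z \<bullet> (A *v z) = 0) \<and> (\<forall>x\<in>ball x0 r. v x = A *v x + b)"
proof -
  define w where "w z = v (x0 + z) - v x0" for z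
  define \<delta> where "\<delta> = r / 2"
  have \<delta>: "\<delta> > 0" "\<delta> < r" using r by (auto simp: \<delta>_def)
  have inball: "x0 + z \<in> ball x0 r" if "norm z < r" for z using that by (simp add: dist_norm)
  have self: "w z \<bullet> z = 0" if "norm z < r" for z
    using orth[of x0 "x0 + z"] inball[OF that] r by (simp add: w_def)
  have swap: "w z \<bullet> z' = - (w z' \<bullet> z)" if "norm z < r" "norm z' < r" for z z'
  proof -
    have "(w z - w z') \<bullet> (z - z') = 0"
      using orth[of "x0 + z'" "x0 + z"] inball that by (simp add: w_def)
    then show ?thesis using self that by (simp add: inner_diff_left inner_diff_right)
  qed
  define A :: "real^'n^'n" where "A = (\<chi> i j. - (w (\<delta> *\<^sub>R axis i 1) $ j) / \<delta>)"
  have wA: "w z = A *v z" if z: "norm z < r" for z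
  proof (rule vec_eq_iff[THEN iffD2], rule allI)
    fix i
    have "norm (\<delta> *\<^sub>R axis i (1::real) :: real^'n) < r" using \<delta> by (simp add: norm_axis_1)
    from swap[OF z this] have "\<delta> * w z $ i = - (w (\<delta> *\<^sub>R axis i 1) \<bullet> z)"
      by (simp add: inner_axis)
    then have "w z $ i = - (w (\<delta> *\<^sub>R axis i 1) \<bullet> z) / \<delta>" using \<delta> by (simp add: field_simps)
    also have "\<dots> = (A *v z) $ i"
      by (simp add: A_def matrix_vector_mult_def inner_vec_def sum_divide_distrib sum_negf)
    finally show "w z $ i = (A *v z) $ i" .
  qed
  have "z \<bullet> (A *v z) = 0" for z
  proof -
    define t where "t = r / (2 * (norm z + 1))"
    have nz: "norm z + 1 > 0" by (simp add: add_nonneg_pos)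
    then have t: "t > 0" using r by (simp add: t_def)
    have "norm (t *\<^sub>R z) \<le> t * (norm z + 1)" using t by simp
    also have "\<dots> = r / 2" using nz unfolding t_def by (simp add: divide_simps)
    finally have n: "norm (t *\<^sub>R z) < r" using r by linarith
    have "(A *v (t *\<^sub>R z)) \<bullet> (t *\<^sub>R z) = 0" using self[OF n] wA[OF n] by simp
    then show ?thesis using t by (simp add: matrix_vector_mult_scaleR inner_commute)
  qed
  moreover have "v x = A *v x + (v x0 - A *v x0)" if "x \<in> ball x0 r" for x
  proof -
    have "norm (x - x0) < r" using that by (simp add: dist_norm norm_minus_commute)
    from wA[OF this] show ?thesis by (simp add: w_def matrix_vector_mult_diff_distrib algebra_simps)
  qed
  ultimately show ?thesis by blast
qed

text \<open>Two affine maps that agree on a ball are equal, so the local rigid motions propagate along the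
  connected set.\<close>

lemma rigid_motion_on_connected:
  fixes v :: "real^'n \<Rightarrow> real^'n"
  assumes \<Omega>: "open \<Omega>" "connected \<Omega>" "\<Omega> \<noteq> {}"
    and orth: "\<And>x y. closed_segment x y \<subseteq> \<Omega> \<Longrightarrow> (v y - v x) \<bullet> (y - x) = 0"
  obtains A b where "\<And>z. z \<bullet> (A *v z) = 0" "\<And>x. x \<in> \<Omega> \<Longrightarrow> v x = A *v x + b"
proof -
  have loc: "\<exists>A b. (\<forall>z. z \<bullet> (A *v z) = 0) \<and> (\<forall>x\<in>ball x0 r. v x = A *v x + b)"
    if "r > 0" "ball x0 r \<subseteq> \<Omega>" for x0 r
  proof (rule affine_if_orthogonal_increments[OF that(1)])
    fix x y assume "x \<in> ball x0 r" "y \<in> ball x0 r"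
    then have "closed_segment x y \<subseteq> ball x0 r" by (intro closed_segment_subset) auto
    then show "(v y - v x) \<bullet> (y - x) = 0" using that(2) by (intro orth) blast
  qed
  obtain x0 where x0: "x0 \<in> \<Omega>" using \<Omega> by blast
  obtain r0 where r0: "r0 > 0" "ball x0 r0 \<subseteq> \<Omega>" using \<Omega>(1) x0 openE by blast
  obtain A b where A: "\<forall>z. z \<bullet> (A *v z) = 0" and b: "\<forall>x\<in>ball x0 r0. v x = A *v x + b"
    using loc[OF r0] by blast
  let ?P = "\<lambda>x. \<exists>e>0. \<forall>y\<in>ball x e. v y = A *v y + b"
  have "v x = A *v x + b" if x: "x \<in> \<Omega>" for x
  proof -
    have "?P x"
    proof (rule connected_induction_simple[OF \<Omega>(2) x0 x, of ?P])
      show "?P x0" using r0 b by blast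
      fix a assume "a \<in> \<Omega>"
      then obtain r where r: "r > 0" "ball a r \<subseteq> \<Omega>" using \<Omega>(1) openE by blast
      obtain A' b' where b': "\<forall>x\<in>ball a r. v x = A' *v x + b'" using loc[OF r] by blast
      have propagate: "?P y" if xy: "x \<in> ball a r" "y \<in> ball a r" and P: "?P x" for x y
      proof -
        obtain e where e: "e > 0" "\<forall>z\<in>ball x e. v z = A *v z + b" using P by blast
        obtain e' where e': "e' > 0" "ball x e' \<subseteq> ball a r" using xy(1) openE[OF open_ball] by blast
        have "(A' - A) *v z + (b' - b) = 0" if "z \<in> ball x (min e e')" for z
        proof -
          have "z \<in> ball x e" "z \<in> ball a r" using that e' by auto
          then have "A' *v z + b' = A *v z + b" using bspec[OF e(2), of z] bspec[OF b', of z] by simp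
          then show ?thesis by (simp add: matrix_vector_mult_diff_rdistrib algebra_simps)
        qed
        note z = this
        have "min e e' > 0" using e e' by simp
        from affine_zero_on_ball[OF this z] have "A' = A" "b' = b" by simp_all
        moreover obtain s where "s > 0" "ball y s \<subseteq> ball a r" using xy(2) openE[OF open_ball] by blast
        ultimately show ?thesis using b' by blast
      qed
      have op: "openin (top_of_set \<Omega>) (ball a r)"
        using r(2) by (simp add: open_subset)
      show "\<exists>T. openin (top_of_set \<Omega>) T \<and> a \<in> T \<and> (\<forall>x\<in>T. \<forall>y\<in>T. ?P x \<longrightarrow> ?P y)"
      proof (rule exI[of _ "ball a r"], rule conjI[OF op], rule conjI)
        show "a \<in> ball a r" using r(1) by simp
        show "\<forall>x\<in>ball a r. \<forall>y\<in>ball a r. ?P x \<longrightarrow> ?P y" using propagate by blast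
      qed
    qed
    then show ?thesis by (metis centre_in_ball)
  qed
  then show ?thesis using A that by blast
qed

lemma skew_entries:
  fixes A :: "real^'n^'n"
  assumes "\<And>z. z \<bullet> (A *v z) = 0"
  shows "A $ i $ i = 0" "A $ i $ j = - A $ j $ i"
proof -
  have e: "axis i 1 \<bullet> (A *v axis j 1) = A $ i $ j" for i j
    by (simp add: matrix_vector_mult_basis column_def inner_axis')
  show 1: "A $ i $ i = 0" for i using assms[of "axis i 1"] e by simp
  have "(axis i 1 + axis j 1) \<bullet> (A *v (axis i 1 + axis j 1)) = 0" by (rule assms)
  then show "A $ i $ j = - A $ j $ i"
    by (simp add: matrix_vector_right_distrib inner_add_left inner_add_right e 1)
qed

section \<open>Hausdorff measure of the zero set of a rigid motion\<close>

text \<open>\<open>\<Gamma>\<close> is a Lipschitz graph over the coordinates other than \<open>i\<close> and \<open>j\<close>. Cutting these \<open>d - 2\<close> coordinates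
  into \<open>m\<close> parts each gives \<open>m ^ (d - 2)\<close> pieces of diameter at most \<open>C / m\<close>; the sum of their diameters to
  the power \<open>d - 1\<close> is of order \<open>1 / m\<close>.\<close>

lemma hausdorff_measure_graph_zero:
  fixes \<Gamma> :: "(real^'n) set"
  assumes ij: "i \<noteq> j" and bdd: "bounded \<Gamma>" and L: "L \<ge> 0"
    and lip: "\<And>x y l. x \<in> \<Gamma> \<Longrightarrow> y \<in> \<Gamma> \<Longrightarrow> l \<in> {i, j} \<Longrightarrow>
      \<bar>x $ l - y $ l\<bar> \<le> L * (\<Sum>k\<in>- {i, j}. \<bar>x $ k - y $ k\<bar>)"
  shows "hausdorff_measure (CARD('n) - 1) \<Gamma> = 0"
proof -
  define s where "s = CARD('n) - 1"
  have "card {i, j} \<le> CARD('n)" by (rule card_mono) auto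
  then have n2: "2 \<le> CARD('n)" using ij by simp
  then have s1: "s \<ge> 1" by (simp add: s_def)
  have cardS: "card (- {i, j}) = s - 1" using ij by (simp add: s_def Compl_eq_Diff_UNIV card_Diff_subset)
  obtain R0 where R0: "\<And>x. x \<in> \<Gamma> \<Longrightarrow> norm x \<le> R0" using bdd by (auto simp: bounded_iff)
  define R where "R = max R0 0 + 1"
  have R: "R > 0" "\<And>x k. x \<in> \<Gamma> \<Longrightarrow> \<bar>x $ k\<bar> < R"
  proof -
    show "R > 0" by (simp add: R_def)
    show "\<bar>x $ k\<bar> < R" if "x \<in> \<Gamma>" for x k
      using R0[OF that] component_le_norm_cart[of x k] by (simp add: R_def)
  qed
  define C where "C = 2 * R * real CARD('n) * (1 + L * real CARD('n))"
  have C: "C \<ge> 0" using R(1) L by (simp add: C_def)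
  define cell where
    "cell m f = {x\<in>\<Gamma>. \<forall>k\<in>- {i, j}. nat \<lfloor>real m * (x $ k + R) / (2 * R)\<rfloor> = f k}" for m and f :: "'n \<Rightarrow> nat"
  have cell_dist: "dist x y \<le> C / real m" if m: "m > 0" and xy: "x \<in> cell m f" "y \<in> cell m f" for m f x y
  proof -
    have \<Gamma>: "x \<in> \<Gamma>" "y \<in> \<Gamma>" using xy by (auto simp: cell_def)
    have free: "\<bar>x $ k - y $ k\<bar> \<le> 2 * R / real m" if k: "k \<in> - {i, j}" for k
    proof -
      define X where "X = real m * (x $ k + R) / (2 * R)"
      define Y where "Y = real m * (y $ k + R) / (2 * R)"
      have "X \<ge> 0" "Y \<ge> 0" using R(2)[OF \<Gamma>(1), of k] R(2)[OF \<Gamma>(2), of k] R(1) by (auto simp: X_def Y_def)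
      moreover have "nat \<lfloor>X\<rfloor> = nat \<lfloor>Y\<rfloor>" using xy k by (simp add: cell_def X_def Y_def)
      ultimately have "\<lfloor>X\<rfloor> = \<lfloor>Y\<rfloor>" by (metis eq_nat_nat_iff zero_le_floor)
      then have "\<bar>X - Y\<bar> \<le> 1" by linarith
      moreover have "X - Y = real m * (x $ k - y $ k) / (2 * R)"
        unfolding X_def Y_def diff_divide_distrib[symmetric] by (simp add: algebra_simps)
      ultimately have "real m * \<bar>x $ k - y $ k\<bar> / (2 * R) \<le> 1"
        using R(1) by (simp add: abs_mult)
      then show ?thesis using R(1) m by (simp add: field_simps)
    qed
    have "(\<Sum>k\<in>- {i, j}. \<bar>x $ k - y $ k\<bar>) \<le> (\<Sum>k\<in>- {i, j}. 2 * R / real m)" by (rule sum_mono) (rule free)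
    also have "\<dots> \<le> real CARD('n) * (2 * R / real m)"
      using R(1) by (simp add: mult_right_mono divide_right_mono card_mono)
    finally have sum: "(\<Sum>k\<in>- {i, j}. \<bar>x $ k - y $ k\<bar>) \<le> real CARD('n) * (2 * R / real m)" .
    have all: "\<bar>x $ k - y $ k\<bar> \<le> 2 * R / real m + L * (real CARD('n) * (2 * R / real m))" for k
    proof (cases "k \<in> {i, j}")
      case True
      then have "\<bar>x $ k - y $ k\<bar> \<le> L * (\<Sum>k\<in>- {i, j}. \<bar>x $ k - y $ k\<bar>)" using lip \<Gamma> by blast
      also have "\<dots> \<le> L * (real CARD('n) * (2 * R / real m))" using sum L by (rule mult_left_mono)
      finally show ?thesis using R(1) by (smt (verit) divide_nonneg_nonneg of_nat_0_le_iff)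
    next
      case False
      have "0 \<le> L * (real CARD('n) * (2 * R / real m))" using L R(1) by simp
      then show ?thesis using free[of k] False by simp
    qed
    have "dist x y \<le> (\<Sum>k\<in>UNIV. \<bar>(x - y) $ k\<bar>)" unfolding dist_norm by (rule norm_le_l1_cart)
    also have "\<dots> \<le> (\<Sum>k\<in>(UNIV::'n set). 2 * R / real m + L * (real CARD('n) * (2 * R / real m)))"
      by (rule sum_mono) (use all in simp)
    also have "\<dots> = C / real m" by (simp add: C_def algebra_simps add_divide_distrib)
    finally show ?thesis .
  qed
  have "(INF U\<in>{U :: nat \<Rightarrow> (real^'n) set. \<Gamma> \<subseteq> (\<Union>j. U j) \<and> (\<forall>j. bounded (U j) \<and> diameter (U j) \<le> \<delta>)}.
      \<Sum>j. ennreal (diameter (U j) ^ s)) \<le> 0" if \<delta>: "\<delta> > 0" for \<delta>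
  proof (rule ennreal_le_epsilon)
    fix e :: real assume e: "e > 0"
    obtain m :: nat where m: "real m > max 1 (max (C / \<delta>) (C ^ s / e))" using reals_Archimedean2 by blast
    then have m0: "m > 0" "real m > 0" by auto
    have m1: "C / real m \<le> \<delta>" using m m0 \<delta> by (simp add: field_simps)
    have m2: "C ^ s / real m \<le> e" using m m0 e by (simp add: field_simps)
    define I where "I = (- {i, j}) \<rightarrow>\<^sub>E {..<m}"
    have finI: "finite I" and cardI: "card I = m ^ (s - 1)"
      by (simp_all add: I_def finite_PiE card_PiE cardS)
    then obtain g where g: "bij_betw g {..<m ^ (s - 1)} I"
      using ex_bij_betw_nat_finite[OF finI] by (metis atLeast0LessThan)
    \<comment> \<open>Padding with empty sets is free: their diameter is zero and the exponent \<open>s\<close> is positive.\<close>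
    define U where "U l = (if l < m ^ (s - 1) then cell m (g l) else {})" for l
    have cover: "\<Gamma> \<subseteq> (\<Union>l. U l)"
    proof
      fix x assume x: "x \<in> \<Gamma>"
      define f where "f = (\<lambda>k\<in>- {i, j}. nat \<lfloor>real m * (x $ k + R) / (2 * R)\<rfloor>)"
      have "nat \<lfloor>real m * (x $ k + R) / (2 * R)\<rfloor> < m" for k
      proof -
        have "x $ k + R < 2 * R" using R(2)[OF x, of k] by simp
        then have "real m * (x $ k + R) / (2 * R) < real m" using m0 R(1) by (simp add: field_simps)
        then show ?thesis using m0 by linarith
      qed
      then have "f \<in> I" by (auto simp: f_def I_def)
      then obtain l where l: "l < m ^ (s - 1)" "g l = f" using g by (auto simp: bij_betw_def)
      have "x \<in> U l" using l x by (simp add: U_def cell_def f_def)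
      then show "x \<in> (\<Union>l. U l)" by blast
    qed
    have Ubdd: "bounded (U l)" for l
      using bdd by (rule bounded_subset) (auto simp: U_def cell_def)
    have diam: "diameter (U l) \<le> C / real m" for l
    proof (rule diameter_le)
      show "U l \<noteq> {} \<or> 0 \<le> C / real m" using C by simp
      show "norm (x - y) \<le> C / real m" if "x \<in> U l" "y \<in> U l" for x y
        using cell_dist[OF m0(1)] that by (auto simp: U_def dist_norm split: if_splits)
    qed
    have "(\<Sum>l. ennreal (diameter (U l) ^ s)) = (\<Sum>l<m ^ (s - 1). ennreal (diameter (U l) ^ s))"
      using s1 by (intro suminf_finite) (auto simp: U_def)
    also have "\<dots> \<le> (\<Sum>l<m ^ (s - 1). ennreal ((C / real m) ^ s))"
      by (intro sum_mono ennreal_leI power_mono diam diameter_ge_0 Ubdd)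
    also have "\<dots> = ennreal (real (m ^ (s - 1)) * (C / real m) ^ s)"
      using C by (simp add: ennreal_mult ennreal_of_nat_eq_real_of_nat)
    also have "real (m ^ (s - 1)) * (C / real m) ^ s = C ^ s / real m"
      using s1 m0 by (cases s) (simp_all add: power_divide field_simps)
    also have "ennreal (C ^ s / real m) \<le> 0 + ennreal e" using m2 by (simp add: ennreal_leI)
    finally have "(\<Sum>l. ennreal (diameter (U l) ^ s)) \<le> 0 + ennreal e" .
    moreover have "diameter (U l) \<le> \<delta>" for l using diam[of l] m1 by simp
    ultimately show "(INF U\<in>{U :: nat \<Rightarrow> (real^'n) set. \<Gamma> \<subseteq> (\<Union>j. U j) \<and> (\<forall>j. bounded (U j) \<and> diameter (U j) \<le> \<delta>)}.
        \<Sum>j. ennreal (diameter (U j) ^ s)) \<le> 0 + ennreal e"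
      using cover Ubdd by (intro INF_lower2[of U]) auto
  qed
  then have "hausdorff_measure s \<Gamma> \<le> 0"
    unfolding hausdorff_measure_def by (intro SUP_least) simp
  then show ?thesis by (simp add: s_def)
qed

text \<open>If \<open>A $ i $ j \<noteq> 0\<close> then, the diagonal of a skew matrix being zero, row \<open>i\<close> expresses coordinate \<open>j\<close> of a
  solution of \<open>A x + b = 0\<close> through the coordinates other than \<open>i\<close> and \<open>j\<close>, and row \<open>j\<close> does the same for
  coordinate \<open>i\<close>. Hence the zero set has codimension at least two.\<close>

lemma hausdorff_measure_rigid_zero_set:
  fixes \<Gamma> :: "(real^'n) set"
  assumes skew: "\<And>z. z \<bullet> (A *v z) = 0" and A: "A \<noteq> 0" and bdd: "bounded \<Gamma>"
    and zero: "\<And>x. x \<in> \<Gamma> \<Longrightarrow> A *v x + b = 0"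
  shows "hausdorff_measure (CARD('n) - 1) \<Gamma> = 0"
proof -
  obtain i j where Aij: "A $ i $ j \<noteq> 0" using A by (auto simp: vec_eq_iff)
  then have ij: "i \<noteq> j" using skew_entries(1)[OF skew, of i] by auto
  have Aji: "A $ j $ i \<noteq> 0" using skew_entries(2)[OF skew, of i j] Aij by simp
  define S where "S = (\<Sum>k\<in>UNIV. \<bar>A $ i $ k\<bar>) + (\<Sum>k\<in>UNIV. \<bar>A $ j $ k\<bar>)"
  define L where "L = S / \<bar>A $ i $ j\<bar>"
  have S: "\<bar>A $ i $ k\<bar> \<le> S" "\<bar>A $ j $ k\<bar> \<le> S" for k
    unfolding S_def by (intro add_increasing2 add_increasing member_le_sum sum_nonneg; simp)+
  have S0: "S \<ge> 0" by (simp add: S_def sum_nonneg)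
  have row: "\<bar>A $ a $ l\<bar> * \<bar>x $ l - y $ l\<bar> \<le> S * (\<Sum>k\<in>- {i, j}. \<bar>x $ k - y $ k\<bar>)"
    if al: "{a, l} = {i, j}" and x: "x \<in> \<Gamma>" and y: "y \<in> \<Gamma>" for a l x y
  proof -
    have "A *v (x - y) = 0"
      using zero[OF x] zero[OF y] by (simp add: matrix_vector_mult_diff_distrib eq_neg_iff_add_eq_0)
        (metis add_right_cancel)
    then have "(\<Sum>k\<in>UNIV. A $ a $ k * (x $ k - y $ k)) = 0"
      by (simp add: matrix_vector_mult_def vec_eq_iff)
    also have "(\<Sum>k\<in>UNIV. A $ a $ k * (x $ k - y $ k)) =
        (\<Sum>k\<in>{a, l}. A $ a $ k * (x $ k - y $ k)) + (\<Sum>k\<in>- {a, l}. A $ a $ k * (x $ k - y $ k))"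
      by (metis (no_types, lifting) Compl_disjoint Compl_partition finite sum.union_disjoint)
    also have "(\<Sum>k\<in>{a, l}. A $ a $ k * (x $ k - y $ k)) = A $ a $ l * (x $ l - y $ l)"
      using al ij skew_entries(1)[OF skew, of a] by (cases "a = l") (auto simp: doubleton_eq_iff)
    finally have "A $ a $ l * (x $ l - y $ l) = - (\<Sum>k\<in>- {i, j}. A $ a $ k * (x $ k - y $ k))"
      using al by simp
    then have "\<bar>A $ a $ l\<bar> * \<bar>x $ l - y $ l\<bar> = \<bar>\<Sum>k\<in>- {i, j}. A $ a $ k * (x $ k - y $ k)\<bar>"
      by (metis abs_minus_cancel abs_mult)
    also have "\<dots> \<le> (\<Sum>k\<in>- {i, j}. \<bar>A $ a $ k * (x $ k - y $ k)\<bar>)" by (rule sum_abs)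
    also have "\<dots> \<le> (\<Sum>k\<in>- {i, j}. S * \<bar>x $ k - y $ k\<bar>)"
    proof (rule sum_mono)
      fix k
      have "\<bar>A $ a $ k\<bar> \<le> S" using S[of k] al by (auto simp: doubleton_eq_iff)
      then show "\<bar>A $ a $ k * (x $ k - y $ k)\<bar> \<le> S * \<bar>x $ k - y $ k\<bar>"
        unfolding abs_mult by (rule mult_right_mono) simp
    qed
    finally show ?thesis by (simp add: sum_distrib_left)
  qed
  show ?thesis
  proof (rule hausdorff_measure_graph_zero[OF ij bdd])
    show "L \<ge> 0" using S0 by (simp add: L_def)
    fix x y l assume xy: "x \<in> \<Gamma>" "y \<in> \<Gamma>" and l: "l \<in> {i, j}"
    have "\<bar>A $ j $ i\<bar> = \<bar>A $ i $ j\<bar>" using skew_entries(2)[OF skew, of i j] by simp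
    then have "\<bar>A $ i $ j\<bar> * \<bar>x $ l - y $ l\<bar> \<le> S * (\<Sum>k\<in>- {i, j}. \<bar>x $ k - y $ k\<bar>)"
      using row[of i j x y] row[of j i x y] l xy by (auto simp: insert_commute)
    then show "\<bar>x $ l - y $ l\<bar> \<le> L * (\<Sum>k\<in>- {i, j}. \<bar>x $ k - y $ k\<bar>)"
      using Aij by (simp add: L_def field_simps)
  qed
qed

section \<open>Korn's inequality on the discrete space\<close>

text \<open>A finite-dimensional space of functions is determined by its values at finitely many points. In the
  induction, a combination \<open>c0\<close> that vanishes on the points found so far, but not at \<open>x0\<close>, is the only one
  up to multiples and combinations vanishing on \<open>X\<close>, and adding \<open>x0\<close> excludes it.\<close>

lemma ex_finite_determining_set:
  fixes \<phi> :: "'m \<Rightarrow> 'x \<Rightarrow> real"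
  assumes "finite M"
  shows "\<exists>F. finite F \<and> F \<subseteq> X \<and> (\<forall>c. (\<forall>x\<in>F. (\<Sum>m\<in>M. c m * \<phi> m x) = 0) \<longrightarrow>
    (\<forall>x\<in>X. (\<Sum>m\<in>M. c m * \<phi> m x) = 0))"
  using assms
proof (induction M rule: finite_induct)
  case empty
  then show ?case by (intro exI[of _ "{}"]) simp
next
  case (insert m0 M)
  let ?f = "\<lambda>c x. \<Sum>m\<in>insert m0 M. c m * \<phi> m x"
  have f: "?f c x = c m0 * \<phi> m0 x + (\<Sum>m\<in>M. c m * \<phi> m x)" for c x
    using insert.hyps by simp
  obtain F where F: "finite F" "F \<subseteq> X"
    and det: "\<And>c. (\<forall>x\<in>F. (\<Sum>m\<in>M. c m * \<phi> m x) = 0) \<Longrightarrow> (\<forall>x\<in>X. (\<Sum>m\<in>M. c m * \<phi> m x) = 0)"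
    using insert.IH by blast
  show ?case
  proof (cases "\<forall>c. (\<forall>x\<in>F. ?f c x = 0) \<longrightarrow> (\<forall>x\<in>X. ?f c x = 0)")
    case True
    then show ?thesis using F by blast
  next
    case False
    then obtain c0 x0 where c0: "\<And>x. x \<in> F \<Longrightarrow> ?f c0 x = 0" and x0: "x0 \<in> X" "?f c0 x0 \<noteq> 0" by blast
    have c0m: "c0 m0 \<noteq> 0"
    proof
      assume "c0 m0 = 0"
      then have "\<forall>x\<in>F. (\<Sum>m\<in>M. c0 m * \<phi> m x) = 0" using c0 unfolding f by simp
      from det[OF this] show False using x0 \<open>c0 m0 = 0\<close> unfolding f by simp
    qed
    have "\<forall>x\<in>X. ?f c x = 0" if c: "\<forall>x\<in>insert x0 F. ?f c x = 0" for c
    proof -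
      define t where "t = c m0 / c0 m0"
      define c' where "c' m = c m - t * c0 m" for m
      have c'f: "(\<Sum>m\<in>M. c' m * \<phi> m x) = ?f c x - t * ?f c0 x" for x
      proof -
        have "?f c x - t * ?f c0 x = (c m0 - t * c0 m0) * \<phi> m0 x + (\<Sum>m\<in>M. c' m * \<phi> m x)"
          unfolding f c'_def by (simp add: algebra_simps sum_subtractf sum_distrib_left)
        then show ?thesis using c0m by (simp add: t_def)
      qed
      have "\<forall>x\<in>F. (\<Sum>m\<in>M. c' m * \<phi> m x) = 0" unfolding c'f using c c0 by simp
      from det[OF this] have z: "?f c x = t * ?f c0 x" if "x \<in> X" for x
        using that unfolding c'f by simp
      have "t = 0" using z[OF x0(1)] c x0(2) by simp
      then show ?thesis using z by simp
    qed
    then show ?thesis using F x0(1) by (intro exI[of _ "insert x0 F"]) blast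
  qed
qed

lemma finite_multi_indices: "finite {m :: 'n::finite \<Rightarrow> nat. (\<Sum>i\<in>UNIV. m i) \<le> k}"
proof (rule finite_subset)
  show "{m :: 'n \<Rightarrow> nat. (\<Sum>i\<in>UNIV. m i) \<le> k} \<subseteq> UNIV \<rightarrow>\<^sub>E {..k}"
  proof (rule subsetI)
    fix m :: "'n \<Rightarrow> nat" assume "m \<in> {m. (\<Sum>i\<in>UNIV. m i) \<le> k}"
    moreover have "m i \<le> (\<Sum>i\<in>UNIV. m i)" for i by (rule member_le_sum) auto
    ultimately have "m i \<le> k" for i using le_trans by blast
    then show "m \<in> UNIV \<rightarrow>\<^sub>E {..k}" by (auto simp: PiE_def)
  qed
  show "finite ((UNIV :: 'n set) \<rightarrow>\<^sub>E {..k})" by (simp add: finite_PiE)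
qed

lemma ex_finite_determining_points:
  fixes E :: "(real^'n) set"
  obtains F where "finite F" "F \<subseteq> E"
    "\<And>f. poly_on k E f \<Longrightarrow> (\<forall>x\<in>F. f x = 0) \<Longrightarrow> (\<forall>x\<in>E. f x = 0)"
proof -
  let ?M = "{m :: 'n \<Rightarrow> nat. (\<Sum>i\<in>UNIV. m i) \<le> k}"
  obtain F where F: "finite F" "F \<subseteq> E"
    and det: "\<forall>c. (\<forall>x\<in>F. (\<Sum>m\<in>?M. c m * (\<Prod>i\<in>UNIV. (x $ i) ^ m i)) = 0) \<longrightarrow>
      (\<forall>x\<in>E. (\<Sum>m\<in>?M. c m * (\<Prod>i\<in>UNIV. (x $ i) ^ m i)) = 0)"
    using ex_finite_determining_set[OF finite_multi_indices[of k], where X=E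
        and \<phi>="\<lambda>m x. \<Prod>i\<in>UNIV. (x $ i) ^ m i"] by (elim exE conjE) (rule that)
  have "\<forall>x\<in>E. f x = 0" if f: "poly_on k E f" "\<forall>x\<in>F. f x = 0" for f
  proof -
    obtain c where c: "\<forall>x\<in>E. f x = (\<Sum>m\<in>?M. c m * (\<Prod>i\<in>UNIV. (x $ i) ^ m i))"
      using f(1) unfolding poly_on_def by blast
    then have "\<forall>x\<in>F. (\<Sum>m\<in>?M. c m * (\<Prod>i\<in>UNIV. (x $ i) ^ m i)) = 0" using f(2) F(2) by (metis subsetD)
    from det[rule_format, OF this[rule_format]] show ?thesis using c by simp
  qed
  then show ?thesis using that[OF F] by blast
qed

lemma poly_on_C1:
  assumes "poly_on k E f"
  obtains p where "C1 p" "\<And>x. x \<in> E \<Longrightarrow> f x = p x"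
proof -
  obtain c where c: "\<forall>x\<in>E. f x = (\<Sum>m | (\<Sum>i\<in>UNIV. m i) \<le> k. c m * (\<Prod>i\<in>UNIV. (x $ i) ^ m i))"
    using assms unfolding poly_on_def by blast
  have "C1 (\<lambda>x. \<Sum>m | (\<Sum>i\<in>UNIV. m i) \<le> k. c m * (\<Prod>i\<in>UNIV. (x $ i) ^ m i))"
    by (intro C1_sum C1_mult C1_const C1_prod C1_power C1_coordinate)
  then show ?thesis using that c by blast
qed

text \<open>The absence of slits guarantees that the interiors of the mesh cells lie in the domain.\<close>

lemma interior_closure_polyhedral_domain:
  assumes "polyhedral_domain \<Omega>"
  shows "interior (closure \<Omega>) \<subseteq> \<Omega>"
proof -
  obtain \<P> where P: "finite \<P>" "\<forall>P\<in>\<P>. polytope P" "\<Omega> = interior (\<Union>\<P>)"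
    using assms by (auto simp: polyhedral_domain_def)
  have "closed (\<Union>\<P>)" using P by (intro closed_Union) (auto intro: polytope_imp_closed)
  then have "closure \<Omega> \<subseteq> \<Union>\<P>" using P(3) closure_minimal interior_subset by metis
  then show ?thesis using P(3) interior_mono by blast
qed

lemma biot_mesh:
  fixes D :: "('n::finite) biot_problem"
  assumes D: "biot_setting D"
  shows mesh_finite: "finite (mesh D)" and mesh_Union: "\<Union>(mesh D) = closure (Omega D)"
    and mesh_cell: "E \<in> mesh D \<Longrightarrow> convex E \<and> closure (interior E) = E \<and> interior E \<subseteq> Omega D"
proof -
  have m: "simplicial_mesh (Omega D) (mesh D)" using D by (simp add: biot_setting_def)
  then show "finite (mesh D)" and U: "\<Union>(mesh D) = closure (Omega D)"
    by (auto simp: simplicial_mesh_def triangulation_def)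
  assume E: "E \<in> mesh D"
  then have sE: "int CARD('n) simplex E" using m by (simp add: simplicial_mesh_def)
  have "aff_dim E = DIM(real^'n)" using aff_dim_simplex[OF sE] by simp
  then have "affine hull E = UNIV" using aff_dim_eq_full by blast
  then have "closure (interior E) = closure (rel_interior E)" by (simp add: rel_interior_interior)
  also have "\<dots> = closure E" by (rule convex_closure_rel_interior[OF convex_simplex[OF sE]])
  also have "\<dots> = E" using closed_simplex[OF sE] by simp
  finally have "closure (interior E) = E" .
  moreover have "interior E \<subseteq> Omega D"
  proof -
    have "interior E \<subseteq> interior (closure (Omega D))" using E U by (intro interior_mono) blast
    also have "\<dots> \<subseteq> Omega D"
      using D by (intro interior_closure_polyhedral_domain) (simp add: biot_setting_def)
    finally show ?thesis .
  qed
  ultimately show "convex E \<and> closure (interior E) = E \<and> interior E \<subseteq> Omega D"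
    using convex_simplex[OF sE] by blast
qed

lemma orthogonal_increments_cell:
  fixes D :: "('n::finite) biot_problem"
  assumes D: "biot_setting D" and v: "v \<in> V_h D"
    and strain: "AE x in lebesgue_on (Omega D). strain (Omega D) v x = 0"
    and E: "E \<in> mesh D" and xy: "x \<in> E" "y \<in> E"
  shows "(v y - v x) \<bullet> (y - x) = 0"
proof -
  note \<Omega> = biot_Omega(1,2)[OF D]
  define U where "U = interior E"
  have U: "open U" "U \<subseteq> Omega D" "closure U = E" "convex U"
    using mesh_cell[OF D E] by (auto simp: U_def convex_interior)
  have UE: "U \<subseteq> E" unfolding U_def by (rule interior_subset)
  have "\<exists>p. C1 p \<and> (\<forall>x\<in>E. v x $ i = p x)" for i
  proof -
    have "poly_on (deg_k D) E (\<lambda>x. v x $ i)" using v E by (simp add: V_h_def)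
    then show ?thesis by (rule poly_on_C1) blast
  qed
  then have "\<exists>p. \<forall>i. C1 (p i) \<and> (\<forall>x\<in>E. v x $ i = p i x)" by (intro choice allI)
  then obtain p where p: "\<And>i. C1 (p i)" "\<And>i x. x \<in> E \<Longrightarrow> v x $ i = p i x" by blast
  let ?J = "\<lambda>z. \<chi> i. classical_grad (p i) z"
  have H1: "in_H1 (Omega D) (\<lambda>x. v x $ i)" for i using v by (simp add: V_h_def in_H1_vec_def)
  have "AE z in lebesgue_on U. \<forall>i\<in>UNIV. weak_grad (Omega D) (\<lambda>x. v x $ i) z = classical_grad (p i) z"
    using UE p(2) by (intro AE_finite_allI weak_grad_eq_classical[OF \<Omega> U(1,2) H1 p(1)]) auto
  moreover have "AE z in lebesgue_on U. strain (Omega D) v z = 0"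
  proof -
    have "AE z in lebesgue. z \<in> Omega D \<longrightarrow> strain (Omega D) v z = 0"
      using strain \<Omega>(1) by (subst (asm) AE_restrict_space_iff) auto
    then have "AE z in lebesgue. z \<in> U \<longrightarrow> strain (Omega D) v z = 0"
      by eventually_elim (use U(2) in blast)
    then show ?thesis using U(1) by (subst AE_restrict_space_iff) auto
  qed
  ultimately have "AE z in lebesgue_on U. sym_part (?J z) = 0"
    by eventually_elim (simp add: strain_eq_sym_part weak_jacobian_def)
  moreover have "continuous_on U (\<lambda>z. sym_part (?J z))"
    using linear_continuous_on[OF linear_conv_bounded_linear[THEN iffD1, OF linear_sym_part]]
    by (rule continuous_on_compose2[where t=UNIV])
      (auto intro!: continuous_on_vec_lambda C1_continuous_grad p(1))
  ultimately have zero: "sym_part (?J z) = 0" if "z \<in> U" for z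
    using AE_zero_continuous[OF U(1)] that by blast
  have "E \<subseteq> closure (Omega D)" using E mesh_Union[OF D] by blast
  then have cont: "continuous_on E v" using v by (auto simp: V_h_def intro: continuous_on_subset)
  show ?thesis
  proof (rule orthogonal_increments_closure[of U])
    show "(v y - v x) \<bullet> (y - x) = 0" if "x \<in> U" "y \<in> U" for x y
      by (rule orthogonal_increments_if_strain_zero[OF U(1,4) p(1) _ zero that]) (use UE p(2) in blast)
  qed (use cont xy U(3) in auto)
qed

text \<open>Definiteness of the strain on the clamped space. The field is a rigid motion \<open>A x + b\<close>; a nonzero \<open>A\<close>
  would confine \<open>Gamma_u\<close> to a set of vanishing surface measure, and for \<open>A = 0\<close> a single clamped point
  forces \<open>b = 0\<close>.\<close>

lemma strain_zero_imp_zero: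
  fixes D :: "('n::finite) biot_problem"
  assumes dim: "2 \<le> CARD('n)" and D: "biot_setting D" and v: "v \<in> V_h D"
    and strain: "AE x in lebesgue_on (Omega D). strain (Omega D) v x = 0"
    and x: "x \<in> closure (Omega D)"
  shows "v x = 0"
proof -
  have cont: "continuous_on (closure (Omega D)) v" and clamped: "\<And>x. x \<in> Gamma_u D \<Longrightarrow> v x = 0"
    using v unfolding V_h_def by blast+
  have orth: "(v y - v x) \<bullet> (y - x) = 0" if "closed_segment x y \<subseteq> Omega D" for x y
    by (rule orthogonal_increments_across_cells[OF mesh_finite[OF D]])
      (use that closure_subset[of "Omega D"] mesh_Union[OF D] cont
        orthogonal_increments_cell[OF D v strain] in auto)
  obtain A b where A: "\<And>z. z \<bullet> (A *v z) = 0" and Ab: "\<And>x. x \<in> Omega D \<Longrightarrow> v x = A *v x + b"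
    by (rule rigid_motion_on_connected[OF biot_Omega(1,3,4)[OF D] orth]) (assumption, rule that)
  have Abc: "v x = A *v x + b" if "x \<in> closure (Omega D)" for x
  proof -
    have "continuous_on (closure (Omega D)) (\<lambda>x. v x - (A *v x + b))"
      by (intro continuous_intros cont matrix_vector_mult_linear_continuous_on)
    then have "v x - (A *v x + b) = 0"
      by (rule continuous_constant_on_closure) (use Ab that in auto)
    then show ?thesis by simp
  qed
  have front: "Gamma_u D \<subseteq> closure (Omega D)"
    and pos: "0 < hausdorff_measure (CARD('n) - 1) (Gamma_u D)"
    using D by (auto simp: biot_setting_def boundary_split_def frontier_def)
  have bdd: "bounded (Gamma_u D)"
    using front biot_Omega(2)[OF D] bounded_closure bounded_subset by blast
  have zero: "A *v x + b = 0" if "x \<in> Gamma_u D" for x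
    using that Abc clamped front by (metis subsetD)
  have A0: "A = 0"
    using hausdorff_measure_rigid_zero_set[OF A _ bdd zero] pos by fastforce
  have "Gamma_u D \<noteq> {}"
  proof
    assume "Gamma_u D = {}"
    obtain i j :: 'n where "i \<noteq> j"
      using dim by (metis card_2_iff' card_le_Suc0_iff_eq finite not_less_eq_eq numeral_2_eq_2 UNIV_I)
    then have "hausdorff_measure (CARD('n) - 1) ({} :: (real^'n) set) = 0"
      by (rule hausdorff_measure_graph_zero[where L=0]) auto
    then show False using pos \<open>Gamma_u D = {}\<close> by simp
  qed
  then have "b = 0" using zero A0 by auto
  then show ?thesis using Abc[OF x] A0 by simp
qed

lemma semi_inner_add:
  assumes "semi_inner V A" "semi_inner V B"
  shows "semi_inner V (\<lambda>u v. A u v + B u v)"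
  using assms by (auto simp: semi_inner_def lin_form_def algebra_simps)

lemma weak_jacobian_zero:
  assumes "open \<Omega>" "bounded \<Omega>" "in_H1_vec \<Omega> v" "\<And>x. x \<in> \<Omega> \<Longrightarrow> v x = 0"
  shows "AE x in lebesgue_on \<Omega>. weak_jacobian \<Omega> v x = 0"
proof -
  have "AE x in lebesgue_on \<Omega>. \<forall>i\<in>UNIV. weak_grad \<Omega> (\<lambda>x. v x $ i) x = 0"
    using assms by (intro AE_finite_allI weak_grad_zero) (auto simp: in_H1_vec_def)
  then show ?thesis by eventually_elim (simp add: weak_jacobian_def vec_eq_iff)
qed

lemma H1_norm_vec_sq:
  "(H1_norm_vec \<Omega> v)\<^sup>2 = L2_inner \<Omega> v v + L2_inner \<Omega> (weak_jacobian \<Omega> v) (weak_jacobian \<Omega> v)"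
  by (simp add: H1_norm_vec_def L2_norm_sq L2_inner_self_nonneg)

lemma ex_finite_separating_functionals:
  fixes D :: "('n::finite) biot_problem"
  assumes D: "biot_setting D"
  obtains F where "finite F" "\<And>l. l \<in> F \<Longrightarrow> lin_form (V_h D) l"
    "\<And>v x. v \<in> V_h D \<Longrightarrow> (\<forall>l\<in>F. l v = 0) \<Longrightarrow> x \<in> closure (Omega D) \<Longrightarrow> v x = 0"
proof -
  define G where "G E F \<longleftrightarrow> finite F \<and>
      (\<forall>f. poly_on (deg_k D) E f \<longrightarrow> (\<forall>x\<in>F. f x = 0) \<longrightarrow> (\<forall>x\<in>E. f x = 0))" for E F :: "(real^'n) set"
  have ex: "\<exists>F. G E F" for E
    unfolding G_def by (rule ex_finite_determining_points[of E "deg_k D"]) blast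
  define P where "P E = (SOME F. G E F)" for E
  have G: "G E (P E)" for E unfolding P_def by (rule someI_ex[OF ex])
  have P: "finite (P E)" "poly_on (deg_k D) E f \<Longrightarrow> (\<forall>x\<in>P E. f x = 0) \<Longrightarrow> x \<in> E \<Longrightarrow> f x = 0" for E f x
    using G[of E] unfolding G_def by blast+
  define F where "F = (\<lambda>(x, i) v. (v x :: real^'n) $ i) ` ((\<Union>E\<in>mesh D. P E) \<times> UNIV)"
  show thesis
  proof
    show "finite F" using mesh_finite[OF D] P(1) by (simp add: F_def)
    show "lin_form (V_h D) l" if "l \<in> F" for l
      using that by (auto simp: F_def lin_form_def axpy_def)
    fix v x assume v: "v \<in> V_h D" and F0: "\<forall>l\<in>F. l v = 0" and x: "x \<in> closure (Omega D)"
    obtain E where E: "E \<in> mesh D" "x \<in> E" using x mesh_Union[OF D] by blast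
    have "v x $ i = 0" for i
    proof (rule P(2)[OF _ _ E(2)])
      show "poly_on (deg_k D) E (\<lambda>x. v x $ i)" using v E by (simp add: V_h_def)
      show "\<forall>x\<in>P E. v x $ i = 0" using F0 E by (force simp: F_def)
    qed
    then show "v x = 0" by (simp add: vec_eq_iff)
  qed
qed

text \<open>The constant depends on the mesh. This is harmless here, because convergence of the iteration is
  considered for a fixed mesh.\<close>

lemma discrete_Korn:
  fixes D :: "('n::finite) biot_problem"
  assumes dim: "2 \<le> CARD('n)" and D: "biot_setting D"
  obtains C where "C \<ge> 0" "\<And>v. v \<in> V_h D \<Longrightarrow>
    (H1_norm_vec (Omega D) v)\<^sup>2 \<le> C * L2_inner (Omega D) (strain (Omega D) v) (strain (Omega D) v)"
proof -
  note \<Omega> = biot_Omega(1,2)[OF D]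
  let ?A = "\<lambda>u v. L2_inner (Omega D) (strain (Omega D) u) (strain (Omega D) v)"
  let ?J = "\<lambda>u v. L2_inner (Omega D) (weak_jacobian (Omega D) u) (weak_jacobian (Omega D) v)"
  let ?B = "\<lambda>u v. L2_inner (Omega D) u v + ?J u v"
  note V = lin_space_discrete(1)[OF D]
  note sub = discrete_subset(1)[of D]
  obtain F where F: "finite F" "\<And>l. l \<in> F \<Longrightarrow> lin_form (V_h D) l"
    "\<And>v x. v \<in> V_h D \<Longrightarrow> (\<forall>l\<in>F. l v = 0) \<Longrightarrow> x \<in> closure (Omega D) \<Longrightarrow> v x = 0"
    by (rule ex_finite_separating_functionals[OF D]) (rule that)
  have strainV: "L2_linear (Omega D) (V_h D) (strain (Omega D))"
    by (rule L2_linear_subset[OF strain_linear[OF \<Omega>] sub])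
  have jacV: "L2_linear (Omega D) (V_h D) (weak_jacobian (Omega D))"
    by (rule L2_linear_subset[OF weak_jacobian_linear[OF \<Omega>] sub])
  have idV: "L2_linear (Omega D) (V_h D) (\<lambda>u. u)"
    by (rule L2_linear_id) (use sub in_H1_vec_in_L2 in blast)
  have A: "semi_inner (V_h D) ?A" by (rule L2_linear_semi_inner[OF strainV V])
  have B: "semi_inner (V_h D) ?B"
    by (rule semi_inner_add[OF L2_linear_semi_inner[OF idV V] L2_linear_semi_inner[OF jacV V]])
  have nullJ: "AE x in lebesgue_on (Omega D). weak_jacobian (Omega D) v x = 0"
    if "v \<in> V_h D" "\<And>x. x \<in> closure (Omega D) \<Longrightarrow> v x = 0" for v
    using that sub closure_subset by (intro weak_jacobian_zero[OF \<Omega>]) blast+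
  have "\<exists>C\<ge>0. \<forall>v\<in>V_h D. ?B v v \<le> C * ?A v v"
  proof (rule semi_inner_dominated[OF F(1) V A B F(2)])
    fix v assume v: "v \<in> V_h D" "\<forall>l\<in>F. l v = 0"
    have "v x = 0" if "x \<in> closure (Omega D)" for x using F(3)[OF v that] .
    then have "AE x in lebesgue_on (Omega D). weak_jacobian (Omega D) v x = 0" by (rule nullJ[OF v(1)])
    then have "AE x in lebesgue_on (Omega D). strain (Omega D) v x = 0"
      by eventually_elim (simp add: strain_eq_sym_part linear_0[OF linear_sym_part])
    then show "?A v v = 0"
      using L2_inner_self_zero_iff strainV v(1) by (auto simp: L2_linear_def)
  next
    fix v assume v: "v \<in> V_h D" and "?A v v = 0"
    then have "AE x in lebesgue_on (Omega D). strain (Omega D) v x = 0"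
      using L2_inner_self_zero_iff strainV by (auto simp: L2_linear_def)
    then have zero: "v x = 0" if "x \<in> closure (Omega D)" for x
      using strain_zero_imp_zero[OF dim D v] that by blast
    have "?J v v = 0"
      using L2_inner_self_zero_iff nullJ[OF v zero] jacV v by (auto simp: L2_linear_def)
    moreover have "L2_inner (Omega D) v v = 0"
    proof -
      have "AE x in lebesgue_on (Omega D). v x = 0"
        using zero closure_subset by (intro AE_I2) auto
      then show ?thesis using L2_inner_self_zero_iff idV v by (auto simp: L2_linear_def)
    qed
    ultimately show "?B v v = 0" by simp
  qed
  then show ?thesis using that unfolding H1_norm_vec_sq by blast
qed

section \<open>BDF-2 differences\<close>

text \<open>The operator of the scheme for an arbitrary step and vector-valued sequences, written through \<open>axpy\<close> so
  that linear statements transfer to it directly.\<close>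

definition bdf :: "real \<Rightarrow> (nat \<Rightarrow> 'a \<Rightarrow> 'b::real_vector) \<Rightarrow> nat \<Rightarrow> 'a \<Rightarrow> 'b" where
  "bdf \<tau> y n = axpy (axpy (axpy (\<lambda>_. 0) (3 / (2 * \<tau>)) (y n)) (- 2 / \<tau>) (y (n - 1))) (1 / (2 * \<tau>)) (y (n - 2))"

lemma BDF2_eq_bdf: "BDF2 D = bdf (dt D)"
  by (auto simp: fun_eq_iff BDF2_def bdf_def axpy_def algebra_simps divide_simps)

lemma bdf_in:
  assumes "lin_space V" "y n \<in> V" "y (n - 1) \<in> V" "y (n - 2) \<in> V"
  shows "bdf \<tau> y n \<in> V"
  unfolding bdf_def by (intro lin_spaceD[OF assms(1)] assms)

lemma lin_form_bdf:
  assumes V: "lin_space V" and L: "lin_form V L" and y: "y n \<in> V" "y (n - 1) \<in> V" "y (n - 2) \<in> V"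
  shows "L (bdf \<tau> y n) = 3 / (2 * \<tau>) * L (y n) - 2 / \<tau> * L (y (n - 1)) + 1 / (2 * \<tau>) * L (y (n - 2))"
  unfolding bdf_def using lin_formD[OF L] lin_spaceD[OF V] y lin_form_zero[OF V L] by simp

text \<open>Four times \<open>A (y n) (3/2 y n - 2 y (n-1) + 1/2 y (n-2))\<close> equals \<open>Q n - Q (n - 1)\<close> plus the square of the
  second difference \<open>y n - 2 y (n-1) + y (n-2)\<close>, where \<open>Q n\<close> is the sum of the squares of \<open>y n\<close> and of
  \<open>2 y n - y (n-1)\<close>.\<close>

lemma bdf_G_stability:
  assumes V: "lin_space V" and A: "semi_inner V A" and \<tau>: "\<tau> > 0" and N: "1 \<le> N"
    and y: "\<And>n. n \<le> N \<Longrightarrow> y n \<in> V"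
  defines "Q \<equiv> \<lambda>n. 5 * A (y n) (y n) - 4 * A (y n) (y (n - 1)) + A (y (n - 1)) (y (n - 1))"
  shows "Q N - Q 1 \<le> 4 * \<tau> * (\<Sum>n=2..N. A (y n) (bdf \<tau> y n))"
  using N y
proof (induction N rule: nat_induct_at_least)
  case base
  then show ?case by simp
next
  case (Suc N)
  let ?a = "y (Suc N)" and ?b = "y N" and ?c = "y (N - 1)"
  have abc: "?a \<in> V" "?b \<in> V" "?c \<in> V" using Suc.prems by auto
  have ab: "axpy ?a (-2) ?b \<in> V" using lin_spaceD(2)[OF V] abc by blast
  have "0 \<le> A (axpy (axpy ?a (-2) ?b) 1 ?c) (axpy (axpy ?a (-2) ?b) 1 ?c)"
    using semi_inner_nonneg[OF A] lin_spaceD(2)[OF V ab abc(3)] by blast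
  also have "\<dots> = A ?a ?a - 4 * A ?a ?b + 4 * A ?b ?b + 2 * (A ?a ?c - 2 * A ?b ?c) + A ?c ?c"
    using semi_inner_axpy[OF V A ab abc(3), of 1] semi_inner_axpy[OF V A abc(1,2), of "-2"]
      semi_inner_left[OF A abc(1,2,3), of "-2"] by simp
  finally have sq: "0 \<le> A ?a ?a - 4 * A ?a ?b + 4 * A ?b ?b + 2 * (A ?a ?c - 2 * A ?b ?c) + A ?c ?c" .
  have "lin_form V (A ?a)"
    using semi_inner_right[OF V A _ _ abc(1)] by (simp add: lin_form_def)
  then have "A ?a (bdf \<tau> y (Suc N)) = 3 / (2 * \<tau>) * A ?a ?a - 2 / \<tau> * A ?a ?b + 1 / (2 * \<tau>) * A ?a ?c"
    using lin_form_bdf[OF V, of "A ?a" y "Suc N" \<tau>] abc by simp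
  then have "4 * \<tau> * A ?a (bdf \<tau> y (Suc N)) = 6 * A ?a ?a - 8 * A ?a ?b + 2 * A ?a ?c"
    using \<tau> by (simp add: field_simps)
  moreover have "Q N - Q 1 \<le> 4 * \<tau> * (\<Sum>n=2..N. A (y n) (bdf \<tau> y n))"
    using Suc by simp
  moreover have "(\<Sum>n=2..Suc N. A (y n) (bdf \<tau> y n)) =
      (\<Sum>n=2..N. A (y n) (bdf \<tau> y n)) + A ?a (bdf \<tau> y (Suc N))"
    using Suc.hyps by simp
  ultimately show ?case
    using sq by (simp add: Q_def algebra_simps)
qed

lemma sum_bdf_nonneg:
  assumes V: "lin_space V" and A: "semi_inner V A" and \<tau>: "\<tau> > 0" and N: "1 \<le> N"
    and y: "\<And>n. n \<le> N \<Longrightarrow> y n \<in> V" and y01: "y 0 = (\<lambda>_. 0)" "y 1 = (\<lambda>_. 0)"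
  shows "0 \<le> (\<Sum>n=2..N. A (y n) (bdf \<tau> y n))"
proof -
  let ?Q = "\<lambda>n. 5 * A (y n) (y n) - 4 * A (y n) (y (n - 1)) + A (y (n - 1)) (y (n - 1))"
  have z: "A (\<lambda>_. 0) (\<lambda>_. 0) = 0"
    using lin_form_zero[OF V, of "\<lambda>u. A u (\<lambda>_. 0)"] A lin_spaceD(1)[OF V] by (auto simp: semi_inner_def)
  have yN: "y N \<in> V" "y (N - 1) \<in> V" using y by auto
  have "0 \<le> A (axpy (y (N - 1)) (-2) (y N)) (axpy (y (N - 1)) (-2) (y N))"
    using semi_inner_nonneg[OF A] lin_spaceD(2)[OF V yN(2,1)] by blast
  then have "0 \<le> ?Q N"
    using semi_inner_axpy[OF V A yN(2,1), of "-2"] semi_inner_nonneg[OF A yN(1)]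
      semi_inner_sym[OF A yN] by simp
  moreover have "?Q 1 = 0" using y01 z by simp
  moreover have "?Q N - ?Q 1 \<le> 4 * \<tau> * (\<Sum>n=2..N. A (y n) (bdf \<tau> y n))"
    by (rule bdf_G_stability[OF V A \<tau> N y])
  ultimately have "0 \<le> 4 * \<tau> * (\<Sum>n=2..N. A (y n) (bdf \<tau> y n))" by linarith
  then show ?thesis using \<tau> by (simp add: zero_le_mult_iff)
qed

lemma bdf_solve:
  assumes "\<tau> \<noteq> 0"
  shows "y n = axpy (axpy (axpy (\<lambda>_. 0) (2 * \<tau> / 3) (bdf \<tau> y n)) (4 / 3) (y (n - 1))) (- 1 / 3) (y (n - 2))"
  using assms by (auto simp: fun_eq_iff bdf_def axpy_def algebra_simps)

lemma L2_norm_bdf_bound: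
  fixes y :: "nat \<Rightarrow> real^'n \<Rightarrow> 'b::euclidean_space"
  assumes \<tau>: "\<tau> > 0" and y: "in_L2 \<Omega> (y n)" "in_L2 \<Omega> (y (n - 1))" "in_L2 \<Omega> (y (n - 2))"
  shows "L2_norm \<Omega> (y n) \<le> 2 * \<tau> / 3 * L2_norm \<Omega> (bdf \<tau> y n) + 4 / 3 * L2_norm \<Omega> (y (n - 1))
    + 1 / 3 * L2_norm \<Omega> (y (n - 2))"
proof -
  have b: "in_L2 \<Omega> (bdf \<tau> y n)"
    using bdf_in[OF lin_space_L2, of y n \<Omega> \<tau>] y by simp
  let ?u = "axpy (\<lambda>_. 0) (2 * \<tau> / 3) (bdf \<tau> y n)"
  have u: "in_L2 \<Omega> ?u" by (intro in_L2_axpy in_L2_zero b)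
  have 0: "L2_norm \<Omega> (\<lambda>_. 0 :: 'b) = 0" by (simp add: L2_norm_def L2_inner_def)
  have "y n = axpy (axpy ?u (4 / 3) (y (n - 1))) (- 1 / 3) (y (n - 2))"
    using bdf_solve[of \<tau> y n] \<tau> by blast
  then have "L2_norm \<Omega> (y n) = L2_norm \<Omega> (axpy (axpy ?u (4 / 3) (y (n - 1))) (- 1 / 3) (y (n - 2)))"
    by (rule arg_cong)
  also have "\<dots> \<le> L2_norm \<Omega> (axpy ?u (4 / 3) (y (n - 1))) + \<bar>- 1 / 3\<bar> * L2_norm \<Omega> (y (n - 2))"
    by (rule L2_norm_axpy_le[OF in_L2_axpy[OF u y(2)] y(3)])
  also have "L2_norm \<Omega> (axpy ?u (4 / 3) (y (n - 1))) \<le> L2_norm \<Omega> ?u + \<bar>4 / 3\<bar> * L2_norm \<Omega> (y (n - 1))"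
    by (rule L2_norm_axpy_le[OF u y(2)])
  also have "L2_norm \<Omega> ?u \<le> L2_norm \<Omega> (\<lambda>_. 0 :: 'b) + \<bar>2 * \<tau> / 3\<bar> * L2_norm \<Omega> (bdf \<tau> y n)"
    by (rule L2_norm_axpy_le[OF in_L2_zero b])
  finally show ?thesis using 0 \<tau> by simp
qed

section \<open>The forms of the scheme\<close>

lemma semi_inner_scale:
  assumes "semi_inner V A" "0 \<le> c"
  shows "semi_inner V (\<lambda>u v. c * A u v)"
  using assms by (auto simp: semi_inner_def lin_form_def algebra_simps)

lemma semi_inner_a1:
  assumes D: "biot_setting D"
  shows "semi_inner (V_h D) (form_a1 D)"
proof -
  have "semi_inner (V_h D) (\<lambda>u v. L2_inner (Omega D) (strain (Omega D) u) (strain (Omega D) v))"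
    by (rule L2_linear_semi_inner[OF L2_linear_subset[OF strain_linear[OF biot_Omega(1,2)[OF D]]
          discrete_subset(1)] lin_space_discrete(1)[OF D]])
  then have "semi_inner (V_h D) (\<lambda>u v. 2 * mu D * L2_inner (Omega D) (strain (Omega D) u) (strain (Omega D) v))"
    by (rule semi_inner_scale) (use D in \<open>simp add: biot_setting_def\<close>)
  then show ?thesis by (simp add: form_a1_def[abs_def])
qed

lemma semi_inner_d:
  assumes D: "biot_setting D"
  shows "semi_inner (M_h D) (form_d D)"
proof -
  have "semi_inner (M_h D) (\<lambda>u v. L2_inner (Omega D) (weak_grad (Omega D) u) (weak_grad (Omega D) v))"
    by (rule L2_linear_semi_inner[OF L2_linear_subset[OF weak_grad_linear[OF biot_Omega(1,2)[OF D]]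
          discrete_subset(3)] lin_space_discrete(3)[OF D]])
  then have "semi_inner (M_h D) (\<lambda>u v. k_p D * L2_inner (Omega D) (weak_grad (Omega D) u) (weak_grad (Omega D) v))"
    by (rule semi_inner_scale) (use D in \<open>simp add: biot_setting_def\<close>)
  then show ?thesis by (simp add: form_d_def[abs_def])
qed

lemma lin_form_b_left:
  assumes D: "biot_setting D" and w: "w \<in> W_h D"
  shows "lin_form (V_h D) (\<lambda>v. form_b D v w)"
proof -
  have "lin_form (V_h D) (\<lambda>v. L2_inner (Omega D) (divergence (Omega D) v) w)"
    by (rule L2_linear_inner_left[OF L2_linear_subset[OF divergence_linear[OF biot_Omega(1,2)[OF D]]
          discrete_subset(1)] lin_space_discrete(1)[OF D]]) (use w discrete_subset(2)[of D] in blast)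
  then show ?thesis by (simp add: form_b_def[abs_def] L2_inner_commute[of "Omega D" w])
qed

lemma lin_form_b_right:
  assumes D: "biot_setting D" and v: "v \<in> V_h D"
  shows "lin_form (W_h D) (form_b D v)"
proof -
  have "in_L2 (Omega D) (divergence (Omega D) v)"
    using divergence_linear[OF biot_Omega(1,2)[OF D]] v discrete_subset(1)[of D]
    by (auto simp: L2_linear_def)
  then show ?thesis
    using discrete_subset(2)[of D] by (auto simp: lin_form_def form_b_def intro!: L2_inner_axpy_left)
qed

lemma M_h_in_L2: "q \<in> M_h D \<Longrightarrow> in_L2 (Omega D) q"
  by (simp add: M_h_def in_H1_def)

lemma W_h_in_L2: "w \<in> W_h D \<Longrightarrow> in_L2 (Omega D) w"
  by (simp add: W_h_def)

lemma form_ac_axpy: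
  assumes "in_L2 (Omega D) f" "in_L2 (Omega D) g" "in_L2 (Omega D) h"
  shows "form_a2 D (axpy f s g) h = form_a2 D f h + s * form_a2 D g h"
    and "form_a3 D (axpy f s g) h = form_a3 D f h + s * form_a3 D g h"
    and "form_c D (axpy f s g) h = form_c D f h + s * form_c D g h"
    and "form_c D h (axpy f s g) = form_c D h f + s * form_c D h g"
  using L2_inner_axpy_left[OF assms, of s]
  by (simp_all add: form_a2_def form_a3_def form_c_def L2_inner_commute[of _ h] distrib_left
      mult.left_commute[of s] L2_inner_commute[of _ h "axpy f s g"])

section \<open>The coupled elliptic problem\<close>

text \<open>The equations of the flow subproblem without force. Both the errors and their BDF-2 differences
  satisfy them, which is why they are stated for a single time level.\<close>

definition homogeneous_stokes ::
    "('n::finite) biot_problem \<Rightarrow> (real^'n \<Rightarrow> real^'n) \<Rightarrow> (real^'n \<Rightarrow> real) \<Rightarrow> (real^'n \<Rightarrow> real) \<Rightarrow> bool" where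
  "homogeneous_stokes D u \<xi> p \<longleftrightarrow> u \<in> V_h D \<and> \<xi> \<in> W_h D \<and> p \<in> M_h D \<and>
     (\<forall>v\<in>V_h D. form_a1 D u v = form_b D v \<xi>) \<and>
     (\<forall>w\<in>W_h D. form_b D u w + form_a2 D \<xi> w = form_c D p w)"

lemma homogeneous_stokes_axpy:
  assumes D: "biot_setting D" and h: "homogeneous_stokes D u \<xi> p" "homogeneous_stokes D u' \<xi>' p'"
  shows "homogeneous_stokes D (axpy u s u') (axpy \<xi> s \<xi>') (axpy p s p')"
proof -
  note lin = lin_space_discrete[OF D]
  have u: "u \<in> V_h D" "u' \<in> V_h D" and \<xi>: "\<xi> \<in> W_h D" "\<xi>' \<in> W_h D" and p: "p \<in> M_h D" "p' \<in> M_h D"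
    using h by (auto simp: homogeneous_stokes_def)
  note L2 = W_h_in_L2[OF \<xi>(1)] W_h_in_L2[OF \<xi>(2)] M_h_in_L2[OF p(1)] M_h_in_L2[OF p(2)]
  have "form_a1 D (axpy u s u') v = form_b D v (axpy \<xi> s \<xi>')" if v: "v \<in> V_h D" for v
    using semi_inner_left[OF semi_inner_a1[OF D] u v, of s] lin_formD[OF lin_form_b_right[OF D v] \<xi>, of s]
      h v by (simp add: homogeneous_stokes_def)
  moreover have "form_b D (axpy u s u') w + form_a2 D (axpy \<xi> s \<xi>') w = form_c D (axpy p s p') w"
    if w: "w \<in> W_h D" for w
  proof -
    have "form_b D u w + form_a2 D \<xi> w = form_c D p w" "form_b D u' w + form_a2 D \<xi>' w = form_c D p' w"
      using h w by (auto simp: homogeneous_stokes_def)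
    then show ?thesis
      using lin_formD[OF lin_form_b_left[OF D w] u, of s] form_ac_axpy(1)[OF L2(1,2) W_h_in_L2[OF w], of s]
        form_ac_axpy(3)[OF L2(3,4) W_h_in_L2[OF w], of s]
      by (simp add: algebra_simps flip: distrib_left)
  qed
  ultimately show ?thesis
    using lin_spaceD(2)[OF lin(1) u] lin_spaceD(2)[OF lin(2) \<xi>] lin_spaceD(2)[OF lin(3) p]
    by (simp add: homogeneous_stokes_def)
qed

lemma homogeneous_stokes_zero:
  assumes D: "biot_setting D"
  shows "homogeneous_stokes D (\<lambda>_. 0) (\<lambda>_. 0) (\<lambda>_. 0)"
proof -
  note lin = lin_space_discrete[OF D]
  note V = lin_spaceD(1)[OF lin(1)] and W = lin_spaceD(1)[OF lin(2)]
  have "form_a1 D (\<lambda>_. 0) v = 0" if "v \<in> V_h D" for v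
    using lin_form_zero[OF lin(1), of "\<lambda>u. form_a1 D u v"] semi_inner_a1[OF D] that
    by (simp add: semi_inner_def)
  moreover have "form_b D v (\<lambda>_. 0) = 0" for v by (simp add: form_b_def L2_inner_def)
  moreover have "form_b D (\<lambda>_. 0) w = 0" if "w \<in> W_h D" for w
    using lin_form_zero[OF lin(1) lin_form_b_left[OF D that]] .
  ultimately show ?thesis
    using V W lin_spaceD(1)[OF lin(3)]
    by (simp add: homogeneous_stokes_def form_a2_def form_c_def L2_inner_def)
qed

lemma homogeneous_stokes_bdf:
  assumes D: "biot_setting D"
    and "homogeneous_stokes D (u n) (\<xi> n) (p n)" "homogeneous_stokes D (u (n - 1)) (\<xi> (n - 1)) (p (n - 1))"
      "homogeneous_stokes D (u (n - 2)) (\<xi> (n - 2)) (p (n - 2))"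
  shows "homogeneous_stokes D (bdf \<tau> u n) (bdf \<tau> \<xi> n) (bdf \<tau> p n)"
  unfolding bdf_def by (intro homogeneous_stokes_axpy homogeneous_stokes_zero assms)

text \<open>Test with \<open>v = u\<close> and \<open>w = \<xi>\<close>; the form \<open>b\<close> cancels.\<close>

lemma homogeneous_stokes_energy:
  assumes D: "biot_setting D" and h: "homogeneous_stokes D u \<xi> p"
  shows "form_a1 D u u = alpha D / lam D * L2_inner (Omega D) p \<xi> - 1 / lam D * (L2_norm (Omega D) \<xi>)\<^sup>2"
proof -
  have "form_a1 D u u = form_b D u \<xi>" "form_b D u \<xi> + form_a2 D \<xi> \<xi> = form_c D p \<xi>"
    using h by (auto simp: homogeneous_stokes_def)
  then show ?thesis by (simp add: form_a2_def form_c_def L2_norm_sq)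
qed

lemma homogeneous_stokes_a1_le:
  assumes D: "biot_setting D" and h: "homogeneous_stokes D u \<xi> p"
  shows "form_a1 D u u \<le> alpha D / lam D * (L2_norm (Omega D) p * L2_norm (Omega D) \<xi>)"
proof -
  have pos: "0 < lam D" "0 < alpha D" using D by (auto simp: biot_setting_def)
  have "in_L2 (Omega D) p" "in_L2 (Omega D) \<xi>"
    using h M_h_in_L2 W_h_in_L2 by (auto simp: homogeneous_stokes_def)
  then have "alpha D / lam D * L2_inner (Omega D) p \<xi> \<le>
      alpha D / lam D * (L2_norm (Omega D) p * L2_norm (Omega D) \<xi>)"
    using pos by (intro mult_left_mono L2_inner_le) auto
  moreover have "0 \<le> 1 / lam D * (L2_norm (Omega D) \<xi>)\<^sup>2" using pos by simp
  ultimately show ?thesis using homogeneous_stokes_energy[OF D h] by linarith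
qed

text \<open>In the inf-sup condition, \<open>b v \<xi>\<close> is \<open>a\<^sub>1 u v\<close>, so Cauchy-Schwarz bounds the supremum by
  the norm of the strain of \<open>u\<close>.\<close>

lemma homogeneous_stokes_inf_sup:
  assumes D: "biot_setting D" and inf_sup: "inf_sup D \<beta>" and h: "homogeneous_stokes D u \<xi> p"
  shows "\<beta> * L2_norm (Omega D) \<xi> \<le> 2 * mu D * L2_norm (Omega D) (strain (Omega D) u)"
proof -
  let ?S = "L2_norm (Omega D) (strain (Omega D) u)"
  have mu: "mu D > 0" using D by (simp add: biot_setting_def)
  have u: "u \<in> V_h D" and \<xi>: "\<xi> \<in> W_h D" using h by (auto simp: homogeneous_stokes_def)
  have strain: "in_L2 (Omega D) (strain (Omega D) v)" if "v \<in> V_h D" for v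
    using strain_linear[OF biot_Omega(1,2)[OF D]] that discrete_subset(1)[of D]
    by (auto simp: L2_linear_def)
  have "form_b D v \<xi> / H1_norm_vec (Omega D) v \<le> 2 * mu D * ?S" if v: "v \<in> V_h D" for v
  proof -
    have "form_b D v \<xi> = form_a1 D u v" using h v by (simp add: homogeneous_stokes_def)
    also have "\<dots> \<le> 2 * mu D * (?S * L2_norm (Omega D) (strain (Omega D) v))"
      unfolding form_a1_def using mu by (intro mult_left_mono L2_inner_le strain u v) auto
    also have "\<dots> \<le> 2 * mu D * (?S * H1_norm_vec (Omega D) v)"
      using mu v discrete_subset(1)[of D]
      by (intro mult_left_mono L2_norm_strain_le biot_Omega[OF D] L2_norm_nonneg) auto
    finally have le: "form_b D v \<xi> \<le> 2 * mu D * ?S * H1_norm_vec (Omega D) v" by (simp add: mult.assoc)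
    show ?thesis
    proof (cases "H1_norm_vec (Omega D) v = 0")
      case True
      then show ?thesis using mu L2_norm_nonneg[of "Omega D" "strain (Omega D) u"] by simp
    next
      case False
      then have "H1_norm_vec (Omega D) v > 0" by (simp add: H1_norm_vec_def order_less_le)
      then show ?thesis using le by (simp add: divide_le_eq)
    qed
  qed
  then have "(SUP v\<in>{v\<in>V_h D. \<exists>x\<in>closure (Omega D). v x \<noteq> 0}.
      ereal (form_b D v \<xi> / H1_norm_vec (Omega D) v)) \<le> ereal (2 * mu D * ?S)"
    by (intro SUP_least) auto
  moreover have "ereal (\<beta> * L2_norm (Omega D) \<xi>) \<le> (SUP v\<in>{v\<in>V_h D. \<exists>x\<in>closure (Omega D). v x \<noteq> 0}.
      ereal (form_b D v \<xi> / H1_norm_vec (Omega D) v))"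
    using inf_sup \<xi> by (simp add: inf_sup_def)
  ultimately have "ereal (\<beta> * L2_norm (Omega D) \<xi>) \<le> ereal (2 * mu D * ?S)" by (rule order_trans[rotated])
  then show ?thesis by simp
qed

text \<open>The energy identity retains \<open>a\<^sub>1 u u\<close>, and the inf-sup condition bounds it from below by
  \<open>\<beta>\<^sup>2 / (2 \<mu>)\<close> times the square of the norm of \<open>\<xi>\<close>. This is where the constant comes from.\<close>

lemma homogeneous_stokes_estimate:
  assumes D: "biot_setting D" and \<beta>: "0 < \<beta>" "inf_sup D \<beta>" and h: "homogeneous_stokes D u \<xi> p"
  shows "(\<beta>\<^sup>2 / (2 * mu D) * lam D + 1) * L2_norm (Omega D) \<xi> \<le> alpha D * L2_norm (Omega D) p"
proof (cases "L2_norm (Omega D) \<xi> = 0")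
  case True
  then show ?thesis using D L2_norm_nonneg[of "Omega D" p] by (simp add: biot_setting_def)
next
  case False
  let ?S = "L2_norm (Omega D) (strain (Omega D) u)"
  define X where "X = L2_norm (Omega D) \<xi>"
  define P where "P = L2_norm (Omega D) p"
  have X: "X > 0" using False L2_norm_nonneg[of "Omega D" \<xi>] by (simp add: X_def)
  have pos: "0 < lam D" "0 < mu D" "0 < alpha D" using D by (auto simp: biot_setting_def)
  have "(\<beta> * X)\<^sup>2 \<le> (2 * mu D * ?S)\<^sup>2"
    using homogeneous_stokes_inf_sup[OF D \<beta>(2) h] \<beta>(1) X by (intro power_mono) (auto simp: X_def)
  also have "\<dots> = 2 * mu D * form_a1 D u u"
    by (simp add: form_a1_def L2_norm_sq[symmetric] power_mult_distrib power2_eq_square)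
  finally have "\<beta>\<^sup>2 / (2 * mu D) * X\<^sup>2 \<le> form_a1 D u u"
    using pos by (simp add: field_simps)
  moreover have "form_a1 D u u \<le> alpha D / lam D * (P * X) - 1 / lam D * X\<^sup>2"
  proof -
    have "in_L2 (Omega D) p" "in_L2 (Omega D) \<xi>"
      using h M_h_in_L2 W_h_in_L2 by (auto simp: homogeneous_stokes_def)
    then have "alpha D / lam D * L2_inner (Omega D) p \<xi> \<le> alpha D / lam D * (P * X)"
      unfolding P_def X_def using pos by (intro mult_left_mono L2_inner_le) auto
    then show ?thesis using homogeneous_stokes_energy[OF D h] by (simp add: X_def)
  qed
  ultimately have "\<beta>\<^sup>2 / (2 * mu D) * X\<^sup>2 \<le> alpha D / lam D * (P * X) - 1 / lam D * X\<^sup>2" by linarith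
  then have "lam D * (\<beta>\<^sup>2 / (2 * mu D) * X\<^sup>2) \<le> lam D * (alpha D / lam D * (P * X) - 1 / lam D * X\<^sup>2)"
    using pos by (intro mult_left_mono) auto
  also have "\<dots> = alpha D * P * X - X\<^sup>2" using pos by (simp add: right_diff_distrib)
  finally have "((\<beta>\<^sup>2 / (2 * mu D) * lam D + 1) * X) * X \<le> (alpha D * P) * X"
    by (simp add: algebra_simps power2_eq_square)
  then show ?thesis using X unfolding X_def P_def by simp
qed

section \<open>The iteration errors\<close>

lemma iter_error_initial: "n < 2 \<Longrightarrow> iter_error yf y i n = (\<lambda>_. 0)"
  by (simp add: iter_error_def)

lemma iter_error_axpy: "2 \<le> n \<Longrightarrow> iter_error yf y i n = axpy (yf n i) (-1) (y n)"
  by (simp add: iter_error_def axpy_def)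

lemma BDF2_iter_error:
  assumes "\<And>m. m < 2 \<Longrightarrow> yf m i = y m"
  shows "BDF2 D (iter_error yf y i) n = axpy (BDF2 D (\<lambda>m. yf m i) n) (-1) (BDF2 D y n)"
proof -
  have e: "iter_error yf y i m x = yf m i x - y m x" for m x
    using assms[of m] by (cases "m < 2") (simp_all add: iter_error_def)
  show ?thesis by (simp add: fun_eq_iff BDF2_def axpy_def e algebra_simps)
qed

locale decoupled_iteration =
  fixes D :: "('n::finite) biot_problem" and \<beta> :: real and u \<xi> p uf \<xi>f pf
  assumes setting: "biot_setting D" and \<beta>_pos: "0 < \<beta>" and inf_sup: "inf_sup D \<beta>"
    and mono: "monolithic_solution D u \<xi> p" and dec: "decoupled_iterates D \<xi> p uf \<xi>f pf"
begin

abbreviation "e\<^sub>u \<equiv> iter_error uf u"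
abbreviation "e\<^sub>\<xi> \<equiv> iter_error \<xi>f \<xi>"
abbreviation "e\<^sub>p \<equiv> iter_error pf p"

abbreviation "norm0 f \<equiv> L2_norm (Omega D) f"

text \<open>The constant \<open>C\<close> of the contraction factor, obtained from the inf-sup condition.\<close>

definition stokes_const :: real where "stokes_const = \<beta>\<^sup>2 / (2 * mu D)"

definition diffusion_factor :: real where "diffusion_factor = 1 / (c_0 D * lam D / (alpha D)\<^sup>2 + 1)"

lemma positive: "0 < lam D" "0 < mu D" "0 < alpha D" "0 < k_p D" "0 \<le> c_0 D" "0 < dt D" "2 \<le> steps D"
  using setting by (auto simp: biot_setting_def dt_def)

lemma stokes_const_pos: "0 < stokes_const"
  using positive \<beta>_pos by (simp add: stokes_const_def)

lemmas spaces = lin_space_discrete[OF setting]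

lemma in_spaces:
  assumes "n \<le> steps D"
  shows "\<xi> n \<in> W_h D" "p n \<in> M_h D" "\<xi>f n i \<in> W_h D" "1 \<le> i \<Longrightarrow> pf n i \<in> M_h D"
proof -
  show \<xi>: "\<xi> n \<in> W_h D" and p: "p n \<in> M_h D"
    using mono assms unfolding monolithic_solution_def by (cases "n < 2"; force)+
  show "\<xi>f n i \<in> W_h D"
  proof (cases "n < 2")
    case True
    have "\<forall>j\<ge>1. \<forall>n<2. \<xi>f n (j - 1) = \<xi> n" using dec unfolding decoupled_iterates_def by blast
    from this[rule_format, of "Suc i" n] show ?thesis using True \<xi> by simp
  next
    case False
    then have n: "n \<in> {2..steps D}" using assms by simp
    show ?thesis
      using dec n unfolding decoupled_iterates_def by (cases "i = 0") (blast, metis One_nat_def Suc_leI neq0_conv)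
  qed
  show "pf n i \<in> M_h D" if i: "1 \<le> i"
  proof (cases "n < 2")
    case True
    then show ?thesis using dec p i unfolding decoupled_iterates_def by force
  next
    case False
    then have "n \<in> {2..steps D}" using assms by simp
    then show ?thesis using dec i unfolding decoupled_iterates_def by blast
  qed
qed

lemma error_in_spaces:
  assumes "n \<le> steps D"
  shows "e\<^sub>\<xi> i n \<in> W_h D" "1 \<le> i \<Longrightarrow> e\<^sub>p i n \<in> M_h D"
  using in_spaces[OF assms] lin_spaceD[OF spaces(2)] lin_spaceD[OF spaces(3)]
  by (cases "n < 2"; simp add: iter_error_initial iter_error_axpy)+

lemma bdf_error_in_spaces:
  assumes "n \<le> steps D"
  shows "BDF2 D (e\<^sub>\<xi> i) n \<in> W_h D" "1 \<le> i \<Longrightarrow> BDF2 D (e\<^sub>p i) n \<in> M_h D"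
  unfolding BDF2_eq_bdf
  using assms by (auto intro!: bdf_in spaces error_in_spaces)

text \<open>At the initial time levels all errors vanish, so the equations hold there as well; this is what
  permits taking BDF-2 differences from \<open>n = 2\<close> on.\<close>

lemma error_stokes:
  assumes i: "1 \<le> i" and n: "n \<le> steps D"
  shows "homogeneous_stokes D (e\<^sub>u i n) (e\<^sub>\<xi> i n) (e\<^sub>p i n)"
proof (cases "n < 2")
  case True
  then show ?thesis using homogeneous_stokes_zero[OF setting] by (simp add: iter_error_initial)
next
  case False
  then have n2: "n \<in> {2..steps D}" using n by simp
  note sp = in_spaces[OF n] in_spaces(4)[OF n i]
  have m: "u n \<in> V_h D"
    "\<And>v. v \<in> V_h D \<Longrightarrow> form_a1 D (u n) v - form_b D v (\<xi> n) = L2_inner (Omega D) (force D (real n * dt D)) v"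
    "\<And>w. w \<in> W_h D \<Longrightarrow> form_b D (u n) w + form_a2 D (\<xi> n) w - form_c D (p n) w = 0"
    using mono n2 unfolding monolithic_solution_def by blast+
  have d: "uf n i \<in> V_h D"
    "\<And>v. v \<in> V_h D \<Longrightarrow> form_a1 D (uf n i) v - form_b D v (\<xi>f n i) = L2_inner (Omega D) (force D (real n * dt D)) v"
    "\<And>w. w \<in> W_h D \<Longrightarrow> form_b D (uf n i) w + form_a2 D (\<xi>f n i) w = form_c D (pf n i) w"
    using dec i n2 unfolding decoupled_iterates_def by blast+
  have e: "e\<^sub>u i n = axpy (uf n i) (-1) (u n)" "e\<^sub>\<xi> i n = axpy (\<xi>f n i) (-1) (\<xi> n)" "e\<^sub>p i n = axpy (pf n i) (-1) (p n)"
    using False by (simp_all add: iter_error_axpy)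
  have "form_a1 D (e\<^sub>u i n) v = form_b D v (e\<^sub>\<xi> i n)" if v: "v \<in> V_h D" for v
    unfolding e semi_inner_left[OF semi_inner_a1[OF setting] d(1) m(1) v]
      lin_formD[OF lin_form_b_right[OF setting v] sp(3,1)]
    using m(2)[OF v] d(2)[OF v] by simp
  moreover have "form_b D (e\<^sub>u i n) w + form_a2 D (e\<^sub>\<xi> i n) w = form_c D (e\<^sub>p i n) w" if w: "w \<in> W_h D" for w
    unfolding e lin_formD[OF lin_form_b_left[OF setting w] d(1) m(1)]
      form_ac_axpy(1)[OF W_h_in_L2[OF sp(3)] W_h_in_L2[OF sp(1)] W_h_in_L2[OF w]]
      form_ac_axpy(3)[OF M_h_in_L2[OF sp(5)] M_h_in_L2[OF sp(2)] W_h_in_L2[OF w]]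
    using m(3)[OF w] d(3)[OF w] by simp
  moreover have "e\<^sub>u i n \<in> V_h D" unfolding e by (rule lin_spaceD(2)[OF spaces(1) d(1) m(1)])
  ultimately show ?thesis
    using error_in_spaces[OF n] i by (simp add: homogeneous_stokes_def)
qed

lemma error_diffusion:
  assumes i: "1 \<le> i" and n: "n \<in> {2..steps D}" and q: "q \<in> M_h D"
  shows "form_a3 D (BDF2 D (e\<^sub>p i) n) q + form_d D (e\<^sub>p i n) q = form_c D q (BDF2 D (e\<^sub>\<xi> (i - 1)) n)"
proof -
  have le: "n \<le> steps D" "n - 1 \<le> steps D" "n - 2 \<le> steps D" using n by auto
  have p0: "\<And>m. m < 2 \<Longrightarrow> pf m i = p m" and \<xi>0: "\<And>m. m < 2 \<Longrightarrow> \<xi>f m (i - 1) = \<xi> m"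
    using dec i unfolding decoupled_iterates_def by blast+
  have m: "form_a3 D (BDF2 D p n) q - form_c D q (BDF2 D \<xi> n) + form_d D (p n) q =
      L2_inner (Omega D) (source D (real n * dt D)) q"
    using mono n q unfolding monolithic_solution_def by blast
  have d: "form_a3 D (BDF2 D (\<lambda>m. pf m i) n) q + form_d D (pf n i) q =
      L2_inner (Omega D) (source D (real n * dt D)) q + form_c D q (BDF2 D (\<lambda>m. \<xi>f m (i - 1)) n)"
    using dec i n q unfolding decoupled_iterates_def by blast
  have L2: "in_L2 (Omega D) (BDF2 D (\<lambda>m. pf m i) n)" "in_L2 (Omega D) (BDF2 D p n)"
    "in_L2 (Omega D) (BDF2 D (\<lambda>m. \<xi>f m (i - 1)) n)" "in_L2 (Omega D) (BDF2 D \<xi> n)"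
    unfolding BDF2_eq_bdf
    by (intro M_h_in_L2 bdf_in spaces(3) in_spaces(2,4) le i,
        intro M_h_in_L2 bdf_in spaces(3) in_spaces(2,4) le i,
        intro W_h_in_L2 bdf_in spaces(2) in_spaces(1,3) le,
        intro W_h_in_L2 bdf_in spaces(2) in_spaces(1,3) le)
  have e: "e\<^sub>p i n = axpy (pf n i) (-1) (p n)" using n by (simp add: iter_error_axpy)
  have ep: "BDF2 D (e\<^sub>p i) n = axpy (BDF2 D (\<lambda>m. pf m i) n) (-1) (BDF2 D p n)"
    by (rule BDF2_iter_error) (rule p0)
  have e\<xi>: "BDF2 D (e\<^sub>\<xi> (i - 1)) n = axpy (BDF2 D (\<lambda>m. \<xi>f m (i - 1)) n) (-1) (BDF2 D \<xi> n)"
    by (rule BDF2_iter_error) (rule \<xi>0)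
  show ?thesis
    unfolding ep e\<xi> e
      form_ac_axpy(2)[OF L2(1,2) M_h_in_L2[OF q]] form_ac_axpy(4)[OF L2(3,4) M_h_in_L2[OF q]]
      semi_inner_left[OF semi_inner_d[OF setting] in_spaces(4)[OF le(1) i] in_spaces(2)[OF le(1)] q]
    using m d by simp
qed

section \<open>The contraction\<close>

lemma stokes_step:
  assumes i: "1 \<le> i" and n: "n \<in> {2..steps D}"
  shows "(stokes_const * lam D + 1) * norm0 (BDF2 D (e\<^sub>\<xi> i) n) \<le> alpha D * norm0 (BDF2 D (e\<^sub>p i) n)"
proof -
  have "homogeneous_stokes D (bdf (dt D) (e\<^sub>u i) n) (bdf (dt D) (e\<^sub>\<xi> i) n) (bdf (dt D) (e\<^sub>p i) n)"
    by (intro homogeneous_stokes_bdf setting error_stokes i) (use n in auto)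
  from homogeneous_stokes_estimate[OF setting \<beta>_pos inf_sup this]
  show ?thesis by (simp add: BDF2_eq_bdf stokes_const_def)
qed

definition xi_diffs :: "nat \<Rightarrow> real" where "xi_diffs i = (\<Sum>n=2..steps D. (norm0 (BDF2 D (e\<^sub>\<xi> i) n))\<^sup>2)"

definition p_diffs :: "nat \<Rightarrow> real" where "p_diffs i = (\<Sum>n=2..steps D. (norm0 (BDF2 D (e\<^sub>p i) n))\<^sup>2)"

text \<open>Test with the BDF-2 difference of the pressure error. The diffusion terms sum to something nonnegative
  by G-stability, and Young's inequality with weight \<open>\<gamma>\<close> splits the coupling term.\<close>

lemma diffusion_step:
  assumes i: "1 \<le> i"
  shows "(alpha D)\<^sup>2 * p_diffs i \<le> diffusion_factor\<^sup>2 * xi_diffs (i - 1)"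
proof -
  define \<gamma> where "\<gamma> = c_0 D + (alpha D)\<^sup>2 / lam D"
  define \<delta> where "\<delta> = alpha D / lam D"
  have \<gamma>: "\<gamma> > 0" using positive by (simp add: \<gamma>_def add_nonneg_pos)
  have diffusion_factor: "diffusion_factor = alpha D * \<delta> / \<gamma>"
    using positive by (simp add: diffusion_factor_def \<gamma>_def \<delta>_def divide_simps power2_eq_square)
  have step: "\<gamma> / 2 * (norm0 (BDF2 D (e\<^sub>p i) n))\<^sup>2 + form_d D (e\<^sub>p i n) (BDF2 D (e\<^sub>p i) n)
      \<le> \<delta>\<^sup>2 / (2 * \<gamma>) * (norm0 (BDF2 D (e\<^sub>\<xi> (i - 1)) n))\<^sup>2" if n: "n \<in> {2..steps D}" for n
  proof -
    let ?z = "BDF2 D (e\<^sub>p i) n" and ?x = "BDF2 D (e\<^sub>\<xi> (i - 1)) n"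
    have z: "?z \<in> M_h D" and x: "?x \<in> W_h D" using bdf_error_in_spaces n i by auto
    have "\<gamma> * (norm0 ?z)\<^sup>2 + form_d D (e\<^sub>p i n) ?z = \<delta> * L2_inner (Omega D) ?z ?x"
      using error_diffusion[OF i n z] by (simp add: form_a3_def form_c_def \<gamma>_def \<delta>_def L2_norm_sq)
    also have "\<dots> \<le> \<delta> * (norm0 ?z * norm0 ?x)"
      using positive by (intro mult_left_mono L2_inner_le M_h_in_L2 W_h_in_L2 z x) (simp add: \<delta>_def)
    also have "\<dots> \<le> \<gamma> / 2 * (norm0 ?z)\<^sup>2 + \<delta>\<^sup>2 / (2 * \<gamma>) * (norm0 ?x)\<^sup>2"
    proof -
      have "0 \<le> (\<gamma> * norm0 ?z - \<delta> * norm0 ?x)\<^sup>2 / (2 * \<gamma>)" using \<gamma> by simp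
      also have "\<dots> = \<gamma> / 2 * (norm0 ?z)\<^sup>2 + \<delta>\<^sup>2 / (2 * \<gamma>) * (norm0 ?x)\<^sup>2 - \<delta> * (norm0 ?z * norm0 ?x)"
        using \<gamma> by (simp add: power2_eq_square field_simps)
      finally show ?thesis by simp
    qed
    finally show ?thesis by simp
  qed
  have "\<gamma> / 2 * p_diffs i + (\<Sum>n=2..steps D. form_d D (e\<^sub>p i n) (BDF2 D (e\<^sub>p i) n)) \<le> \<delta>\<^sup>2 / (2 * \<gamma>) * xi_diffs (i - 1)"
  proof -
    have "(\<Sum>n=2..steps D. \<gamma> / 2 * (norm0 (BDF2 D (e\<^sub>p i) n))\<^sup>2 + form_d D (e\<^sub>p i n) (BDF2 D (e\<^sub>p i) n))
        \<le> (\<Sum>n=2..steps D. \<delta>\<^sup>2 / (2 * \<gamma>) * (norm0 (BDF2 D (e\<^sub>\<xi> (i - 1)) n))\<^sup>2)"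
      by (rule sum_mono) (rule step)
    then show ?thesis unfolding p_diffs_def xi_diffs_def sum.distrib sum_distrib_left .
  qed
  moreover have "0 \<le> (\<Sum>n=2..steps D. form_d D (e\<^sub>p i n) (BDF2 D (e\<^sub>p i) n))"
    unfolding BDF2_eq_bdf
    by (rule sum_bdf_nonneg[OF spaces(3) semi_inner_d[OF setting] positive(6)])
      (use positive(7) error_in_spaces(2) i in \<open>auto simp: iter_error_initial\<close>)
  ultimately have "\<gamma> / 2 * p_diffs i \<le> \<delta>\<^sup>2 / (2 * \<gamma>) * xi_diffs (i - 1)" by linarith
  then have "p_diffs i \<le> (\<delta> / \<gamma>)\<^sup>2 * xi_diffs (i - 1)"
    using \<gamma> by (simp add: field_simps power2_eq_square)
  then have "(alpha D)\<^sup>2 * p_diffs i \<le> (alpha D)\<^sup>2 * ((\<delta> / \<gamma>)\<^sup>2 * xi_diffs (i - 1))"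
    by (rule mult_left_mono) simp
  also have "\<dots> = diffusion_factor\<^sup>2 * xi_diffs (i - 1)" by (simp add: diffusion_factor power_mult_distrib power_divide)
  finally show ?thesis .
qed

lemma contraction_factor_eq: "contraction_factor D stokes_const = diffusion_factor / (stokes_const * lam D + 1)"
  by (simp add: contraction_factor_def diffusion_factor_def)

lemma contraction_factor_bounds: "0 \<le> contraction_factor D stokes_const" "contraction_factor D stokes_const < 1"
proof -
  have a: "1 \<le> c_0 D * lam D / (alpha D)\<^sup>2 + 1" using positive by simp
  have b: "1 < stokes_const * lam D + 1" using positive stokes_const_pos by simp
  have "1 < (c_0 D * lam D / (alpha D)\<^sup>2 + 1) * (stokes_const * lam D + 1)"
  proof -
    have "0 \<le> stokes_const * lam D + 1" using b by linarith
    from less_le_trans[OF b mult_right_mono[OF a this, unfolded mult_1]] show ?thesis .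
  qed
  then show "0 \<le> contraction_factor D stokes_const" "contraction_factor D stokes_const < 1"
    by (simp_all add: contraction_factor_def)
qed

lemma contraction:
  assumes i: "1 \<le> i"
  shows "xi_diffs i \<le> (contraction_factor D stokes_const)\<^sup>2 * xi_diffs (i - 1)"
proof -
  have pos: "stokes_const * lam D + 1 > 0" using stokes_const_pos positive by (simp add: add_pos_pos)
  have "(stokes_const * lam D + 1)\<^sup>2 * xi_diffs i = (\<Sum>n=2..steps D. ((stokes_const * lam D + 1) * norm0 (BDF2 D (e\<^sub>\<xi> i) n))\<^sup>2)"
    by (simp add: xi_diffs_def sum_distrib_left power_mult_distrib)
  also have "\<dots> \<le> (\<Sum>n=2..steps D. (alpha D * norm0 (BDF2 D (e\<^sub>p i) n))\<^sup>2)"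
    using pos by (intro sum_mono power_mono stokes_step i) (auto intro: mult_nonneg_nonneg L2_norm_nonneg)
  also have "\<dots> = (alpha D)\<^sup>2 * p_diffs i"
    by (simp add: p_diffs_def sum_distrib_left power_mult_distrib)
  also have "\<dots> \<le> diffusion_factor\<^sup>2 * xi_diffs (i - 1)" by (rule diffusion_step[OF i])
  finally show ?thesis
    using pos by (simp add: contraction_factor_eq power_divide field_simps)
qed

section \<open>Convergence\<close>

lemma xi_diffs_tendsto: "xi_diffs \<longlonglongrightarrow> 0"
proof (rule Lim_null_comparison)
  let ?K = "contraction_factor D stokes_const"
  have S0: "0 \<le> xi_diffs i" for i by (simp add: xi_diffs_def sum_nonneg)
  have "xi_diffs i \<le> (?K\<^sup>2) ^ i * xi_diffs 0" for i
  proof (induction i)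
    case (Suc i)
    have "xi_diffs (Suc i) \<le> ?K\<^sup>2 * xi_diffs i" using contraction[of "Suc i"] by simp
    also have "\<dots> \<le> ?K\<^sup>2 * ((?K\<^sup>2) ^ i * xi_diffs 0)" using Suc by (rule mult_left_mono) simp
    finally show ?case by (simp add: mult.assoc)
  qed simp
  then show "\<forall>\<^sub>F i in sequentially. norm (xi_diffs i) \<le> (?K\<^sup>2) ^ i * xi_diffs 0" using S0 by simp
  have "?K\<^sup>2 < 1"
    using contraction_factor_bounds power_strict_mono[of ?K 1 2] by simp
  then have "(\<lambda>i. (?K\<^sup>2) ^ i) \<longlonglongrightarrow> 0" by (intro LIMSEQ_power_zero) simp
  then show "(\<lambda>i. (?K\<^sup>2) ^ i * xi_diffs 0) \<longlonglongrightarrow> 0" by (intro tendsto_mult_left_zero)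
qed

lemma bdf_xi_tendsto:
  assumes n: "n \<in> {2..steps D}"
  shows "(\<lambda>i. norm0 (BDF2 D (e\<^sub>\<xi> (i - 1)) n)) \<longlonglongrightarrow> 0"
proof -
  have "(norm0 (BDF2 D (e\<^sub>\<xi> i) n))\<^sup>2 \<le> xi_diffs i" for i
    unfolding xi_diffs_def using n by (intro member_le_sum) auto
  then have "norm0 (BDF2 D (e\<^sub>\<xi> i) n) \<le> sqrt (xi_diffs i)" for i by (rule real_le_rsqrt)
  then have le: "\<forall>\<^sub>F i in sequentially. norm (norm0 (BDF2 D (e\<^sub>\<xi> i) n)) \<le> sqrt (xi_diffs i)"
    by (simp add: L2_norm_nonneg)
  have "(\<lambda>i. sqrt (xi_diffs i)) \<longlonglongrightarrow> 0" using tendsto_real_sqrt[OF xi_diffs_tendsto] by simp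
  then have "(\<lambda>i. norm0 (BDF2 D (e\<^sub>\<xi> i) n)) \<longlonglongrightarrow> 0"
    by (rule Lim_null_comparison[OF le])
  then have "(\<lambda>i. norm0 (BDF2 D (e\<^sub>\<xi> (Suc i - 1)) n)) \<longlonglongrightarrow> 0" by simp
  then show ?thesis by (rule LIMSEQ_imp_Suc)
qed

lemma bdf_p_tendsto:
  assumes n: "n \<in> {2..steps D}"
  shows "(\<lambda>i. norm0 (BDF2 D (e\<^sub>p i) n)) \<longlonglongrightarrow> 0"
proof (rule Lim_null_comparison)
  let ?B = "\<lambda>i. sqrt (diffusion_factor\<^sup>2 / (alpha D)\<^sup>2 * xi_diffs (i - 1))"
  have "norm0 (BDF2 D (e\<^sub>p i) n) \<le> ?B i" if i: "1 \<le> i" for i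
  proof (rule real_le_rsqrt)
    have "(norm0 (BDF2 D (e\<^sub>p i) n))\<^sup>2 \<le> p_diffs i"
      unfolding p_diffs_def using n by (intro member_le_sum) auto
    also have "\<dots> \<le> diffusion_factor\<^sup>2 / (alpha D)\<^sup>2 * xi_diffs (i - 1)"
      using diffusion_step[OF i] positive by (simp add: field_simps)
    finally show "(norm0 (BDF2 D (e\<^sub>p i) n))\<^sup>2 \<le> diffusion_factor\<^sup>2 / (alpha D)\<^sup>2 * xi_diffs (i - 1)" .
  qed
  then show "\<forall>\<^sub>F i in sequentially. norm (norm0 (BDF2 D (e\<^sub>p i) n)) \<le> ?B i"
    by (auto simp: eventually_sequentially L2_norm_nonneg)
  have "(\<lambda>i. xi_diffs (Suc i - 1)) \<longlonglongrightarrow> 0" using xi_diffs_tendsto by simp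
  then have "(\<lambda>i. xi_diffs (i - 1)) \<longlonglongrightarrow> 0" by (rule LIMSEQ_imp_Suc)
  then have "(\<lambda>i. diffusion_factor\<^sup>2 / (alpha D)\<^sup>2 * xi_diffs (i - 1)) \<longlonglongrightarrow> 0" by (rule tendsto_mult_right_zero)
  from tendsto_real_sqrt[OF this] show "?B \<longlonglongrightarrow> 0" by simp
qed

text \<open>The value at level \<open>n\<close> is recovered from the BDF-2 difference and the two previous levels, starting
  from the vanishing initial errors.\<close>

lemma L2_p_tendsto:
  assumes "n \<le> steps D"
  shows "(\<lambda>i. norm0 (e\<^sub>p i n)) \<longlonglongrightarrow> 0"
  using assms
proof (induction n rule: less_induct)
  case (less n)
  show ?case
  proof (cases "n < 2")
    case True
    then show ?thesis by (simp add: iter_error_initial L2_norm_def L2_inner_def)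
  next
    case False
    let ?B = "\<lambda>i. 2 * dt D / 3 * norm0 (BDF2 D (e\<^sub>p i) n) + 4 / 3 * norm0 (e\<^sub>p i (n - 1)) + 1 / 3 * norm0 (e\<^sub>p i (n - 2))"
    have lim: "?B \<longlonglongrightarrow> 0"
      using less False by (intro tendsto_add_zero tendsto_mult_right_zero bdf_p_tendsto less.IH) auto
    have "norm0 (e\<^sub>p i n) \<le> ?B i" if "1 \<le> i" for i
      unfolding BDF2_eq_bdf using less.prems that
      by (intro L2_norm_bdf_bound positive M_h_in_L2 error_in_spaces) auto
    then show ?thesis
      by (intro Lim_null_comparison[OF _ lim]) (auto simp: eventually_sequentially L2_norm_nonneg)
  qed
qed

text \<open>Test with the pressure error itself: every other term contains a factor that tends to zero.\<close>

lemma grad_p_tendsto: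
  assumes n: "n \<in> {2..steps D}"
  shows "(\<lambda>i. form_d D (e\<^sub>p i n) (e\<^sub>p i n)) \<longlonglongrightarrow> 0"
proof (rule Lim_null_comparison)
  let ?\<gamma> = "c_0 D + (alpha D)\<^sup>2 / lam D"
  let ?B = "\<lambda>i. alpha D / lam D * (norm0 (e\<^sub>p i n) * norm0 (BDF2 D (e\<^sub>\<xi> (i - 1)) n)) +
    ?\<gamma> * (norm0 (BDF2 D (e\<^sub>p i) n) * norm0 (e\<^sub>p i n))"
  have le: "n \<le> steps D" using n by simp
  have "norm (form_d D (e\<^sub>p i n) (e\<^sub>p i n)) \<le> ?B i" if i: "1 \<le> i" for i
  proof -
    let ?z = "BDF2 D (e\<^sub>p i) n"
    have q: "e\<^sub>p i n \<in> M_h D" by (rule error_in_spaces(2)[OF le i])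
    have z: "?z \<in> M_h D" and x: "BDF2 D (e\<^sub>\<xi> (i - 1)) n \<in> W_h D" using bdf_error_in_spaces[OF le] i by auto
    have "axpy (\<lambda>_. 0) (-1) ?z \<in> M_h D" using lin_spaceD[OF spaces(3)] z by blast
    then have "L2_inner (Omega D) (axpy (\<lambda>_. 0) (-1) ?z) (e\<^sub>p i n) \<le>
        norm0 (axpy (\<lambda>_. 0) (-1) ?z) * norm0 (e\<^sub>p i n)"
      by (intro L2_inner_le M_h_in_L2 q)
    then have neg: "- L2_inner (Omega D) ?z (e\<^sub>p i n) \<le> norm0 ?z * norm0 (e\<^sub>p i n)"
      by (simp add: axpy_def L2_norm_def L2_inner_def)
    have "form_d D (e\<^sub>p i n) (e\<^sub>p i n) = alpha D / lam D * L2_inner (Omega D) (e\<^sub>p i n) (BDF2 D (e\<^sub>\<xi> (i - 1)) n)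
        + ?\<gamma> * (- L2_inner (Omega D) ?z (e\<^sub>p i n))"
      using error_diffusion[OF i n q] by (simp add: form_a3_def form_c_def)
    also have "\<dots> \<le> ?B i"
      using positive by (intro add_mono mult_left_mono neg L2_inner_le M_h_in_L2 W_h_in_L2 q x) auto
    finally show ?thesis using semi_inner_nonneg[OF semi_inner_d[OF setting] q] by simp
  qed
  then show "\<forall>\<^sub>F i in sequentially. norm (form_d D (e\<^sub>p i n) (e\<^sub>p i n)) \<le> ?B i"
    by (auto simp: eventually_sequentially)
  show "?B \<longlonglongrightarrow> 0"
    by (intro tendsto_add_zero tendsto_mult_right_zero tendsto_mult_zero L2_p_tendsto[OF le]
        bdf_xi_tendsto[OF n] bdf_p_tendsto[OF n])
qed

lemma H1_p_tendsto:
  assumes n: "n \<in> {2..steps D}"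
  shows "(\<lambda>i. H1_norm (Omega D) (e\<^sub>p i n)) \<longlonglongrightarrow> 0"
proof -
  have eq: "(L2_norm (Omega D) (weak_grad (Omega D) q))\<^sup>2 = 1 / k_p D * form_d D q q" for q
    using positive by (simp add: form_d_def L2_norm_sq)
  have "(\<lambda>i. (norm0 (e\<^sub>p i n))\<^sup>2 + 1 / k_p D * form_d D (e\<^sub>p i n) (e\<^sub>p i n)) \<longlonglongrightarrow> 0\<^sup>2 + 1 / k_p D * 0"
    using n by (intro tendsto_intros L2_p_tendsto grad_p_tendsto) auto
  from tendsto_real_sqrt[OF this] show ?thesis by (simp add: H1_norm_def eq)
qed

lemma L2_xi_tendsto:
  assumes n: "n \<in> {2..steps D}"
  shows "(\<lambda>i. norm0 (e\<^sub>\<xi> i n)) \<longlonglongrightarrow> 0"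
proof (rule Lim_null_comparison)
  have le: "n \<le> steps D" using n by simp
  let ?c = "alpha D / (stokes_const * lam D + 1)"
  have pos: "stokes_const * lam D + 1 > 0" using stokes_const_pos positive by (simp add: add_pos_pos)
  have "norm0 (e\<^sub>\<xi> i n) \<le> ?c * norm0 (e\<^sub>p i n)" if "1 \<le> i" for i
    using homogeneous_stokes_estimate[OF setting \<beta>_pos inf_sup error_stokes[OF that le], folded stokes_const_def] pos
    by (simp add: pos_le_divide_eq mult.commute)
  then show "\<forall>\<^sub>F i in sequentially. norm (norm0 (e\<^sub>\<xi> i n)) \<le> ?c * norm0 (e\<^sub>p i n)"
    by (auto simp: eventually_sequentially L2_norm_nonneg)
  show "(\<lambda>i. ?c * norm0 (e\<^sub>p i n)) \<longlonglongrightarrow> 0"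
    by (rule tendsto_mult_right_zero[OF L2_p_tendsto[OF le]])
qed

lemma H1_u_tendsto:
  assumes dim: "2 \<le> CARD('n)" and n: "n \<in> {2..steps D}"
  shows "(\<lambda>i. H1_norm_vec (Omega D) (e\<^sub>u i n)) \<longlonglongrightarrow> 0"
proof -
  have le: "n \<le> steps D" using n by simp
  obtain C where C: "C \<ge> 0" and korn: "\<And>v. v \<in> V_h D \<Longrightarrow>
      (H1_norm_vec (Omega D) v)\<^sup>2 \<le> C * L2_inner (Omega D) (strain (Omega D) v) (strain (Omega D) v)"
    using discrete_Korn[OF dim setting] by blast
  let ?B = "\<lambda>i. sqrt (C / (2 * mu D) * (alpha D / lam D * (norm0 (e\<^sub>p i n) * norm0 (e\<^sub>\<xi> i n))))"
  have "H1_norm_vec (Omega D) (e\<^sub>u i n) \<le> ?B i" if i: "1 \<le> i" for i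
  proof (rule real_le_rsqrt)
    note h = error_stokes[OF i le]
    then have "e\<^sub>u i n \<in> V_h D" by (simp add: homogeneous_stokes_def)
    from korn[OF this] have "(H1_norm_vec (Omega D) (e\<^sub>u i n))\<^sup>2 \<le> C / (2 * mu D) * form_a1 D (e\<^sub>u i n) (e\<^sub>u i n)"
      using positive by (simp add: form_a1_def)
    also have "\<dots> \<le> C / (2 * mu D) * (alpha D / lam D * (norm0 (e\<^sub>p i n) * norm0 (e\<^sub>\<xi> i n)))"
      using C positive by (intro mult_left_mono homogeneous_stokes_a1_le[OF setting h]) auto
    finally show "(H1_norm_vec (Omega D) (e\<^sub>u i n))\<^sup>2 \<le>
      C / (2 * mu D) * (alpha D / lam D * (norm0 (e\<^sub>p i n) * norm0 (e\<^sub>\<xi> i n)))" .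
  qed
  moreover have "0 \<le> H1_norm_vec (Omega D) v" for v by (simp add: H1_norm_vec_def)
  ultimately have bound: "\<forall>\<^sub>F i in sequentially. norm (H1_norm_vec (Omega D) (e\<^sub>u i n)) \<le> ?B i"
    by (auto simp: eventually_sequentially)
  have "(\<lambda>i. C / (2 * mu D) * (alpha D / lam D * (norm0 (e\<^sub>p i n) * norm0 (e\<^sub>\<xi> i n)))) \<longlonglongrightarrow> 0"
    by (intro tendsto_mult_right_zero tendsto_mult_zero L2_p_tendsto[OF le] L2_xi_tendsto[OF n])
  from tendsto_real_sqrt[OF this] have "?B \<longlonglongrightarrow> 0" by simp
  then show ?thesis by (rule Lim_null_comparison[OF bound])
qed

end

text \<open>The lower bound on the dimension enters through Korn's inequality: the zero set of a rigid motion is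
  covered by a graph over all but two coordinates.\<close>

theorem convergence_of_decoupled_iteration:
  fixes D :: "('n::finite) biot_problem"
  assumes dim: "2 \<le> CARD('n)"
    and "0 < \<beta>" "biot_setting D" "inf_sup D \<beta>"
      "monolithic_solution D u \<xi> p" "decoupled_iterates D \<xi> p uf \<xi>f pf"
  defines "K \<equiv> contraction_factor D (\<beta>\<^sup>2 / (2 * mu D))"
  shows "K < 1 \<and>
    (\<forall>i\<ge>1. (\<Sum>n=2..steps D. (L2_norm (Omega D) (BDF2 D (iter_error \<xi>f \<xi> i) n))\<^sup>2) \<le>
       K\<^sup>2 * (\<Sum>n=2..steps D. (L2_norm (Omega D) (BDF2 D (iter_error \<xi>f \<xi> (i - 1)) n))\<^sup>2)) \<and>
    (\<forall>n\<in>{2..steps D}.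
       (\<lambda>i. H1_norm_vec (Omega D) (iter_error uf u i n)) \<longlonglongrightarrow> 0 \<and>
       (\<lambda>i. L2_norm (Omega D) (iter_error \<xi>f \<xi> i n)) \<longlonglongrightarrow> 0 \<and>
       (\<lambda>i. H1_norm (Omega D) (iter_error pf p i n)) \<longlonglongrightarrow> 0)"
proof -
  interpret decoupled_iteration D \<beta> u \<xi> p uf \<xi>f pf
    by unfold_locales (fact assms)+
  show ?thesis
    using contraction_factor_bounds(2) contraction H1_u_tendsto[OF dim] L2_xi_tendsto H1_p_tendsto
    unfolding K_def stokes_const_def xi_diffs_def by blast
qed

theorem theorem3p1:
  shows "\<exists>C :: real \<Rightarrow> real \<Rightarrow> real.
      (\<forall>\<beta> \<mu>. 0 < \<beta> \<longrightarrow> 0 < \<mu> \<longrightarrow> 0 < C \<beta> \<mu>) \<and>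
      (\<forall>(\<beta>::real) (D :: 2 biot_problem) u \<xi> p uf \<xi>f pf.
        0 < \<beta> \<longrightarrow> biot_setting D \<longrightarrow> inf_sup D \<beta> \<longrightarrow>
        monolithic_solution D u \<xi> p \<longrightarrow> decoupled_iterates D \<xi> p uf \<xi>f pf \<longrightarrow>
        contraction_factor D (C \<beta> (mu D)) < 1 \<and>
        (\<forall>i\<ge>1. (\<Sum>n=2..steps D. (L2_norm (Omega D) (BDF2 D (iter_error \<xi>f \<xi> i) n))\<^sup>2) \<le>
           (contraction_factor D (C \<beta> (mu D)))\<^sup>2 *
           (\<Sum>n=2..steps D. (L2_norm (Omega D) (BDF2 D (iter_error \<xi>f \<xi> (i - 1)) n))\<^sup>2)) \<and>
        (\<forall>n\<in>{2..steps D}.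
           (\<lambda>i. H1_norm_vec (Omega D) (iter_error uf u i n)) \<longlonglongrightarrow> 0 \<and>
           (\<lambda>i. L2_norm (Omega D) (iter_error \<xi>f \<xi> i n)) \<longlonglongrightarrow> 0 \<and>
           (\<lambda>i. H1_norm (Omega D) (iter_error pf p i n)) \<longlonglongrightarrow> 0)) \<and>
      (\<forall>(\<beta>::real) (D :: 3 biot_problem) u \<xi> p uf \<xi>f pf.
        0 < \<beta> \<longrightarrow> biot_setting D \<longrightarrow> inf_sup D \<beta> \<longrightarrow>
        monolithic_solution D u \<xi> p \<longrightarrow> decoupled_iterates D \<xi> p uf \<xi>f pf \<longrightarrow>
        contraction_factor D (C \<beta> (mu D)) < 1 \<and>
        (\<forall>i\<ge>1. (\<Sum>n=2..steps D. (L2_norm (Omega D) (BDF2 D (iter_error \<xi>f \<xi> i) n))\<^sup>2) \<le>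
           (contraction_factor D (C \<beta> (mu D)))\<^sup>2 *
           (\<Sum>n=2..steps D. (L2_norm (Omega D) (BDF2 D (iter_error \<xi>f \<xi> (i - 1)) n))\<^sup>2)) \<and>
        (\<forall>n\<in>{2..steps D}.
           (\<lambda>i. H1_norm_vec (Omega D) (iter_error uf u i n)) \<longlonglongrightarrow> 0 \<and>
           (\<lambda>i. L2_norm (Omega D) (iter_error \<xi>f \<xi> i n)) \<longlonglongrightarrow> 0 \<and>
           (\<lambda>i. H1_norm (Omega D) (iter_error pf p i n)) \<longlonglongrightarrow> 0))"
proof (rule exI[of _ "\<lambda>\<beta> \<mu>. \<beta>\<^sup>2 / (2 * \<mu>)"], rule conjI[OF _ conjI], goal_cases)
  case 1
  show ?case by simp
next
  case 2
  show ?case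
    by (intro allI impI, rule convergence_of_decoupled_iteration) (simp, assumption+)
next
  case 3
  show ?case
    by (intro allI impI, rule convergence_of_decoupled_iteration) (simp, assumption+)
qed

end
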